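(* Let $\mu$ be a probability measure on $\mathbb{R}$ such that $\int \exp[\theta x^2]\,\mu(dx)<\infty$ for every $\theta>0$. For each $n$, let $X=\{x_{i,j}\}$ be a random real symmetric $n\times n$ matrix whose entries $x_{i,j}$, $j\ge i$, are independent with common distribution $\mu$, let $k(x,y)=\sum_{i,j=1}^n x_{i,j}\mathbf 1_{J^n_i}(x)\mathbf 1_{J^n_j}(y)$ with $J^n_i=[\frac{i-1}{n},\frac in]$, and let $\tilde Q_n$ be the law of the orbit $\tilde k$ of $k$ in $\tilde{\mathcal K}$. Then $\tilde Q_n$ satisfies a large deviation principle on $\tilde{\mathcal K}$ (with the topology of the cut distance $\tilde d_\square$) with speed $n^2$ and rate function $I$: for every closed $C\subset\tilde{\mathcal K}$, $$\limsup_{n\to\infty}\frac1{n^2}\log\tilde Q_n(C)\le-\inf_{\tilde k\in C}I(\tilde k),$$ and for every open $U\subset\tilde{\mathcal K}$, $$\liminf_{n\to\infty}\frac1{n^2}\log\tilde Q_n(U)\ge-\inf_{\tilde k\in U}I(\tilde k).$$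
   Context: $M(\theta)=\int e^{\theta x}\mu(dx)$, $h(x)=\sup_\theta[\theta x-\log M(\theta)]$. $\mathcal{K}$ is the space of measurable symmetric kernels $k$ on $D=[0,1]^2$ with $\int_D k^2<\infty$, and $I(k)=\frac12\int_0^1\int_0^1h(k(x,y))\,dxdy$. The cut distance on $\mathcal K$ is $d_\square(k_1,k_2)=\sup_{A,B}\left|\int_{A\times B}(k_1-k_2)\,dxdy\right|$, the supremum over Borel sets $A,B\subset[0,1]$. $G$ is the group of measure-preserving bijections $\sigma$ of $[0,1]$, acting on $\mathcal K$ by $(\sigma k)(x,y)=k(\sigma x,\sigma y)$; $\tilde{\mathcal K}=\mathcal K/G$ is the set of orbits, with distance $\tilde d_\square(\tilde k_1,\tilde k_2)=\inf_{\sigma\in G}d_\square(\sigma k_1,k_2)$. Since $I(\sigma k)=I(k)$, $I$ is well defined on $\tilde{\mathcal K}$. *)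

theory Defs
  imports "HOL-Probability.Probability"
begin

definition unitsq :: "(real \<times> real) set" where
  "unitsq = {0..1} \<times> {0..1}"

(* The space K of kernels. Kernels are represented as functions on R^2 that vanish
   outside [0,1]^2 (canonical representatives). *)
definition kernels :: "(real \<times> real \<Rightarrow> real) set" where
  "kernels = {k. k \<in> borel_measurable borel
              \<and> (\<forall>p. p \<notin> unitsq \<longrightarrow> k p = 0)
              \<and> (\<forall>x y. k (x, y) = k (y, x))
              \<and> integrable lborel (\<lambda>p. (k p)\<^sup>2)}"

definition cut_dist :: "(real \<times> real \<Rightarrow> real) \<Rightarrow> (real \<times> real \<Rightarrow> real) \<Rightarrow> real" where
  "cut_dist k1 k2 =
     (SUP AB \<in> {(A, B). A \<in> sets borel \<and> A \<subseteq> {0..1} \<and> B \<in> sets borel \<and> B \<subseteq> {0..1}}.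
        \<bar>LINT p : (fst AB \<times> snd AB) | lborel. (k1 p - k2 p)\<bar>)"

definition mp_bij :: "(real \<Rightarrow> real) \<Rightarrow> bool" where
  "mp_bij \<sigma> \<longleftrightarrow> bij_betw \<sigma> {0..1} {0..1} \<and>
     (\<forall>A \<in> sets borel. A \<subseteq> {0..1} \<longrightarrow>
        \<sigma> -` A \<inter> {0..1} \<in> sets borel \<and> \<sigma> ` A \<in> sets borel \<and>
        emeasure lborel (\<sigma> -` A \<inter> {0..1}) = emeasure lborel A)"

definition act :: "(real \<Rightarrow> real) \<Rightarrow> (real \<times> real \<Rightarrow> real) \<Rightarrow> (real \<times> real \<Rightarrow> real)" where
  "act \<sigma> k = (\<lambda>(x, y). if (x, y) \<in> unitsq then k (\<sigma> x, \<sigma> y) else 0)"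

definition orbit :: "(real \<times> real \<Rightarrow> real) \<Rightarrow> (real \<times> real \<Rightarrow> real) set" where
  "orbit k = {act \<sigma> k | \<sigma>. mp_bij \<sigma>}"

definition Ktil :: "(real \<times> real \<Rightarrow> real) set set" where
  "Ktil = orbit ` kernels"

definition rep :: "(real \<times> real \<Rightarrow> real) set \<Rightarrow> (real \<times> real \<Rightarrow> real)" where
  "rep Ob = (SOME k. k \<in> Ob)"

definition dtil :: "(real \<times> real \<Rightarrow> real) set \<Rightarrow> (real \<times> real \<Rightarrow> real) set \<Rightarrow> real" where
  "dtil Ob1 Ob2 = (INF \<sigma> \<in> {\<sigma>. mp_bij \<sigma>}. cut_dist (act \<sigma> (rep Ob1)) (rep Ob2))"

definition til_open :: "(real \<times> real \<Rightarrow> real) set set \<Rightarrow> bool" where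
  "til_open U \<longleftrightarrow> U \<subseteq> Ktil \<and>
     (\<forall>u \<in> U. \<exists>e>0. \<forall>v \<in> Ktil. dtil u v < e \<longrightarrow> v \<in> U)"

definition til_closed :: "(real \<times> real \<Rightarrow> real) set set \<Rightarrow> bool" where
  "til_closed C \<longleftrightarrow> C \<subseteq> Ktil \<and> til_open (Ktil - C)"

definition mgf :: "real measure \<Rightarrow> real \<Rightarrow> real" where
  "mgf \<mu> \<theta> = (\<integral>x. exp (\<theta> * x) \<partial>\<mu>)"

definition cramer :: "real measure \<Rightarrow> real \<Rightarrow> ereal" where
  "cramer \<mu> x = (SUP \<theta>. ereal (\<theta> * x - ln (mgf \<mu> \<theta>)))"

definition rateI :: "real measure \<Rightarrow> (real \<times> real \<Rightarrow> real) \<Rightarrow> ereal" where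
  "rateI \<mu> k = ereal (1/2) *
     enn2ereal (\<integral>\<^sup>+ p. e2ennreal (cramer \<mu> (k p)) * indicator unitsq p \<partial>lborel)"

definition rateItil :: "real measure \<Rightarrow> (real \<times> real \<Rightarrow> real) set \<Rightarrow> ereal" where
  "rateItil \<mu> Ob = rateI \<mu> (rep Ob)"

definition upper_idx :: "nat \<Rightarrow> (nat \<times> nat) set" where
  "upper_idx n = {(i, j). i \<le> j \<and> j < n}"

(* J^n_i = [(i-1)/n, i/n], here 0-based: [i/n, (i+1)/n] *)
definition Jint :: "nat \<Rightarrow> nat \<Rightarrow> real set" where
  "Jint n i = {real i / real n .. (real i + 1) / real n}"

definition kmat :: "nat \<Rightarrow> (nat \<times> nat \<Rightarrow> real) \<Rightarrow> (real \<times> real \<Rightarrow> real)" where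
  "kmat n X = (\<lambda>(x, y). \<Sum>i<n. \<Sum>j<n.
      X (min i j, max i j) * indicator (Jint n i) x * indicator (Jint n j) y)"

definition Qtil :: "real measure \<Rightarrow> nat \<Rightarrow> (real \<times> real \<Rightarrow> real) set set \<Rightarrow> real" where
  "Qtil \<mu> n C = measure (PiM (upper_idx n) (\<lambda>_. \<mu>))
      {X \<in> space (PiM (upper_idx n) (\<lambda>_. \<mu>)). orbit (kmat n X) \<in> C}"

definition elog :: "real \<Rightarrow> ereal" where
  "elog p = (if p \<le> 0 then -\<infinity> else ereal (ln p))"

end

theory Submission
  imports Defs
begin

text \<open>Since \<open>exp (x\<^sup>2)\<close> is integrable, the Cramer function grows quadratically, so that kernels of
bounded rate are bounded in \<open>L\<^sup>2\<close>, and the random matrix is so up to a negligible probability.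
By weak regularity such a matrix is close in cut norm to its block averages over a bounded number of
classes. For each of the \<open>exp (O (n))\<close> labellings Chernoff's inequality bounds the probability of given
block averages by the rate of the resulting step kernel, which still lies near the closed set; since the
level sets of the rate function are compact in the cut distance, the infimum over a small neighbourhood
of a closed set is close to the infimum over the set. For the lower bound the entries are reweighted
exponentially so that their means become (quantized) cell averages of the target kernel; under the new
weight a union bound over the \<open>4 ^ n\<close> rectangles shows that the matrix is close to the target.\<close>

section \<open>Grid cells and cell averages\<close>

text \<open>The cut distance is coarse enough for the union bound: a net in L^1 would have a size
  exponential in n^2, which the speed does not absorb, whereas labellings with a number of labels
  independent of n are negligible. For a fixed labelling the block averages are linear in the
  entries, and a tilt that is constant on blocks has the same pairing with a matrix as with its
  averages (\<open>bavg_orthogonal\<close>); hence a half-space for the averages is one for the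
  independent entries. Symmetry enters twice: an off-diagonal entry occurs in two cells, whence the
  factor 1/2 in the rate, and the n diagonal entries are absorbed by convexity in the upper bound
  and are of lower order in the lower one. Two features of the definitions shape the rest.
  \<open>dtil\<close> is evaluated at chosen representatives, so the work is done with the relation
  \<open>near\<close> between arbitrary kernels. And \<open>Qtil\<close> is defined for all sets,
  measurable or not: the upper bound uses measurable supersets only, the lower bound needs open
  events to be measurable.\<close>

definition usq :: "(real \<times> real) measure" where
  "usq = density lborel (\<lambda>p. ennreal (indicator unitsq p))"

section \<open>The uniform measure on the unit square\<close>

lemma unitsq_borel [measurable]: "unitsq \<in> sets borel"
  unfolding unitsq_def by (simp add: borel_closed closed_Times)

lemma sets_usq [simp, measurable_cong]: "sets usq = sets borel"
  by (simp add: usq_def)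

lemma space_usq [simp]: "space usq = UNIV"
  by (simp add: usq_def)

lemma borel_measurable_usq [simp]: "borel_measurable usq = borel_measurable borel"
  by (rule measurable_cong_sets) simp_all

lemma emeasure_lborel_Times:
  fixes A B :: "real set"
  assumes "A \<in> sets borel" "B \<in> sets borel"
  shows "emeasure lborel (A \<times> B) = emeasure lborel A * emeasure lborel B"
proof -
  have "emeasure (lborel \<Otimes>\<^sub>M lborel) (A \<times> B) = emeasure lborel A * emeasure lborel B"
    by (rule lborel.emeasure_pair_measure_Times) (use assms in auto)
  then show ?thesis by (simp add: lborel_prod)
qed

lemma Times_borel:
  fixes A B :: "real set"
  assumes "A \<in> sets borel" "B \<in> sets borel"
  shows "A \<times> B \<in> sets borel"
proof -
  have "A \<times> B \<in> sets (borel \<Otimes>\<^sub>M borel)" using assms by auto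
  then show ?thesis by (simp only: borel_prod)
qed

lemma emeasure_usq_Times:
  fixes A B :: "real set"
  assumes "A \<in> sets borel" "B \<in> sets borel" "A \<subseteq> {0..1}" "B \<subseteq> {0..1}"
  shows "emeasure usq (A \<times> B) = emeasure lborel A * emeasure lborel B"
proof -
  have AB: "A \<times> B \<in> sets borel" by (rule Times_borel) (use assms in auto)
  have "emeasure usq (A \<times> B) = (\<integral>\<^sup>+ p. ennreal (indicator unitsq p) * indicator (A \<times> B) p \<partial>lborel)"
    unfolding usq_def by (rule emeasure_density) (use AB in auto)
  also have "\<dots> = (\<integral>\<^sup>+ p. indicator (A \<times> B) p \<partial>lborel)"
    by (rule nn_integral_cong) (use assms in \<open>auto simp: unitsq_def indicator_def\<close>)
  also have "\<dots> = emeasure lborel (A \<times> B)" using AB by simp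
  finally show ?thesis using assms by (simp add: emeasure_lborel_Times)
qed

lemma prob_space_usq: "prob_space usq"
proof
  have "emeasure usq UNIV = (\<integral>\<^sup>+ p. ennreal (indicator unitsq p) * indicator UNIV p \<partial>lborel)"
    unfolding usq_def by (rule emeasure_density) auto
  also have "\<dots> = emeasure lborel unitsq" by (simp add: ennreal_indicator)
  also have "\<dots> = 1" unfolding unitsq_def by (subst emeasure_lborel_Times) auto
  finally show "emeasure usq (space usq) = 1" by simp
qed

interpretation usq: prob_space usq by (rule prob_space_usq)

lemma nn_integral_usq:
  assumes "f \<in> borel_measurable borel"
  shows "(\<integral>\<^sup>+ p. f p \<partial>usq) = (\<integral>\<^sup>+ p. f p * indicator unitsq p \<partial>lborel)"
  unfolding usq_def using assms
  by (subst nn_integral_density) (auto simp: ennreal_indicator mult.commute)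

lemma integrable_usq_iff:
  fixes f :: "real \<times> real \<Rightarrow> real"
  assumes "f \<in> borel_measurable borel"
  shows "integrable usq f \<longleftrightarrow> integrable lborel (\<lambda>p. indicator unitsq p * f p)"
  unfolding usq_def using assms by (subst integrable_density) auto

lemma integral_usq:
  fixes f :: "real \<times> real \<Rightarrow> real"
  assumes "f \<in> borel_measurable borel"
  shows "(\<integral> p. f p \<partial>usq) = (\<integral> p. indicator unitsq p * f p \<partial>lborel)"
  unfolding usq_def using assms by (subst integral_density) auto

lemma set_integral_usq:
  fixes f :: "real \<times> real \<Rightarrow> real"
  assumes "f \<in> borel_measurable borel" "A \<in> sets borel" "B \<in> sets borel" "A \<subseteq> {0..1}" "B \<subseteq> {0..1}"
  shows "(LINT p : (A \<times> B) | lborel. f p) = (\<integral>p. indicator (A \<times> B) p * f p \<partial>usq)"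
proof -
  have [measurable]: "A \<times> B \<in> sets borel" by (rule Times_borel) (use assms in auto)
  note assms(1)[measurable]
  have "(\<integral>p. indicator (A \<times> B) p * f p \<partial>usq) = (\<integral>p. indicator unitsq p * (indicator (A \<times> B) p * f p) \<partial>lborel)"
    by (rule integral_usq) measurable
  also have "\<dots> = (\<integral>p. indicator (A \<times> B) p * f p \<partial>lborel)"
    by (rule Bochner_Integration.integral_cong) (use assms in \<open>auto simp: unitsq_def indicator_def\<close>)
  finally show ?thesis by (simp add: set_lebesgue_integral_def)
qed

text \<open>The half-open cells leave out the edges x = 1 and y = 1; discarding this null set is
  what turns identities of step kernels into almost everywhere statements.\<close>

lemma AE_usq_Ico: "AE p in usq. p \<in> {0..<1} \<times> {0..<1}"
proof -
  have "emeasure usq ({0..<1} \<times> {0..<1}) = 1"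
    by (subst emeasure_usq_Times) auto
  moreover have "{0..<1::real} \<times> {0..<1::real} \<in> sets usq" by (simp add: Times_borel)
  ultimately show ?thesis
    by (intro usq.AE_prob_1) (simp only: measure_def enn2real_1)
qed

text \<open>Half-open, unlike \<open>Jint\<close>: the cells of a grid are then disjoint, and the
  cell of a point of [0,1) is found by a floor (\<open>cell\<close>). The price is that
  \<open>kmat\<close> agrees with a step kernel only almost everywhere.\<close>

definition Ic :: "nat \<Rightarrow> nat \<Rightarrow> real set" where
  "Ic n i = {real i / real n ..< (real i + 1) / real n}"

definition cell :: "nat \<Rightarrow> real \<Rightarrow> nat" where
  "cell n x = nat \<lfloor>real n * x\<rfloor>"

definition cellsq :: "nat \<Rightarrow> nat \<Rightarrow> nat \<Rightarrow> (real \<times> real) set" where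
  "cellsq n i j = Ic n i \<times> Ic n j"

lemma Ic_borel [measurable]: "Ic n i \<in> sets borel" by (simp add: Ic_def)

lemma cellsq_borel [measurable]: "cellsq n i j \<in> sets borel"
  by (simp add: cellsq_def Times_borel)

lemma mem_Ic_iff:
  assumes "n > 0" "0 \<le> x"
  shows "x \<in> Ic n i \<longleftrightarrow> cell n x = i"
proof -
  have "x \<in> Ic n i \<longleftrightarrow> real i \<le> real n * x \<and> real n * x < real i + 1"
    using assms by (auto simp: Ic_def field_simps)
  also have "\<dots> \<longleftrightarrow> \<lfloor>real n * x\<rfloor> = int i" by (simp add: floor_eq_iff)
  also have "\<dots> \<longleftrightarrow> cell n x = i" using assms unfolding cell_def by auto
  finally show ?thesis .
qed

lemma cell_less:
  assumes "n > 0" "0 \<le> x" "x < 1"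
  shows "cell n x < n"
proof -
  have "real n * x < real n" using assms by simp
  then have "\<lfloor>real n * x\<rfloor> < int n" by (simp add: floor_less_iff)
  then show ?thesis unfolding cell_def using assms by linarith
qed

lemma Ic_subset: "i < n \<Longrightarrow> Ic n i \<subseteq> {0..<1}"
proof
  fix x assume *: "i < n" "x \<in> Ic n i"
  then have 1: "(real i + 1) / real n \<le> 1" "0 \<le> real i / real n" by (auto simp: field_simps)
  have "real i / real n \<le> x" "x < (real i + 1) / real n" using * by (auto simp: Ic_def)
  with 1 have "0 \<le> x" "x < 1" by linarith+
  then show "x \<in> {0..<1}" by simp
qed

lemma cell_Ic: "i < n \<Longrightarrow> x \<in> Ic n i \<Longrightarrow> cell n x = i"
  using Ic_subset[of i n] mem_Ic_iff[of n x i] by auto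

lemma emeasure_Ic: "i < n \<Longrightarrow> emeasure lborel (Ic n i) = ennreal (1 / real n)"
  unfolding Ic_def by (subst emeasure_lborel_Ico) (auto simp: diff_divide_distrib[symmetric] divide_right_mono)

lemma emeasure_cellsq:
  assumes "i < n" "j < n"
  shows "emeasure usq (cellsq n i j) = ennreal (1 / (real n)\<^sup>2)"
proof -
  have "Ic n i \<subseteq> {0..1}" "Ic n j \<subseteq> {0..1}"
    using Ic_subset[OF assms(1)] Ic_subset[OF assms(2)] by (meson atLeastLessThan_subseteq_atLeastAtMost_iff order_refl order_trans)+
  then have "emeasure usq (cellsq n i j) = ennreal (1 / real n) * ennreal (1 / real n)"
    unfolding cellsq_def by (subst emeasure_usq_Times) (use assms in \<open>auto simp: emeasure_Ic\<close>)
  also have "\<dots> = ennreal (1 / real n * (1 / real n))" by (rule ennreal_mult[symmetric]) auto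
  finally show ?thesis by (simp add: power2_eq_square)
qed

lemma measure_cellsq:
  assumes "i < n" "j < n"
  shows "measure usq (cellsq n i j) = 1 / (real n)\<^sup>2"
  using emeasure_cellsq[OF assms] by (simp add: measure_def)

text \<open>Exactly one cell contains the point. The coefficients range over a semiring so that both
  \<open>real\<close> and \<open>ennreal\<close> integrals can be split along cells.\<close>

lemma sum_cellsq:
  fixes F :: "nat \<Rightarrow> nat \<Rightarrow> 'a :: semiring_1"
  assumes "n > 0" "p \<in> {0..<1} \<times> {0..<1}"
  shows "(\<Sum>i<n. \<Sum>j<n. F i j * indicator (cellsq n i j) p) = F (cell n (fst p)) (cell n (snd p))"
proof -
  obtain x y where p: "p = (x, y)" by force
  have xy: "0 \<le> x" "x < 1" "0 \<le> y" "y < 1" using assms p by auto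
  have "(\<Sum>i<n. \<Sum>j<n. F i j * indicator (cellsq n i j) p)
      = (\<Sum>i<n. \<Sum>j<n. if i = cell n x then (if j = cell n y then F i j else 0) else 0)"
    by (intro sum.cong refl) (use xy assms p in \<open>auto simp: cellsq_def indicator_def mem_Ic_iff\<close>)
  also have "\<dots> = (\<Sum>i<n. if i = cell n x then (\<Sum>j<n. if j = cell n y then F i j else 0) else 0)"
    by (intro sum.cong refl) auto
  also have "\<dots> = F (cell n x) (cell n y)"
    using cell_less[of n x] cell_less[of n y] xy assms by (simp add: sum.delta)
  finally show ?thesis using p by simp
qed

section \<open>Step kernels and their integrals\<close>

definition stepk :: "nat \<Rightarrow> (nat \<Rightarrow> nat \<Rightarrow> real) \<Rightarrow> real \<times> real \<Rightarrow> real" where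
  "stepk n a p = (\<Sum>i<n. \<Sum>j<n. a i j * indicator (cellsq n i j) p)"

lemma stepk_measurable [measurable]: "stepk n a \<in> borel_measurable borel"
  unfolding stepk_def by measurable

lemma stepk_val:
  assumes "n > 0" "p \<in> {0..<1} \<times> {0..<1}"
  shows "stepk n a p = a (cell n (fst p)) (cell n (snd p))"
  unfolding stepk_def by (rule sum_cellsq[OF assms])

lemma stepk_bounded: "\<exists>B. \<forall>p. \<bar>stepk n a p\<bar> \<le> B"
proof (intro exI allI)
  fix p show "\<bar>stepk n a p\<bar> \<le> (\<Sum>i<n. \<Sum>j<n. \<bar>a i j\<bar>)"
    unfolding stepk_def
    by (intro order.trans[OF sum_abs] sum_mono) (auto simp: indicator_def)
qed

lemma integrable_usq_bounded:
  fixes f :: "real \<times> real \<Rightarrow> real"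
  assumes "f \<in> borel_measurable borel" "\<And>p. \<bar>f p\<bar> \<le> B"
  shows "integrable usq f"
  by (rule usq.integrable_const_bound[of _ B]) (use assms in auto)

lemma integrable_stepk [simp]: "integrable usq (stepk n a)"
proof -
  obtain B where "\<And>p. \<bar>stepk n a p\<bar> \<le> B" using stepk_bounded by blast
  then show ?thesis by (rule integrable_usq_bounded[OF stepk_measurable])
qed

lemma integrable_mult_indicator_usq:
  fixes f :: "real \<times> real \<Rightarrow> real"
  assumes "integrable usq f" "S \<in> sets borel"
  shows "integrable usq (\<lambda>p. f p * indicator S p)"
  using integrable_mult_indicator[of S usq f] assms by (simp add: mult.commute)

lemma stepk_mult: "stepk n a p * c = (\<Sum>i<n. \<Sum>j<n. a i j * (c * indicator (cellsq n i j) p))"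
  unfolding stepk_def sum_distrib_right
  by (intro sum.cong refl) (simp only: mult.assoc mult.commute[of c])

lemma integrable_mult_stepk:
  assumes "integrable usq f"
  shows "integrable usq (\<lambda>p. stepk n a p * f p)"
proof -
  have "integrable usq (\<lambda>p. \<Sum>i<n. \<Sum>j<n. a i j * (f p * indicator (cellsq n i j) p))"
    by (intro Bochner_Integration.integrable_sum integrable_mult_right integrable_mult_indicator_usq assms cellsq_borel)
  then show ?thesis by (simp only: stepk_mult)
qed

lemma nn_integral_cells:
  fixes f :: "real \<times> real \<Rightarrow> ennreal"
  assumes "n > 0" and [measurable]: "f \<in> borel_measurable borel"
  shows "(\<integral>\<^sup>+p. f p \<partial>usq) = (\<Sum>i<n. \<Sum>j<n. \<integral>\<^sup>+p. f p * indicator (cellsq n i j) p \<partial>usq)"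
proof -
  have "(\<integral>\<^sup>+p. f p \<partial>usq) = (\<integral>\<^sup>+p. (\<Sum>i<n. \<Sum>j<n. f p * indicator (cellsq n i j) p) \<partial>usq)"
    by (rule nn_integral_cong_AE) (use AE_usq_Ico in eventually_elim, simp only: sum_cellsq[OF assms(1)])
  also have "\<dots> = (\<Sum>i<n. \<integral>\<^sup>+p. (\<Sum>j<n. f p * indicator (cellsq n i j) p) \<partial>usq)"
    by (rule nn_integral_sum) measurable
  also have "\<dots> = (\<Sum>i<n. \<Sum>j<n. \<integral>\<^sup>+p. f p * indicator (cellsq n i j) p \<partial>usq)"
    by (intro sum.cong refl nn_integral_sum) measurable
  finally show ?thesis .
qed

lemma integral_cells:
  fixes f :: "real \<times> real \<Rightarrow> real"
  assumes "n > 0" and f: "integrable usq f"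
  shows "(\<integral>p. f p \<partial>usq) = (\<Sum>i<n. \<Sum>j<n. \<integral>p. f p * indicator (cellsq n i j) p \<partial>usq)"
proof -
  have [measurable]: "f \<in> borel_measurable borel" using borel_measurable_integrable[OF f] by simp
  have "(\<integral>p. f p \<partial>usq) = (\<integral>p. (\<Sum>i<n. \<Sum>j<n. f p * indicator (cellsq n i j) p) \<partial>usq)"
    by (rule integral_cong_AE) (measurable, use AE_usq_Ico in eventually_elim, simp only: sum_cellsq[OF assms(1)])
  also have "\<dots> = (\<Sum>i<n. \<integral>p. (\<Sum>j<n. f p * indicator (cellsq n i j) p) \<partial>usq)"
    by (rule Bochner_Integration.integral_sum) (intro Bochner_Integration.integrable_sum integrable_mult_indicator_usq[OF f] cellsq_borel)
  also have "\<dots> = (\<Sum>i<n. \<Sum>j<n. \<integral>p. f p * indicator (cellsq n i j) p \<partial>usq)"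
    by (intro sum.cong refl Bochner_Integration.integral_sum integrable_mult_indicator_usq[OF f] cellsq_borel)
  finally show ?thesis .
qed

lemma nn_integral_stepk:
  fixes \<phi> :: "real \<Rightarrow> ennreal"
  assumes "n > 0"
  shows "(\<integral>\<^sup>+p. \<phi> (stepk n a p) \<partial>usq) = (\<Sum>i<n. \<Sum>j<n. \<phi> (a i j) * ennreal (1 / (real n)\<^sup>2))"
proof -
  have "(\<integral>\<^sup>+p. \<phi> (stepk n a p) \<partial>usq) = (\<integral>\<^sup>+p. (\<Sum>i<n. \<Sum>j<n. \<phi> (a i j) * indicator (cellsq n i j) p) \<partial>usq)"
    by (rule nn_integral_cong_AE) (use AE_usq_Ico in eventually_elim, simp only: sum_cellsq[OF assms] stepk_val[OF assms])
  also have "\<dots> = (\<Sum>i<n. \<integral>\<^sup>+p. (\<Sum>j<n. \<phi> (a i j) * indicator (cellsq n i j) p) \<partial>usq)"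
    by (rule nn_integral_sum) measurable
  also have "\<dots> = (\<Sum>i<n. \<Sum>j<n. \<integral>\<^sup>+p. \<phi> (a i j) * indicator (cellsq n i j) p \<partial>usq)"
    by (intro sum.cong refl nn_integral_sum) measurable
  also have "\<dots> = (\<Sum>i<n. \<Sum>j<n. \<phi> (a i j) * ennreal (1 / (real n)\<^sup>2))"
    by (intro sum.cong refl) (simp add: nn_integral_cmult emeasure_cellsq)
  finally show ?thesis .
qed

definition avg :: "nat \<Rightarrow> (real \<times> real \<Rightarrow> real) \<Rightarrow> nat \<Rightarrow> nat \<Rightarrow> real" where
  "avg n f i j = (real n)\<^sup>2 * (\<integral>p. f p * indicator (cellsq n i j) p \<partial>usq)"

lemma integral_stepk_mult:
  assumes "n > 0" and f: "integrable usq f"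
  shows "(\<integral>p. stepk n a p * f p \<partial>usq) = (\<Sum>i<n. \<Sum>j<n. a i j * avg n f i j / (real n)\<^sup>2)"
proof -
  have "(\<integral>p. stepk n a p * f p \<partial>usq) = (\<integral>p. (\<Sum>i<n. \<Sum>j<n. a i j * (f p * indicator (cellsq n i j) p)) \<partial>usq)"
    by (rule Bochner_Integration.integral_cong) (simp_all only: stepk_mult)
  also have "\<dots> = (\<Sum>i<n. \<integral>p. (\<Sum>j<n. a i j * (f p * indicator (cellsq n i j) p)) \<partial>usq)"
    by (rule Bochner_Integration.integral_sum) (intro Bochner_Integration.integrable_sum integrable_mult_right integrable_mult_indicator_usq[OF f] cellsq_borel)
  also have "\<dots> = (\<Sum>i<n. \<Sum>j<n. \<integral>p. a i j * (f p * indicator (cellsq n i j) p) \<partial>usq)"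
    by (intro sum.cong refl Bochner_Integration.integral_sum integrable_mult_right integrable_mult_indicator_usq[OF f] cellsq_borel)
  also have "\<dots> = (\<Sum>i<n. \<Sum>j<n. a i j * avg n f i j / (real n)\<^sup>2)"
    using assms by (simp add: avg_def)
  finally show ?thesis .
qed

lemma stepk_comp_AE:
  assumes "n > 0"
  shows "AE p in usq. \<phi> (stepk n a p) = stepk n (\<lambda>i j. \<phi> (a i j)) p"
  using AE_usq_Ico by eventually_elim (simp add: stepk_val assms)

lemma stepk_comp2_AE:
  assumes "n > 0"
  shows "AE p in usq. \<phi> (stepk n a p) (stepk n b p) = stepk n (\<lambda>i j. \<phi> (a i j) (b i j)) p"
  using AE_usq_Ico by eventually_elim (simp add: stepk_val assms)

lemma avg_const: "i < n \<Longrightarrow> j < n \<Longrightarrow> avg n (\<lambda>_. c) i j = c"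
  by (simp add: avg_def measure_cellsq)

lemma integral_stepk:
  assumes "n > 0"
  shows "(\<integral>p. stepk n a p \<partial>usq) = (\<Sum>i<n. \<Sum>j<n. a i j) / (real n)\<^sup>2"
proof -
  have "(\<integral>p. stepk n a p \<partial>usq) = (\<Sum>i<n. \<Sum>j<n. a i j * avg n (\<lambda>_. 1) i j / (real n)\<^sup>2)"
    using integral_stepk_mult[OF assms, of "\<lambda>_. 1" a] by simp
  then show ?thesis by (simp add: avg_const sum_divide_distrib)
qed

lemma integral_stepk_comp:
  assumes "n > 0" "\<phi> \<in> borel_measurable borel"
  shows "(\<integral>p. \<phi> (stepk n a p) \<partial>usq) = (\<Sum>i<n. \<Sum>j<n. \<phi> (a i j)) / (real n)\<^sup>2"
proof -
  have "(\<integral>p. \<phi> (stepk n a p) \<partial>usq) = (\<integral>p. stepk n (\<lambda>i j. \<phi> (a i j)) p \<partial>usq)"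
    by (rule integral_cong_AE) (use assms stepk_comp_AE[OF assms(1), of \<phi> a] in auto)
  then show ?thesis by (simp add: integral_stepk assms)
qed

text \<open>The conditional expectation of \<open>f\<close> under \<open>usq\<close> given the
  partition into n by n cells.\<close>

definition Eavg :: "nat \<Rightarrow> (real \<times> real \<Rightarrow> real) \<Rightarrow> real \<times> real \<Rightarrow> real" where
  "Eavg n f = stepk n (avg n f)"

lemma Eavg_measurable [measurable]: "Eavg n f \<in> borel_measurable borel"
  by (simp add: Eavg_def)

lemma integrable_Eavg [simp]: "integrable usq (Eavg n f)"
  by (simp add: Eavg_def)

lemma avg_add:
  "integrable usq f \<Longrightarrow> integrable usq g \<Longrightarrow> avg n (\<lambda>p. f p + g p) i j = avg n f i j + avg n g i j"
  by (simp add: avg_def distrib_right distrib_left integrable_mult_indicator_usq)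

lemma avg_diff:
  "integrable usq f \<Longrightarrow> integrable usq g \<Longrightarrow> avg n (\<lambda>p. f p - g p) i j = avg n f i j - avg n g i j"
  by (simp add: avg_def left_diff_distrib right_diff_distrib integrable_mult_indicator_usq)

lemma avg_cmult: "avg n (\<lambda>p. c * f p) i j = c * avg n f i j"
  by (simp add: avg_def mult.assoc mult.left_commute)

lemma Eavg_add: "integrable usq f \<Longrightarrow> integrable usq g \<Longrightarrow> Eavg n (\<lambda>p. f p + g p) p = Eavg n f p + Eavg n g p"
  by (simp only: Eavg_def stepk_def avg_add distrib_right sum.distrib)

lemma Eavg_diff: "integrable usq f \<Longrightarrow> integrable usq g \<Longrightarrow> Eavg n (\<lambda>p. f p - g p) p = Eavg n f p - Eavg n g p"
  by (simp only: Eavg_def stepk_def avg_diff left_diff_distrib sum_subtractf)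

lemma Eavg_cmult: "Eavg n (\<lambda>p. c * f p) p = c * Eavg n f p"
  by (simp only: Eavg_def stepk_def avg_cmult sum_distrib_left mult.assoc)

section \<open>L^1 convergence of cell averages\<close>

lemma Eavg_L1:
  assumes f: "integrable usq f"
  shows "(\<integral>p. \<bar>Eavg n f p\<bar> \<partial>usq) \<le> (\<integral>p. \<bar>f p\<bar> \<partial>usq)"
proof (cases "n > 0")
  case True
  have "(\<integral>p. \<bar>Eavg n f p\<bar> \<partial>usq) = (\<Sum>i<n. \<Sum>j<n. \<bar>avg n f i j\<bar>) / (real n)\<^sup>2"
    unfolding Eavg_def by (rule integral_stepk_comp[OF True, where \<phi> = abs]) simp
  also have "\<dots> = (\<Sum>i<n. \<Sum>j<n. \<bar>\<integral>p. f p * indicator (cellsq n i j) p \<partial>usq\<bar>)"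
    using True by (simp add: avg_def abs_mult sum_distrib_left[symmetric])
  also have "\<dots> \<le> (\<Sum>i<n. \<Sum>j<n. \<integral>p. \<bar>f p\<bar> * indicator (cellsq n i j) p \<partial>usq)"
    by (intro sum_mono order.trans[OF integral_abs_bound]) (simp add: abs_mult)
  also have "\<dots> = (\<integral>p. \<bar>f p\<bar> \<partial>usq)"
    by (rule integral_cells[symmetric, OF True]) (use f in simp)
  finally show ?thesis .
qed (simp add: Eavg_def stepk_def)

text \<open>Convergence is asked along all n. These grids are not nested, so martingale convergence
  does not apply; instead the class is shown to contain bounded Lipschitz functions and to be closed
  under dominated limits, which leads through closed and Borel sets to all integrable
  functions.\<close>

definition avg_approx :: "(real \<times> real \<Rightarrow> real) \<Rightarrow> bool" where
  "avg_approx f \<longleftrightarrow> (\<lambda>n. \<integral>p. \<bar>f p - Eavg n f p\<bar> \<partial>usq) \<longlonglongrightarrow> 0"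

lemma avg_close:
  assumes "i < n" "j < n" and f: "integrable usq f"
    and close: "\<And>p. p \<in> cellsq n i j \<Longrightarrow> \<bar>f p - c\<bar> \<le> e"
  shows "\<bar>avg n f i j - c\<bar> \<le> e"
proof -
  have "avg n f i j - c = avg n (\<lambda>p. f p - c) i j"
    using avg_diff[OF f, of "\<lambda>_. c"] avg_const[OF assms(1,2)] by simp
  also have "\<bar>\<dots>\<bar> = (real n)\<^sup>2 * \<bar>\<integral>p. (f p - c) * indicator (cellsq n i j) p \<partial>usq\<bar>"
    by (simp add: avg_def abs_mult)
  also have "\<dots> \<le> (real n)\<^sup>2 * (\<integral>p. e * indicator (cellsq n i j) p \<partial>usq)"
  proof (intro mult_left_mono order.trans[OF integral_abs_bound] integral_mono)
    have 1: "integrable usq (\<lambda>p. (f p - c) * indicator (cellsq n i j) p)"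
      by (intro integrable_mult_indicator_usq Bochner_Integration.integrable_diff f cellsq_borel) simp
    show "integrable usq (\<lambda>p. \<bar>(f p - c) * indicator (cellsq n i j) p\<bar>)"
      using 1 by (rule integrable_abs)
    show "integrable usq (\<lambda>p. e * indicator (cellsq n i j) p)"
      by (intro integrable_mult_indicator_usq cellsq_borel) simp
    fix p show "\<bar>(f p - c) * indicator (cellsq n i j) p\<bar> \<le> e * indicator (cellsq n i j) p"
      using close[of p] by (auto simp: indicator_def)
  qed simp
  also have "\<dots> = e" using assms by (simp add: measure_cellsq)
  finally show ?thesis .
qed

lemma dist_cellsq:
  assumes "p \<in> cellsq n i j" "q \<in> cellsq n i j"
  shows "dist p q \<le> 2 / real n"
proof -
  obtain x y x' y' where p: "p = (x, y)" "q = (x', y')" by (cases p, cases q) auto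
  have "x \<in> Ic n i" "x' \<in> Ic n i" "y \<in> Ic n j" "y' \<in> Ic n j" using assms p by (auto simp: cellsq_def)
  then have "dist x x' \<le> 1 / real n" "dist y y' \<le> 1 / real n"
    by (auto simp: Ic_def dist_real_def add_divide_distrib)
  moreover have "dist p q \<le> dist x x' + dist y y'"
    unfolding p dist_Pair_Pair using sqrt_sum_squares_le_sum_abs[of "dist x x'" "dist y y'"] by simp
  ultimately show ?thesis by simp
qed

lemma avg_approx_Lipschitz:
  assumes f: "f \<in> borel_measurable borel" and B: "\<And>p. \<bar>f p\<bar> \<le> B"
    and L: "\<And>p q. \<bar>f p - f q\<bar> \<le> L * dist p q" and "L \<ge> 0"
  shows "avg_approx f"
  unfolding avg_approx_def
proof (rule Lim_null_comparison)
  have int: "integrable usq f" by (rule integrable_usq_bounded[OF f B])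
  have "norm (\<integral>p. \<bar>f p - Eavg n f p\<bar> \<partial>usq) \<le> L * (2 / real n)" if n: "n > 0" for n
  proof -
    have "AE p in usq. \<bar>f p - Eavg n f p\<bar> \<le> L * (2 / real n)"
      using AE_usq_Ico
    proof eventually_elim
      case (elim p)
      let ?i = "cell n (fst p)" and ?j = "cell n (snd p)"
      have ij: "?i < n" "?j < n" using cell_less[OF n] elim by auto
      have p: "p \<in> cellsq n ?i ?j" using elim mem_Ic_iff[OF n] by (auto simp: cellsq_def mem_Times_iff)
      have "\<bar>avg n f ?i ?j - f p\<bar> \<le> L * (2 / real n)"
        by (rule avg_close[OF ij int])
           (rule order.trans[OF L], rule mult_left_mono, use dist_cellsq p assms in blast, use assms in simp)
      then show ?case using elim by (simp add: Eavg_def stepk_val n abs_minus_commute)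
    qed
    moreover have "integrable usq (\<lambda>p. \<bar>f p - Eavg n f p\<bar>)" using int by simp
    ultimately have "(\<integral>p. \<bar>f p - Eavg n f p\<bar> \<partial>usq) \<le> (\<integral>p. L * (2 / real n) \<partial>usq)"
      by (intro integral_mono_AE) auto
    then show ?thesis by (simp add: usq.prob_space[simplified])
  qed
  then show "\<forall>\<^sub>F n in sequentially. norm (\<integral>p. \<bar>f p - Eavg n f p\<bar> \<partial>usq) \<le> L * (2 / real n)"
    by (intro eventually_sequentiallyI[of 1]) auto
  show "(\<lambda>n. L * (2 / real n)) \<longlonglongrightarrow> 0"
    using tendsto_mult[OF tendsto_const[of L] lim_const_over_n[of 2]] by simp
qed

text \<open>\<open>f - g\<close> enters twice, once directly and once through its averages, which do
  not exceed it in L^1.\<close>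

lemma Eavg_error_perturb:
  assumes f: "integrable usq f" and g: "integrable usq g"
  shows "(\<integral>p. \<bar>f p - Eavg n f p\<bar> \<partial>usq) \<le> 2 * (\<integral>p. \<bar>f p - g p\<bar> \<partial>usq) + (\<integral>p. \<bar>g p - Eavg n g p\<bar> \<partial>usq)"
proof -
  have "(\<integral>p. \<bar>f p - Eavg n f p\<bar> \<partial>usq) \<le>
      (\<integral>p. \<bar>f p - g p\<bar> + \<bar>g p - Eavg n g p\<bar> + \<bar>Eavg n (\<lambda>p. f p - g p) p\<bar> \<partial>usq)"
    by (rule integral_mono) (use f g in \<open>auto simp: Eavg_diff[OF f g]\<close>)
  also have "\<dots> = (\<integral>p. \<bar>f p - g p\<bar> \<partial>usq) + (\<integral>p. \<bar>g p - Eavg n g p\<bar> \<partial>usq) + (\<integral>p. \<bar>Eavg n (\<lambda>p. f p - g p) p\<bar> \<partial>usq)"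
    using f g by simp
  also have "\<dots> \<le> (\<integral>p. \<bar>f p - g p\<bar> \<partial>usq) + (\<integral>p. \<bar>g p - Eavg n g p\<bar> \<partial>usq) + (\<integral>p. \<bar>f p - g p\<bar> \<partial>usq)"
    using Eavg_L1[of "\<lambda>p. f p - g p" n] f g by simp
  finally show ?thesis by simp
qed

lemma avg_approx_L1_closed:
  assumes f: "integrable usq f"
    and g: "\<And>e. e > 0 \<Longrightarrow> \<exists>g. integrable usq g \<and> avg_approx g \<and> (\<integral>p. \<bar>f p - g p\<bar> \<partial>usq) < e"
  shows "avg_approx f"
  unfolding avg_approx_def
proof (rule LIMSEQ_I)
  fix r :: real assume "r > 0"
  then have r4: "r / 4 > 0" by simp
  from assms(2)[OF r4] obtain g where g: "integrable usq g" "avg_approx g" "(\<integral>p. \<bar>f p - g p\<bar> \<partial>usq) < r / 4"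
    by blast
  from LIMSEQ_D[OF g(2)[unfolded avg_approx_def] r4]
  obtain N where N: "\<And>n. n \<ge> N \<Longrightarrow> norm ((\<integral>p. \<bar>g p - Eavg n g p\<bar> \<partial>usq) - 0) < r / 4"
    by blast
  show "\<exists>no. \<forall>n\<ge>no. norm ((\<integral>p. \<bar>f p - Eavg n f p\<bar> \<partial>usq) - 0) < r"
  proof (intro exI[of _ N] allI impI)
    fix n assume "n \<ge> N"
    from N[OF this] Eavg_error_perturb[OF f g(1), of n] g(3)
    have "(\<integral>p. \<bar>f p - Eavg n f p\<bar> \<partial>usq) < r" using \<open>r > 0\<close> by simp
    then show "norm ((\<integral>p. \<bar>f p - Eavg n f p\<bar> \<partial>usq) - 0) < r" by simp
  qed
qed

lemma avg_approx_dominated: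
  assumes f: "integrable usq f" and s: "\<And>k. integrable usq (s k)" "\<And>k. avg_approx (s k)"
    and lim: "\<And>p. (\<lambda>k. s k p) \<longlonglongrightarrow> f p" and w: "integrable usq w" "\<And>k p. \<bar>s k p\<bar> \<le> w p"
  shows "avg_approx f"
proof (rule avg_approx_L1_closed[OF f])
  fix e :: real assume "e > 0"
  have [measurable]: "f \<in> borel_measurable borel" "\<And>k. s k \<in> borel_measurable borel"
    using borel_measurable_integrable[OF f] borel_measurable_integrable[OF s(1)] by simp_all
  have "(\<lambda>k. \<integral>p. \<bar>f p - s k p\<bar> \<partial>usq) \<longlonglongrightarrow> (\<integral>p. 0 \<partial>usq)"
  proof (rule integral_dominated_convergence[where w = "\<lambda>p. \<bar>f p\<bar> + w p"])
    show "AE p in usq. (\<lambda>k. \<bar>f p - s k p\<bar>) \<longlonglongrightarrow> 0"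
    proof (rule AE_I2)
      fix p
      have "(\<lambda>k. \<bar>f p - s k p\<bar>) \<longlonglongrightarrow> \<bar>f p - f p\<bar>" by (intro tendsto_intros lim)
      then show "(\<lambda>k. \<bar>f p - s k p\<bar>) \<longlonglongrightarrow> 0" by simp
    qed
    show "AE p in usq. norm \<bar>f p - s k p\<bar> \<le> \<bar>f p\<bar> + w p" for k
    proof (rule AE_I2)
      fix p show "norm \<bar>f p - s k p\<bar> \<le> \<bar>f p\<bar> + w p" using w(2)[of k p] by simp
    qed
  qed (use f w in auto)
  then have "(\<lambda>k. \<integral>p. \<bar>f p - s k p\<bar> \<partial>usq) \<longlonglongrightarrow> 0" by simp
  from LIMSEQ_D[OF this \<open>e > 0\<close>] obtain k where "(\<integral>p. \<bar>f p - s k p\<bar> \<partial>usq) < e"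
    by fastforce
  then show "\<exists>g. integrable usq g \<and> avg_approx g \<and> (\<integral>p. \<bar>f p - g p\<bar> \<partial>usq) < e" using s by blast
qed

lemma avg_approx_add:
  assumes f: "integrable usq f" and g: "integrable usq g" and "avg_approx f" "avg_approx g"
  shows "avg_approx (\<lambda>p. f p + g p)"
  unfolding avg_approx_def
proof (rule Lim_null_comparison)
  show "(\<lambda>n. (\<integral>p. \<bar>f p - Eavg n f p\<bar> \<partial>usq) + (\<integral>p. \<bar>g p - Eavg n g p\<bar> \<partial>usq)) \<longlonglongrightarrow> 0"
    using assms tendsto_add[of _ 0 sequentially _ 0] unfolding avg_approx_def by simp
  have "(\<integral>p. \<bar>f p + g p - Eavg n (\<lambda>p. f p + g p) p\<bar> \<partial>usq)
      \<le> (\<integral>p. \<bar>f p - Eavg n f p\<bar> + \<bar>g p - Eavg n g p\<bar> \<partial>usq)" for n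
    by (rule integral_mono) (use f g in \<open>auto simp: Eavg_add[OF f g]\<close>)
  then show "\<forall>\<^sub>F n in sequentially. norm (\<integral>p. \<bar>f p + g p - Eavg n (\<lambda>p. f p + g p) p\<bar> \<partial>usq)
      \<le> (\<integral>p. \<bar>f p - Eavg n f p\<bar> \<partial>usq) + (\<integral>p. \<bar>g p - Eavg n g p\<bar> \<partial>usq)"
    using f g by (intro always_eventually allI) simp
qed

lemma avg_approx_cmult:
  assumes "avg_approx f"
  shows "avg_approx (\<lambda>p. c * f p)"
proof -
  have "\<bar>c * f p - Eavg n (\<lambda>p. c * f p) p\<bar> = \<bar>c\<bar> * \<bar>f p - Eavg n f p\<bar>" for n p
    by (simp add: Eavg_cmult right_diff_distrib[symmetric] abs_mult)
  then show ?thesis using tendsto_mult_right_zero[OF assms[unfolded avg_approx_def], of "\<bar>c\<bar>"]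
    by (simp add: avg_approx_def)
qed

lemma avg_approx_const: "avg_approx (\<lambda>_. c)"
  by (rule avg_approx_Lipschitz[of _ "\<bar>c\<bar>" 0]) auto

lemma integrable_indicator_usq:
  "A \<in> sets borel \<Longrightarrow> integrable usq (\<lambda>p. indicator A p :: real)"
  by (rule integrable_usq_bounded[of _ 1]) (auto simp: indicator_def)

text \<open>The functions \<open>max 0 (1 - real k * infdist p F)\<close> are Lipschitz and decrease
  to the indicator because the set is closed. The empty set is treated separately, since the
  distance to it is 0 by convention.\<close>

lemma avg_approx_closed:
  assumes "closed F"
  shows "avg_approx (indicator F)"
proof (cases "F = {}")
  case True
  then have "indicator F = (\<lambda>_. 0 :: real)" by (simp add: fun_eq_iff)
  then show ?thesis using avg_approx_const[of 0] by simp
next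
  case False
  let ?s = "\<lambda>k p. max 0 (1 - real k * infdist p F)"
  have b: "\<bar>?s k p\<bar> \<le> 1" for k p using infdist_nonneg[of p F] by (auto simp: max_def)
  have m: "?s k \<in> borel_measurable borel" for k
    by (intro borel_measurable_max borel_measurable_const borel_measurable_diff borel_measurable_times
        borel_measurable_continuous_onI continuous_intros)
  have F: "F \<in> sets borel" using assms by simp
  show ?thesis
  proof (rule avg_approx_dominated[where s = ?s and w = "\<lambda>_. 1"])
    show "integrable usq (indicator F :: _ \<Rightarrow> real)" using integrable_indicator_usq[OF F] by simp
    show "integrable usq (?s k)" for k by (rule integrable_usq_bounded[OF m b])
    show "avg_approx (?s k)" for k
    proof (rule avg_approx_Lipschitz[OF m b, of _ "real k"])
      fix p q
      have "\<bar>?s k p - ?s k q\<bar> \<le> \<bar>real k * infdist p F - real k * infdist q F\<bar>" by (auto simp: max_def)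
      also have "\<dots> = real k * \<bar>infdist p F - infdist q F\<bar>" by (simp add: abs_mult right_diff_distrib[symmetric])
      also have "\<dots> \<le> real k * dist p q" by (intro mult_left_mono infdist_triangle_abs) simp
      finally show "\<bar>?s k p - ?s k q\<bar> \<le> real k * dist p q" .
    qed simp
    fix p
    show "(\<lambda>k. ?s k p) \<longlonglongrightarrow> indicator F p"
    proof (cases "p \<in> F")
      case True then show ?thesis by simp
    next
      case False
      then have pos: "infdist p F > 0"
        using in_closed_iff_infdist_zero[OF assms \<open>F \<noteq> {}\<close>, of p] infdist_nonneg[of p F] by linarith
      obtain k0 where k0: "1 / infdist p F \<le> real k0" using real_arch_simple by blast
      have "?s k p = 0" if "k \<ge> k0" for k
      proof -
        have "1 / infdist p F \<le> real k" using k0 that by (meson of_nat_mono order.trans)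
        then show ?thesis using pos by (simp add: divide_le_eq)
      qed
      then have "eventually (\<lambda>k. ?s k p = 0) sequentially" by (rule eventually_sequentiallyI)
      then have "(\<lambda>k. ?s k p) \<longlonglongrightarrow> 0" by (rule tendsto_eventually)
      then show ?thesis using False by simp
    qed
  qed (use b in auto)
qed

text \<open>Dynkin's argument: closed sets are stable under intersection and generate the Borel
  sets, and the class is stable under complements and countable disjoint unions, the latter by
  dominated convergence of the partial sums.\<close>

lemma avg_approx_borel:
  assumes "A \<in> sets borel"
  shows "avg_approx (indicator A)"
proof -
  have gen: "sets borel = sigma_sets UNIV (Collect (closed :: (real \<times> real) set \<Rightarrow> bool))"
    by (simp add: borel_eq_closed)
  have "Int_stable (Collect (closed :: (real \<times> real) set \<Rightarrow> bool))" by (auto simp: Int_stable_def)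
  moreover have "Collect (closed :: (real \<times> real) set \<Rightarrow> bool) \<subseteq> Pow UNIV" by simp
  moreover have "A \<in> sigma_sets UNIV (Collect closed)" using assms gen by simp
  ultimately show ?thesis
  proof (induction rule: sigma_sets_induct_disjoint)
    case (basic A)
    then show ?case by (simp add: avg_approx_closed)
  next
    case empty
    show ?case by (rule avg_approx_closed) simp
  next
    case (compl A)
    then have A: "A \<in> sets borel" using gen by simp
    have "avg_approx (\<lambda>p. 1 + (-1) * indicator A p)"
      by (intro avg_approx_add avg_approx_const avg_approx_cmult compl)
         (use integrable_indicator_usq[OF A] in auto)
    moreover have "(\<lambda>p. 1 + (-1) * indicator A p) = (indicator (UNIV - A) :: _ \<Rightarrow> real)"
      by (auto simp: fun_eq_iff indicator_def)
    ultimately show ?case by simp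
  next
    case (union A)
    then have A: "A i \<in> sets borel" for i using gen by auto
    let ?s = "\<lambda>k p. \<Sum>i<k. indicator (A i) p :: real"
    have s: "?s k p = indicator (\<Union>i<k. A i) p" for k p
      by (rule indicator_UN_disjoint[symmetric]) (use union in \<open>auto simp: disjoint_family_on_def\<close>)
    have si: "integrable usq (?s k)" for k
      by (intro Bochner_Integration.integrable_sum integrable_indicator_usq A)
    have sa: "avg_approx (?s k)" for k
    proof (induction k)
      case 0 then show ?case by (simp add: avg_approx_const)
    next
      case (Suc k)
      then show ?case using avg_approx_add[OF si[of k] integrable_indicator_usq[OF A[of k]] Suc] union by simp
    qed
    have U: "\<Union> (range A) \<in> sets borel" using A by auto
    show ?case
    proof (rule avg_approx_dominated[OF _ si sa, where w = "\<lambda>_. 1"])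
      show "integrable usq (indicator (\<Union> (range A)) :: _ \<Rightarrow> real)" using integrable_indicator_usq[OF U] by simp
      show "\<bar>?s k p\<bar> \<le> 1" for k p unfolding s by (simp add: indicator_def)
      fix p
      have "(\<lambda>k. indicator (\<Union>i<k. A i) p :: real) \<longlonglongrightarrow> indicator (\<Union>i. A i) p"
        by (rule LIMSEQ_indicator_UN)
      then show "(\<lambda>k. ?s k p) \<longlonglongrightarrow> indicator (\<Union> (range A)) p" unfolding s .
    qed simp
  qed
qed

theorem avg_approx_integrable:
  assumes "integrable usq f"
  shows "avg_approx f"
  using assms
proof (induction rule: integrable_induct)
  case (base A c)
  then show ?case using avg_approx_cmult[OF avg_approx_borel[of A], of c] by (simp add: mult.commute)
next
  case (add f g)
  then show ?case by (intro avg_approx_add) auto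
next
  case (lim f s)
  show ?case
    by (rule avg_approx_dominated[where s = s and w = "\<lambda>p. 2 * \<bar>f p\<bar>"]) (use lim in auto)
qed

section \<open>The cut norm and the orbit space\<close>

definition cutn :: "(real \<times> real \<Rightarrow> real) \<Rightarrow> real" where
  "cutn f = (SUP AB \<in> {(A, B). A \<in> sets borel \<and> A \<subseteq> {0..1} \<and> B \<in> sets borel \<and> B \<subseteq> {0..1}}.
     \<bar>\<integral>p. indicator (fst AB \<times> snd AB) p * f p \<partial>usq\<bar>)"

lemma cut_dist_cutn:
  assumes "k1 \<in> borel_measurable borel" "k2 \<in> borel_measurable borel"
  shows "cut_dist k1 k2 = cutn (\<lambda>p. k1 p - k2 p)"
  unfolding cut_dist_def cutn_def
  by (intro SUP_cong refl arg_cong[where f = abs])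
     (use assms in \<open>auto intro!: set_integral_usq\<close>)

lemma abs_rect_le_L1:
  fixes f :: "real \<times> real \<Rightarrow> real"
  assumes "integrable usq f" "S \<in> sets borel"
  shows "\<bar>\<integral>p. indicator S p * f p \<partial>usq\<bar> \<le> (\<integral>p. \<bar>f p\<bar> \<partial>usq)"
proof (rule order.trans[OF integral_abs_bound], rule integral_mono)
  show "integrable usq (\<lambda>p. \<bar>indicator S p * f p\<bar>)"
    using integrable_mult_indicator_usq[OF assms] by (simp add: mult.commute)
qed (use assms in \<open>auto simp: indicator_def\<close>)

lemma cutn_upper:
  assumes "integrable usq f" "A \<in> sets borel" "A \<subseteq> {0..1}" "B \<in> sets borel" "B \<subseteq> {0..1}"
  shows "\<bar>\<integral>p. indicator (A \<times> B) p * f p \<partial>usq\<bar> \<le> cutn f"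
proof -
  have "bdd_above ((\<lambda>AB. \<bar>\<integral>p. indicator (fst AB \<times> snd AB) p * f p \<partial>usq\<bar>) `
     {(A, B). A \<in> sets borel \<and> A \<subseteq> {0..1} \<and> B \<in> sets borel \<and> B \<subseteq> {0..1}})"
    by (rule bdd_aboveI[of _ "\<integral>p. \<bar>f p\<bar> \<partial>usq"]) (auto intro!: abs_rect_le_L1 assms Times_borel)
  from cSUP_upper[OF _ this, of "(A, B)"] show ?thesis using assms by (simp add: cutn_def)
qed

lemma cutn_least:
  assumes "\<And>A B. A \<in> sets borel \<Longrightarrow> A \<subseteq> {0..1} \<Longrightarrow> B \<in> sets borel \<Longrightarrow> B \<subseteq> {0..1} \<Longrightarrow>
     \<bar>\<integral>p. indicator (A \<times> B) p * f p \<partial>usq\<bar> \<le> c"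
  shows "cutn f \<le> c"
  unfolding cutn_def
  by (rule cSUP_least) (use assms in auto)

lemma cutn_le_L1:
  assumes "integrable usq f"
  shows "cutn f \<le> (\<integral>p. \<bar>f p\<bar> \<partial>usq)"
  by (intro cutn_least abs_rect_le_L1 assms Times_borel)

lemma cutn_cong_AE:
  assumes "AE p in usq. f p = g p" and [measurable]: "f \<in> borel_measurable borel" "g \<in> borel_measurable borel"
  shows "cutn f = cutn g"
  unfolding cutn_def
proof (intro SUP_cong refl arg_cong[where f = abs])
  fix AB :: "real set \<times> real set"
  assume "AB \<in> {(A, B). A \<in> sets borel \<and> A \<subseteq> {0..1} \<and> B \<in> sets borel \<and> B \<subseteq> {0..1}}"
  then have [measurable]: "fst AB \<times> snd AB \<in> sets borel" by (auto intro: Times_borel)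
  show "(\<integral>p. indicator (fst AB \<times> snd AB) p * f p \<partial>usq) = (\<integral>p. indicator (fst AB \<times> snd AB) p * g p \<partial>usq)"
    by (rule integral_cong_AE) (use assms(1) in \<open>auto\<close>)
qed

lemma integrable_indicator_mult_usq:
  fixes f :: "real \<times> real \<Rightarrow> real"
  assumes "integrable usq f" "S \<in> sets borel"
  shows "integrable usq (\<lambda>p. indicator S p * f p)"
  using integrable_mult_indicator_usq[OF assms] by (simp add: mult.commute)

lemma cutn_triangle:
  assumes f: "integrable usq f" and g: "integrable usq g"
  shows "cutn (\<lambda>p. f p + g p) \<le> cutn f + cutn g"
proof (rule cutn_least)
  fix A B :: "real set" assume *: "A \<in> sets borel" "A \<subseteq> {0..1}" "B \<in> sets borel" "B \<subseteq> {0..1}"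
  have "(\<integral>p. indicator (A \<times> B) p * (f p + g p) \<partial>usq) =
      (\<integral>p. indicator (A \<times> B) p * f p \<partial>usq) + (\<integral>p. indicator (A \<times> B) p * g p \<partial>usq)"
    unfolding distrib_left
    by (rule Bochner_Integration.integral_add; rule integrable_indicator_mult_usq) (use f g * Times_borel in auto)
  then show "\<bar>\<integral>p. indicator (A \<times> B) p * (f p + g p) \<partial>usq\<bar> \<le> cutn f + cutn g"
    using cutn_upper[OF f *] cutn_upper[OF g *] by linarith
qed

lemma cutn_minus: "cutn (\<lambda>p. f p - g p) = cutn (\<lambda>p. g p - f p)"
proof -
  have "\<bar>\<integral>p. indicator S p * (f p - g p) \<partial>usq\<bar> = \<bar>\<integral>p. indicator S p * (g p - f p) \<partial>usq\<bar>" for S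
  proof -
    have "(\<integral>p. indicator S p * (f p - g p) \<partial>usq) = (\<integral>p. - (indicator S p * (g p - f p)) \<partial>usq)"
      by (rule Bochner_Integration.integral_cong) (auto simp: right_diff_distrib)
    then show ?thesis by simp
  qed
  then show ?thesis by (simp add: cutn_def)
qed

lemma cutn_nonneg: "integrable usq f \<Longrightarrow> 0 \<le> cutn f"
  using cutn_upper[of f "{}" "{}"] by simp

section \<open>Measure-preserving bijections of the unit interval\<close>

lemma mp_bij_id: "mp_bij id"
  unfolding mp_bij_def by (auto simp: Int_absorb2)

lemma mp_bijD:
  assumes "mp_bij \<sigma>" "A \<in> sets borel" "A \<subseteq> {0..1}"
  shows "\<sigma> -` A \<inter> {0..1} \<in> sets borel" "\<sigma> ` A \<in> sets borel"
    "emeasure lborel (\<sigma> -` A \<inter> {0..1}) = emeasure lborel A"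
  using assms unfolding mp_bij_def by simp_all

lemma mp_bij_mem: "mp_bij \<sigma> \<Longrightarrow> x \<in> {0..1} \<Longrightarrow> \<sigma> x \<in> {0..1}"
  unfolding mp_bij_def bij_betw_def by blast

lemma mp_bij_image_subset: "mp_bij \<sigma> \<Longrightarrow> A \<subseteq> {0..1} \<Longrightarrow> \<sigma> ` A \<subseteq> {0..1}"
  using mp_bij_mem by blast

lemma mp_bij_image_emeasure:
  assumes s: "mp_bij \<sigma>" and A: "A \<in> sets borel" "A \<subseteq> {0..1}"
  shows "emeasure lborel (\<sigma> ` A) = emeasure lborel A"
proof -
  have "\<sigma> -` (\<sigma> ` A) \<inter> {0..1} = A"
    using s A unfolding mp_bij_def bij_betw_def inj_on_def by blast
  moreover have "emeasure lborel (\<sigma> -` (\<sigma> ` A) \<inter> {0..1}) = emeasure lborel (\<sigma> ` A)"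
    by (intro mp_bijD[OF s] A mp_bij_image_subset[OF s])
  ultimately show ?thesis by simp
qed

lemma mp_bij_comp:
  assumes s: "mp_bij \<sigma>" and t: "mp_bij \<tau>"
  shows "mp_bij (\<sigma> \<circ> \<tau>)"
  unfolding mp_bij_def
proof (intro conjI ballI impI)
  show "bij_betw (\<sigma> \<circ> \<tau>) {0..1} {0..1}"
    using s t unfolding mp_bij_def by (blast intro: bij_betw_trans)
  fix A :: "real set" assume A: "A \<in> sets borel" "A \<subseteq> {0..1}"
  have eq: "(\<sigma> \<circ> \<tau>) -` A \<inter> {0..1} = \<tau> -` (\<sigma> -` A \<inter> {0..1}) \<inter> {0..1}"
    using mp_bij_mem[OF t] by auto
  have p: "\<sigma> -` A \<inter> {0..1} \<in> sets borel" "emeasure lborel (\<sigma> -` A \<inter> {0..1}) = emeasure lborel A"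
    using mp_bijD[OF s A] by simp_all
  have p2: "\<tau> -` (\<sigma> -` A \<inter> {0..1}) \<inter> {0..1} \<in> sets borel"
    "emeasure lborel (\<tau> -` (\<sigma> -` A \<inter> {0..1}) \<inter> {0..1}) = emeasure lborel (\<sigma> -` A \<inter> {0..1})"
    using mp_bijD[OF t p(1)] by simp_all
  show "(\<sigma> \<circ> \<tau>) -` A \<inter> {0..1} \<in> sets borel" using eq p2 by simp
  show "emeasure lborel ((\<sigma> \<circ> \<tau>) -` A \<inter> {0..1}) = emeasure lborel A" using eq p p2 by simp
  have "\<sigma> ` (\<tau> ` A) \<in> sets borel"
    by (intro mp_bijD[OF s] mp_bijD[OF t] mp_bij_image_subset[OF t] A)
  then show "(\<sigma> \<circ> \<tau>) ` A \<in> sets borel" by (simp add: image_comp)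
qed

lemma mp_bij_inverse:
  assumes s: "mp_bij \<sigma>"
  obtains \<tau> where "mp_bij \<tau>" "\<And>x. x \<in> {0..1} \<Longrightarrow> \<sigma> (\<tau> x) = x" "\<And>x. x \<in> {0..1} \<Longrightarrow> \<tau> (\<sigma> x) = x"
proof -
  let ?t = "inv_into {0..1} \<sigma>"
  have b: "bij_betw \<sigma> {0..1} {0..1}" using s unfolding mp_bij_def by blast
  have bt: "bij_betw ?t {0..1} {0..1}" using b by (rule bij_betw_inv_into)
  have st: "\<sigma> (?t x) = x" if "x \<in> {0..1}" for x using b that by (rule bij_betw_inv_into_right)
  have ts: "?t (\<sigma> x) = x" if "x \<in> {0..1}" for x using b that by (rule bij_betw_inv_into_left)
  have tm: "?t x \<in> {0..1}" if "x \<in> {0..1}" for x using bt that unfolding bij_betw_def by blast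
  have "mp_bij ?t"
    unfolding mp_bij_def
  proof (intro conjI ballI impI bt)
    fix A :: "real set" assume A: "A \<in> sets borel" "A \<subseteq> {0..1}"
    have e1: "?t -` A \<inter> {0..1} = \<sigma> ` A"
    proof
      show "?t -` A \<inter> {0..1} \<subseteq> \<sigma> ` A"
      proof
        fix x assume "x \<in> ?t -` A \<inter> {0..1}"
        then show "x \<in> \<sigma> ` A" by (intro image_eqI[of x \<sigma> "?t x"]) (auto simp: st)
      qed
      show "\<sigma> ` A \<subseteq> ?t -` A \<inter> {0..1}" using ts A mp_bij_mem[OF s] by (auto simp: subset_iff)
    qed
    have e2: "?t ` A = \<sigma> -` A \<inter> {0..1}"
    proof
      show "?t ` A \<subseteq> \<sigma> -` A \<inter> {0..1}" using st tm A by (auto simp: subset_iff)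
      show "\<sigma> -` A \<inter> {0..1} \<subseteq> ?t ` A"
      proof
        fix x assume "x \<in> \<sigma> -` A \<inter> {0..1}"
        then show "x \<in> ?t ` A" by (intro image_eqI[of x ?t "\<sigma> x"]) (auto simp: ts)
      qed
    qed
    show "?t -` A \<inter> {0..1} \<in> sets borel" unfolding e1 by (rule mp_bijD[OF s A])
    show "?t ` A \<in> sets borel" unfolding e2 by (rule mp_bijD[OF s A])
    show "emeasure lborel (?t -` A \<inter> {0..1}) = emeasure lborel A"
      unfolding e1 by (rule mp_bij_image_emeasure[OF s A])
  qed
  then show thesis using st ts that by blast
qed

lemma act_act:
  assumes "mp_bij \<sigma>"
  shows "act \<sigma> (act \<tau> k) = act (\<tau> \<circ> \<sigma>) k"
  using mp_bij_mem[OF assms] by (auto simp: act_def fun_eq_iff unitsq_def)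

lemma act_id:
  assumes "\<And>p. p \<notin> unitsq \<Longrightarrow> k p = 0" "\<And>x. x \<in> {0..1} \<Longrightarrow> \<sigma> x = x"
  shows "act \<sigma> k = k"
  using assms by (auto simp: act_def fun_eq_iff unitsq_def)

text \<open>A map with \<open>mp_bij\<close> is arbitrary outside [0,1] and may fail to be
  measurable there; replacing it by the identity outside gives a Borel map of the plane that
  preserves \<open>usq\<close>.\<close>

definition ext2 :: "(real \<Rightarrow> real) \<Rightarrow> real \<times> real \<Rightarrow> real \<times> real" where
  "ext2 \<sigma> = (\<lambda>(x, y). (if x \<in> {0..1} then \<sigma> x else x, if y \<in> {0..1} then \<sigma> y else y))"

lemma act_ext2: "act \<sigma> k p = indicator unitsq p * k (ext2 \<sigma> p)"
  by (cases p) (auto simp: act_def ext2_def unitsq_def)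

lemma mp_bij_ext_measurable:
  assumes s: "mp_bij \<sigma>"
  shows "(\<lambda>x. if x \<in> {0..1} then \<sigma> x else x) \<in> borel_measurable borel"
proof (rule measurableI)
  fix A :: "real set" assume A: "A \<in> sets borel"
  have "(\<lambda>x. if x \<in> {0..1} then \<sigma> x else x) -` A =
      (\<sigma> -` (A \<inter> {0..1}) \<inter> {0..1}) \<union> (A - {0..1})"
    using mp_bij_mem[OF s] by (auto split: if_splits)
  moreover have "\<sigma> -` (A \<inter> {0..1}) \<inter> {0..1} \<in> sets borel"
  proof -
    have "A \<inter> {0..1} \<in> sets borel" "A \<inter> {0..1} \<subseteq> {0..1}" using A by auto
    then show ?thesis by (rule mp_bijD[OF s])
  qed
  ultimately show "(\<lambda>x. if x \<in> {0..1} then \<sigma> x else x) -` A \<inter> space borel \<in> sets borel" using A by auto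
qed simp

definition uint :: "real measure" where
  "uint = density lborel (\<lambda>x. ennreal (indicator {0..1} x))"

lemma sets_uint [simp, measurable_cong]: "sets uint = sets borel" by (simp add: uint_def)
lemma space_uint [simp]: "space uint = UNIV" by (simp add: uint_def)

lemma emeasure_uint:
  assumes "A \<in> sets borel"
  shows "emeasure uint A = emeasure lborel (A \<inter> {0..1})"
proof -
  have "emeasure uint A = (\<integral>\<^sup>+x. ennreal (indicator {0..1} x) * indicator A x \<partial>lborel)"
    unfolding uint_def by (rule emeasure_density) (use assms in auto)
  also have "\<dots> = (\<integral>\<^sup>+x. indicator (A \<inter> {0..1}) x \<partial>lborel)"
    by (rule nn_integral_cong) (auto simp: indicator_def)
  finally show ?thesis using assms by simp
qed

lemma prob_space_uint: "prob_space uint"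
  by standard (simp add: emeasure_uint)

lemma usq_pair: "usq = uint \<Otimes>\<^sub>M uint"
proof -
  interpret u: prob_space uint by (rule prob_space_uint)
  have "uint \<Otimes>\<^sub>M uint = density (lborel \<Otimes>\<^sub>M lborel) (\<lambda>(x, y). ennreal (indicator {0..1} x) * ennreal (indicator {0..1} y))"
    unfolding uint_def
    by (rule pair_measure_density)
       (auto intro: lborel.sigma_finite_measure_axioms u.sigma_finite_measure_axioms[unfolded uint_def])
  also have "\<dots> = density lborel (\<lambda>(x, y). ennreal (indicator {0..1} x) * ennreal (indicator {0..1} y))"
    by (simp add: lborel_prod)
  also have "(\<lambda>(x, y). ennreal (indicator {0..1} x) * ennreal (indicator {0..1} y)) =
      (\<lambda>p :: real \<times> real. ennreal (indicator unitsq p))"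
    by (auto simp: fun_eq_iff unitsq_def indicator_def)
  finally show ?thesis by (simp add: usq_def)
qed

lemma ext2_measurable:
  assumes s: "mp_bij \<sigma>"
  shows "ext2 \<sigma> \<in> borel_measurable borel"
proof -
  note mp_bij_ext_measurable[OF s, measurable]
  have "ext2 \<sigma> \<in> borel \<Otimes>\<^sub>M borel \<rightarrow>\<^sub>M borel \<Otimes>\<^sub>M borel"
    unfolding ext2_def by measurable
  then show ?thesis by (simp only: borel_prod)
qed

text \<open>The measure is a product and the map acts on each coordinate separately, so invariance
  reduces to the interval, where it is part of \<open>mp_bij\<close>.\<close>

lemma distr_ext2:
  assumes s: "mp_bij \<sigma>"
  shows "distr usq borel (ext2 \<sigma>) = usq"
proof -
  interpret u: prob_space uint by (rule prob_space_uint)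
  let ?s = "\<lambda>x. if x \<in> {0..1} then \<sigma> x else x"
  have m: "?s \<in> borel_measurable borel" by (rule mp_bij_ext_measurable[OF s])
  have d: "distr uint borel ?s = uint"
  proof (rule measure_eqI)
    fix A :: "real set" assume "A \<in> sets (distr uint borel ?s)"
    then have A: "A \<in> sets borel" by simp
    have "emeasure (distr uint borel ?s) A = emeasure uint (?s -` A)"
      using emeasure_distr[of ?s uint borel A] m A by simp
    also have "\<dots> = emeasure lborel (?s -` A \<inter> {0..1})"
      by (rule emeasure_uint) (use measurable_sets[OF m A] in simp)
    also have "?s -` A \<inter> {0..1} = \<sigma> -` (A \<inter> {0..1}) \<inter> {0..1}"
      using mp_bij_mem[OF s] by auto
    also have "emeasure lborel \<dots> = emeasure lborel (A \<inter> {0..1})"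
    proof -
      have "A \<inter> {0..1} \<in> sets borel" "A \<inter> {0..1} \<subseteq> {0..1}" using A by auto
      then show ?thesis by (rule mp_bijD[OF s])
    qed
    finally show "emeasure (distr uint borel ?s) A = emeasure uint A" by (simp add: emeasure_uint A)
  qed simp
  have "uint \<Otimes>\<^sub>M uint = distr uint borel ?s \<Otimes>\<^sub>M distr uint borel ?s" using d by simp
  also have "\<dots> = distr (uint \<Otimes>\<^sub>M uint) (borel \<Otimes>\<^sub>M borel) (\<lambda>(x, y). (?s x, ?s y))"
    by (rule pair_measure_distr) (use m d u.sigma_finite_measure_axioms in auto)
  finally show ?thesis unfolding usq_pair[symmetric] ext2_def borel_prod by simp
qed

section \<open>The group action on kernels\<close>

lemma kernels_measurable: "k \<in> kernels \<Longrightarrow> k \<in> borel_measurable borel"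
  by (simp add: kernels_def)

lemma kernels_sq: "k \<in> kernels \<Longrightarrow> integrable usq (\<lambda>p. (k p)\<^sup>2)"
proof -
  assume k: "k \<in> kernels"
  have m: "(\<lambda>p. (k p)\<^sup>2) \<in> borel_measurable borel" using kernels_measurable[OF k] by measurable
  have "(\<lambda>p. indicator unitsq p * (k p)\<^sup>2) = (\<lambda>p. (k p)\<^sup>2)"
    using k by (auto simp: kernels_def indicator_def fun_eq_iff)
  then show ?thesis unfolding integrable_usq_iff[OF m] using k by (simp add: kernels_def)
qed

lemma integrable_of_sq:
  fixes f :: "real \<times> real \<Rightarrow> real"
  assumes "f \<in> borel_measurable borel" "integrable usq (\<lambda>p. (f p)\<^sup>2)"
  shows "integrable usq f"
proof (rule Bochner_Integration.integrable_bound[of usq "\<lambda>p. 1 + (f p)\<^sup>2"])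
  have "\<bar>x\<bar> \<le> 1 + x\<^sup>2" for x :: real
  proof (cases "\<bar>x\<bar> \<le> 1")
    case False
    then have "\<bar>x\<bar> * 1 \<le> \<bar>x\<bar> * \<bar>x\<bar>" by (intro mult_left_mono) auto
    then show ?thesis by (simp add: power2_eq_square)
  qed (use zero_le_power2[of x] in linarith)
  then show "AE p in usq. norm (f p) \<le> norm (1 + (f p)\<^sup>2)" by (intro AE_I2) auto
qed (use assms in auto)

lemma kernels_integrable: "k \<in> kernels \<Longrightarrow> integrable usq k"
  by (rule integrable_of_sq[OF kernels_measurable kernels_sq])

lemma kernelsI:
  assumes "k \<in> borel_measurable borel" "\<And>p. p \<notin> unitsq \<Longrightarrow> k p = 0" "\<And>x y. k (x, y) = k (y, x)"
    "integrable usq (\<lambda>p. (k p)\<^sup>2)"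
  shows "k \<in> kernels"
proof -
  have m: "(\<lambda>p. (k p)\<^sup>2) \<in> borel_measurable borel" using assms(1) by measurable
  have "(\<lambda>p. indicator unitsq p * (k p)\<^sup>2) = (\<lambda>p. (k p)\<^sup>2)"
    using assms by (auto simp: indicator_def fun_eq_iff)
  then have "integrable lborel (\<lambda>p. (k p)\<^sup>2)" using assms(4) unfolding integrable_usq_iff[OF m] by simp
  then show ?thesis using assms by (auto simp: kernels_def)
qed

lemma kernels_outside: "k \<in> kernels \<Longrightarrow> p \<notin> unitsq \<Longrightarrow> k p = 0"
  unfolding kernels_def by blast

lemma AE_usq_unitsq: "AE p in usq. p \<in> unitsq"
  using AE_usq_Ico by eventually_elim (auto simp: unitsq_def)

lemma act_AE: "AE p in usq. act \<sigma> k p = k (ext2 \<sigma> p)"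
  using AE_usq_unitsq by eventually_elim (simp add: act_ext2)

lemma act_measurable:
  assumes "mp_bij \<sigma>" "k \<in> borel_measurable borel"
  shows "act \<sigma> k \<in> borel_measurable borel"
proof -
  note assms(2)[measurable] ext2_measurable[OF assms(1), measurable]
  show ?thesis unfolding act_ext2[abs_def] by measurable
qed

lemma nn_integral_act:
  fixes \<phi> :: "real \<Rightarrow> ennreal"
  assumes s: "mp_bij \<sigma>" and [measurable]: "k \<in> borel_measurable borel" "\<phi> \<in> borel_measurable borel"
  shows "(\<integral>\<^sup>+p. \<phi> (act \<sigma> k p) \<partial>usq) = (\<integral>\<^sup>+p. \<phi> (k p) \<partial>usq)"
proof -
  note ext2_measurable[OF s, measurable]
  have "(\<integral>\<^sup>+p. \<phi> (act \<sigma> k p) \<partial>usq) = (\<integral>\<^sup>+p. \<phi> (k (ext2 \<sigma> p)) \<partial>usq)"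
    by (rule nn_integral_cong_AE) (use act_AE[of \<sigma> k] in eventually_elim, simp)
  also have "\<dots> = (\<integral>\<^sup>+p. \<phi> (k p) \<partial>(distr usq borel (ext2 \<sigma>)))"
    by (rule nn_integral_distr[symmetric]) measurable
  finally show ?thesis by (simp add: distr_ext2[OF s])
qed

lemma integrable_ext2:
  fixes f :: "real \<times> real \<Rightarrow> real"
  assumes s: "mp_bij \<sigma>" and f: "integrable usq f"
  shows "integrable usq (\<lambda>p. f (ext2 \<sigma> p))"
proof -
  note ext2_measurable[OF s, measurable]
  have "integrable (distr usq borel (ext2 \<sigma>)) f" using f by (simp add: distr_ext2[OF s])
  then show ?thesis
    using integrable_distr_eq[of "ext2 \<sigma>" usq borel f] borel_measurable_integrable[OF f] by simp
qed

lemma integral_ext2: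
  fixes f :: "real \<times> real \<Rightarrow> real"
  assumes s: "mp_bij \<sigma>" and f: "integrable usq f"
  shows "(\<integral>p. f (ext2 \<sigma> p) \<partial>usq) = (\<integral>p. f p \<partial>usq)"
proof -
  note ext2_measurable[OF s, measurable]
  have "(\<integral>p. f p \<partial>(distr usq borel (ext2 \<sigma>))) = (\<integral>p. f (ext2 \<sigma> p) \<partial>usq)"
    by (rule integral_distr) (use borel_measurable_integrable[OF f] in auto)
  then show ?thesis by (simp add: distr_ext2[OF s])
qed

lemma act_kernels:
  assumes s: "mp_bij \<sigma>" and k: "k \<in> kernels"
  shows "act \<sigma> k \<in> kernels"
proof (rule kernelsI)
  show "act \<sigma> k \<in> borel_measurable borel" by (rule act_measurable[OF s kernels_measurable[OF k]])
  then have [measurable]: "act \<sigma> k \<in> borel_measurable borel" .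
  show "act \<sigma> k p = 0" if "p \<notin> unitsq" for p using that by (simp add: act_ext2)
  show "act \<sigma> k (x, y) = act \<sigma> k (y, x)" for x y
    using k by (auto simp: act_def unitsq_def kernels_def)
  have "integrable usq (\<lambda>p. (k (ext2 \<sigma> p))\<^sup>2)" by (rule integrable_ext2[OF s kernels_sq[OF k]])
  then show "integrable usq (\<lambda>p. (act \<sigma> k p)\<^sup>2)"
  proof (rule Bochner_Integration.integrable_bound)
    show "AE p in usq. norm ((act \<sigma> k p)\<^sup>2) \<le> norm ((k (ext2 \<sigma> p))\<^sup>2)"
      using act_AE[of \<sigma> k] by eventually_elim simp
  qed simp
qed

lemma cut_dist_kernels:
  "k1 \<in> kernels \<Longrightarrow> k2 \<in> kernels \<Longrightarrow> cut_dist k1 k2 = cutn (\<lambda>p. k1 p - k2 p)"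
  by (rule cut_dist_cutn) (auto intro: kernels_measurable)

text \<open>A rectangle tested against the moved kernels amounts to the rectangle of the images of
  its sides tested against the original ones; the images are Borel because \<open>mp_bij\<close>
  demands it. The reverse inequality follows by applying this to the inverse bijection.\<close>

lemma cut_dist_act_le:
  assumes s: "mp_bij \<sigma>" and k: "k1 \<in> kernels" "k2 \<in> kernels"
  shows "cut_dist (act \<sigma> k1) (act \<sigma> k2) \<le> cut_dist k1 k2"
  unfolding cut_dist_kernels[OF k] cut_dist_kernels[OF act_kernels[OF s k(1)] act_kernels[OF s k(2)]]
proof (rule cutn_least)
  fix A B :: "real set" assume *: "A \<in> sets borel" "A \<subseteq> {0..1}" "B \<in> sets borel" "B \<subseteq> {0..1}"
  have i: "integrable usq (\<lambda>p. k1 p - k2 p)" using k by (simp add: kernels_integrable)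
  note [measurable] = kernels_measurable[OF k(1)] kernels_measurable[OF k(2)]
    act_measurable[OF s kernels_measurable[OF k(1)]] act_measurable[OF s kernels_measurable[OF k(2)]]
    ext2_measurable[OF s]
  have im: "\<sigma> ` A \<in> sets borel" "\<sigma> ` A \<subseteq> {0..1}" "\<sigma> ` B \<in> sets borel" "\<sigma> ` B \<subseteq> {0..1}"
    using * mp_bij_image_subset[OF s] mp_bijD(2)[OF s] by simp_all
  have [measurable]: "A \<times> B \<in> sets borel" "\<sigma> ` A \<times> \<sigma> ` B \<in> sets borel"
    using * im by (auto intro: Times_borel)
  have inj: "inj_on \<sigma> {0..1}" using s by (simp add: mp_bij_def bij_betw_def)
  have mem: "\<sigma> x \<in> \<sigma> ` S \<longleftrightarrow> x \<in> S" if "S \<subseteq> {0..1}" "x \<in> {0..1}" for S x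
    using inj_on_image_mem_iff[OF inj] that by blast
  have "(\<integral>p. indicator (A \<times> B) p * (act \<sigma> k1 p - act \<sigma> k2 p) \<partial>usq)
      = (\<integral>p. indicator (\<sigma> ` A \<times> \<sigma> ` B) (ext2 \<sigma> p) * (k1 (ext2 \<sigma> p) - k2 (ext2 \<sigma> p)) \<partial>usq)"
  proof (rule integral_cong_AE)
    show "AE p in usq. indicator (A \<times> B) p * (act \<sigma> k1 p - act \<sigma> k2 p) =
        indicator (\<sigma> ` A \<times> \<sigma> ` B) (ext2 \<sigma> p) * (k1 (ext2 \<sigma> p) - k2 (ext2 \<sigma> p))"
      using AE_usq_unitsq
    proof eventually_elim
      case (elim p)
      then show ?case using mem[OF *(2)] mem[OF *(4)]
        by (cases p) (auto simp: act_ext2 ext2_def unitsq_def indicator_def)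
    qed
  qed measurable
  also have "\<dots> = (\<integral>p. indicator (\<sigma> ` A \<times> \<sigma> ` B) p * (k1 p - k2 p) \<partial>usq)"
    by (rule integral_ext2[OF s]) (rule integrable_indicator_mult_usq[OF i], simp)
  finally show "\<bar>\<integral>p. indicator (A \<times> B) p * (act \<sigma> k1 p - act \<sigma> k2 p) \<partial>usq\<bar> \<le> cutn (\<lambda>p. k1 p - k2 p)"
    using cutn_upper[OF i im] by simp
qed

lemma act_inverse:
  assumes s: "mp_bij \<sigma>"
  obtains \<tau> where "mp_bij \<tau>" "\<And>k. k \<in> kernels \<Longrightarrow> act \<tau> (act \<sigma> k) = k" "\<And>k. k \<in> kernels \<Longrightarrow> act \<sigma> (act \<tau> k) = k"
proof -
  obtain \<tau> where t: "mp_bij \<tau>" "\<And>x. x \<in> {0..1} \<Longrightarrow> \<sigma> (\<tau> x) = x" "\<And>x. x \<in> {0..1} \<Longrightarrow> \<tau> (\<sigma> x) = x"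
    using mp_bij_inverse[OF s] by metis
  show thesis
  proof (rule that[OF t(1)])
    fix k assume k: "k \<in> kernels"
    show "act \<tau> (act \<sigma> k) = k" unfolding act_act[OF t(1)]
      by (rule act_id[OF kernels_outside[OF k]]) (simp_all add: t)
    show "act \<sigma> (act \<tau> k) = k" unfolding act_act[OF s]
      by (rule act_id[OF kernels_outside[OF k]]) (simp_all add: t)
  qed
qed

lemma cut_dist_act:
  assumes s: "mp_bij \<sigma>" and k: "k1 \<in> kernels" "k2 \<in> kernels"
  shows "cut_dist (act \<sigma> k1) (act \<sigma> k2) = cut_dist k1 k2"
proof (rule antisym[OF cut_dist_act_le[OF assms]])
  obtain \<tau> where t: "mp_bij \<tau>" "\<And>k. k \<in> kernels \<Longrightarrow> act \<tau> (act \<sigma> k) = k"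
    using act_inverse[OF s] by metis
  show "cut_dist k1 k2 \<le> cut_dist (act \<sigma> k1) (act \<sigma> k2)"
    using cut_dist_act_le[OF t(1) act_kernels[OF s k(1)] act_kernels[OF s k(2)]] t(2) k by simp
qed

section \<open>Distances between kernels and between orbits\<close>

lemma cut_dist_sym: "k1 \<in> kernels \<Longrightarrow> k2 \<in> kernels \<Longrightarrow> cut_dist k1 k2 = cut_dist k2 k1"
  using cutn_minus[of k1 k2] by (simp add: cut_dist_kernels)

lemma cut_dist_nonneg: "k1 \<in> kernels \<Longrightarrow> k2 \<in> kernels \<Longrightarrow> 0 \<le> cut_dist k1 k2"
  by (simp add: cut_dist_kernels cutn_nonneg kernels_integrable)

lemma cut_dist_triangle:
  assumes k: "k1 \<in> kernels" "k2 \<in> kernels" "k3 \<in> kernels"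
  shows "cut_dist k1 k3 \<le> cut_dist k1 k2 + cut_dist k2 k3"
proof -
  have "(\<lambda>p. k1 p - k3 p) = (\<lambda>p. (k1 p - k2 p) + (k2 p - k3 p))" by auto
  then show ?thesis using cutn_triangle[of "\<lambda>p. k1 p - k2 p" "\<lambda>p. k2 p - k3 p"] k
    by (simp add: cut_dist_kernels kernels_integrable)
qed

text \<open>Stands for an orbit distance below \<open>e\<close>, but refers to the kernels
  themselves and not to the representatives picked by \<open>rep\<close>. Strictness turns the
  infimum in \<open>dtil\<close> into an existential statement.\<close>

definition near :: "real \<Rightarrow> (real \<times> real \<Rightarrow> real) \<Rightarrow> (real \<times> real \<Rightarrow> real) \<Rightarrow> bool" where
  "near e k1 k2 \<longleftrightarrow> (\<exists>\<sigma>. mp_bij \<sigma> \<and> cut_dist (act \<sigma> k1) k2 < e)"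

lemma nearI_cut:
  assumes "k1 \<in> kernels" "cut_dist k1 k2 < e"
  shows "near e k1 k2"
  unfolding near_def by (intro exI[of _ id] conjI mp_bij_id) (simp add: assms act_id kernels_outside)

lemma near_sym:
  assumes k: "k1 \<in> kernels" "k2 \<in> kernels" and n: "near e k1 k2"
  shows "near e k2 k1"
proof -
  obtain \<sigma> where s: "mp_bij \<sigma>" "cut_dist (act \<sigma> k1) k2 < e" using n by (auto simp: near_def)
  obtain \<tau> where t: "mp_bij \<tau>" "\<And>k. k \<in> kernels \<Longrightarrow> act \<tau> (act \<sigma> k) = k"
    using act_inverse[OF s(1)] by metis
  have "cut_dist (act \<tau> k2) k1 = cut_dist k1 (act \<tau> k2)"
    by (intro cut_dist_sym act_kernels t k)
  also have "\<dots> = cut_dist (act \<tau> (act \<sigma> k1)) (act \<tau> k2)" using t k by simp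
  also have "\<dots> = cut_dist (act \<sigma> k1) k2" by (intro cut_dist_act act_kernels t s k)
  finally show ?thesis using s t unfolding near_def by auto
qed

lemma near_trans:
  assumes k: "k1 \<in> kernels" "k2 \<in> kernels" "k3 \<in> kernels" and n: "near a k1 k2" "near b k2 k3"
  shows "near (a + b) k1 k3"
proof -
  obtain \<sigma> where s: "mp_bij \<sigma>" "cut_dist (act \<sigma> k1) k2 < a" using n by (auto simp: near_def)
  obtain \<tau> where t: "mp_bij \<tau>" "cut_dist (act \<tau> k2) k3 < b" using n by (auto simp: near_def)
  have "cut_dist (act \<tau> (act \<sigma> k1)) k3 \<le> cut_dist (act \<tau> (act \<sigma> k1)) (act \<tau> k2) + cut_dist (act \<tau> k2) k3"
    by (intro cut_dist_triangle act_kernels s t k)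
  also have "cut_dist (act \<tau> (act \<sigma> k1)) (act \<tau> k2) = cut_dist (act \<sigma> k1) k2"
    by (intro cut_dist_act act_kernels s t k)
  finally have "cut_dist (act (\<sigma> \<circ> \<tau>) k1) k3 < a + b" using s t by (simp add: act_act)
  then show ?thesis using mp_bij_comp[OF s(1) t(1)] unfolding near_def by blast
qed

lemma near_act:
  assumes "k \<in> kernels" "mp_bij \<sigma>" "e > 0"
  shows "near e k (act \<sigma> k)"
proof -
  have "cut_dist (act \<sigma> k) (act \<sigma> k) \<le> 0"
    using assms by (simp add: cut_dist_kernels act_kernels cutn_le_L1[of "\<lambda>_. 0", simplified])
  then show ?thesis unfolding near_def using assms by fastforce
qed

lemma near_mono: "near e k1 k2 \<Longrightarrow> e \<le> e' \<Longrightarrow> near e' k1 k2"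
  unfolding near_def by (meson less_le_trans)

text \<open>The slack pays for intermediate steps at distance 0, which \<open>near\<close> only
  provides with a positive radius.\<close>

lemma near_strict:
  assumes "near e k1 k2"
  obtains e' where "e' < e" "near e' k1 k2"
proof -
  obtain \<sigma> where s: "mp_bij \<sigma>" "cut_dist (act \<sigma> k1) k2 < e" using assms by (auto simp: near_def)
  then obtain e' where "cut_dist (act \<sigma> k1) k2 < e'" "e' < e" using dense by blast
  then show thesis using that s unfolding near_def by blast
qed

lemma near_act_right:
  assumes k: "k1 \<in> kernels" "k2 \<in> kernels" and s: "mp_bij \<sigma>"
  shows "near e k1 (act \<sigma> k2) \<longleftrightarrow> near e k1 k2"
proof -
  have *: "near e k1 (act \<sigma> k)" if "near e k1 k" "k \<in> kernels" "mp_bij \<sigma>" for k \<sigma>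
  proof -
    obtain e' where e': "e' < e" "near e' k1 k" using near_strict[OF \<open>near e k1 k\<close>] by blast
    have "near (e' + (e - e')) k1 (act \<sigma> k)"
      by (rule near_trans[OF k(1) that(2) act_kernels[OF that(3,2)] e'(2)]) (use e' that near_act in auto)
    then show ?thesis by simp
  qed
  obtain \<tau> where t: "mp_bij \<tau>" "\<And>k. k \<in> kernels \<Longrightarrow> act \<tau> (act \<sigma> k) = k"
    using act_inverse[OF s] by metis
  show ?thesis
    using *[of k2 \<sigma>] *[of "act \<sigma> k2" \<tau>] t s k act_kernels by auto
qed

lemma near_act_left:
  assumes k: "k1 \<in> kernels" "k2 \<in> kernels" and s: "mp_bij \<sigma>"
  shows "near e (act \<sigma> k1) k2 \<longleftrightarrow> near e k1 k2"
  using near_act_right[OF k(2,1) s] near_sym act_kernels[OF s] k by metis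

lemma rep_orbit:
  assumes "k \<in> kernels"
  obtains \<sigma> where "mp_bij \<sigma>" "rep (orbit k) = act \<sigma> k"
proof -
  have "act id k \<in> orbit k" unfolding orbit_def using mp_bij_id by blast
  then have "rep (orbit k) \<in> orbit k" unfolding rep_def by (rule someI[of "\<lambda>k'. k' \<in> orbit k"])
  then show thesis using that unfolding orbit_def by blast
qed

lemma rep_orbit_kernels: "k \<in> kernels \<Longrightarrow> rep (orbit k) \<in> kernels"
  by (metis rep_orbit act_kernels)

text \<open>The representatives differ from the given kernels by group elements, and
  \<open>near\<close> is invariant under these on both sides.\<close>

lemma dtil_less_iff:
  assumes k: "k1 \<in> kernels" "k2 \<in> kernels"
  shows "dtil (orbit k1) (orbit k2) < e \<longleftrightarrow> near e k1 k2"
proof -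
  obtain \<sigma> where s: "mp_bij \<sigma>" "rep (orbit k1) = act \<sigma> k1" by (rule rep_orbit[OF k(1)])
  obtain \<tau> where t: "mp_bij \<tau>" "rep (orbit k2) = act \<tau> k2" by (rule rep_orbit[OF k(2)])
  have "dtil (orbit k1) (orbit k2) < e \<longleftrightarrow> near e (rep (orbit k1)) (rep (orbit k2))"
    unfolding dtil_def near_def
  proof (subst cINF_less_iff)
    show "{\<sigma>. mp_bij \<sigma>} \<noteq> {}" using mp_bij_id by blast
    show "bdd_below ((\<lambda>\<sigma>. cut_dist (act \<sigma> (rep (orbit k1))) (rep (orbit k2))) ` {\<sigma>. mp_bij \<sigma>})"
      by (rule bdd_belowI[of _ 0]) (auto intro!: cut_dist_nonneg act_kernels rep_orbit_kernels k)
  qed auto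
  then show ?thesis using near_act_left[OF k(1) act_kernels[OF t(1) k(2)] s(1)] near_act_right[OF k t(1)] s t
    by simp
qed

lemma orbit_in_Ktil: "k \<in> kernels \<Longrightarrow> orbit k \<in> Ktil"
  by (simp add: Ktil_def)

section \<open>Matrices as kernels\<close>

text \<open>Permutes the grid cells by \<open>\<pi>\<close>, translating each of them; the endpoint 1 lies in no half-open cell and stays fixed.\<close>

definition permmap :: "nat \<Rightarrow> (nat \<Rightarrow> nat) \<Rightarrow> real \<Rightarrow> real" where
  "permmap n \<pi> x = x + (\<Sum>i<n. (real (\<pi> i) - real i) / real n * indicator (Ic n i) x)"

lemma permmap_Ic:
  assumes "i < n" "x \<in> Ic n i"
  shows "permmap n \<pi> x = x + (real (\<pi> i) - real i) / real n"
proof -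
  have "indicator (Ic n j) x = (if j = i then 1 else 0 :: real)" if "j < n" for j
  proof (cases "x \<in> Ic n j")
    case True
    then have "j = i" using cell_Ic[OF assms] cell_Ic[OF that True] by simp
    then show ?thesis using True by simp
  next
    case False
    then have "j \<noteq> i" using assms by blast
    then show ?thesis using False by simp
  qed
  then have "(\<Sum>j<n. (real (\<pi> j) - real j) / real n * indicator (Ic n j) x) =
      (\<Sum>j<n. if j = i then (real (\<pi> j) - real j) / real n else 0)"
    by (intro sum.cong) auto
  then show ?thesis using assms by (simp add: permmap_def)
qed

lemma Ic_shift: "n > 0 \<Longrightarrow> x + (real j - real i) / real n \<in> Ic n j \<longleftrightarrow> x \<in> Ic n i"
  unfolding Ic_def by (auto simp: diff_divide_distrib add_divide_distrib)

lemma permmap_Ic_mem: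
  assumes "i < n" "x \<in> Ic n i"
  shows "permmap n \<pi> x \<in> Ic n (\<pi> i)"
  using assms Ic_shift[of n x "\<pi> i" i] by (simp add: permmap_Ic)

lemma ex_Ic:
  assumes "n > 0" "x \<in> {0..<1}"
  obtains i where "i < n" "x \<in> Ic n i"
  using cell_less[of n x] mem_Ic_iff[of n x] assms by auto

lemma permmap_1:
  assumes "n > 0"
  shows "permmap n \<pi> 1 = 1"
proof -
  have "indicator (Ic n i) (1::real) = (0::real)" if "i < n" for i
    using Ic_subset[OF that] by (auto simp: indicator_def)
  then show ?thesis by (simp add: permmap_def)
qed

lemma permmap_inverse:
  assumes n: "n > 0" and p: "\<pi> permutes {..<n}" and x: "x \<in> {0..1}"
  shows "permmap n (inv \<pi>) (permmap n \<pi> x) = x"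
proof (cases "x = 1")
  case True then show ?thesis using permmap_1[OF n] by simp
next
  case False
  then obtain i where i: "i < n" "x \<in> Ic n i" using ex_Ic[OF n, of x] x by auto
  have pi: "\<pi> i < n" using permutes_in_image[OF p, of i] i by simp
  have "permmap n (inv \<pi>) (permmap n \<pi> x) = permmap n \<pi> x + (real (inv \<pi> (\<pi> i)) - real (\<pi> i)) / real n"
    by (rule permmap_Ic[OF pi permmap_Ic_mem[OF i, of \<pi>]])
  also have "\<dots> = x" using permutes_inverses(2)[OF p] by (simp add: permmap_Ic[OF i] diff_divide_distrib)
  finally show ?thesis .
qed

lemma permmap_mem:
  assumes n: "n > 0" and p: "\<pi> permutes {..<n}" and x: "x \<in> {0..1}"
  shows "permmap n \<pi> x \<in> {0..1}"
proof (cases "x = 1")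
  case True then show ?thesis using permmap_1[OF n] by simp
next
  case False
  then obtain i where i: "i < n" "x \<in> Ic n i" using ex_Ic[OF n, of x] x by auto
  have pi: "\<pi> i < n" using permutes_in_image[OF p, of i] i by simp
  then show ?thesis using permmap_Ic_mem[OF i, of \<pi>] Ic_subset[OF pi] by auto
qed

lemma permmap_measurable [measurable]: "permmap n \<pi> \<in> borel_measurable borel"
  unfolding permmap_def by measurable

lemma emeasure_Ic_partition:
  assumes n: "n > 0" and A: "A \<in> sets borel" "A \<subseteq> {0..1}"
  shows "emeasure lborel A = (\<Sum>i<n. emeasure lborel (A \<inter> Ic n i))"
proof -
  have d: "disjoint_family_on (\<lambda>i. A \<inter> Ic n i) {..<n}"
    unfolding disjoint_family_on_def using cell_Ic by (metis (no_types, lifting) disjoint_iff IntE lessThan_iff)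
  have "(\<Union>i<n. A \<inter> Ic n i) = A - {1}"
  proof
    show "(\<Union>i<n. A \<inter> Ic n i) \<subseteq> A - {1}" using Ic_subset by fastforce
    show "A - {1} \<subseteq> (\<Union>i<n. A \<inter> Ic n i)"
    proof
      fix x assume x: "x \<in> A - {1}"
      then have "x \<in> {0..<1}" using A by auto
      then obtain i where "i < n" "x \<in> Ic n i" using ex_Ic[OF n] by blast
      then show "x \<in> (\<Union>i<n. A \<inter> Ic n i)" using x by auto
    qed
  qed
  moreover have "(\<Sum>i<n. emeasure lborel (A \<inter> Ic n i)) = emeasure lborel (\<Union>i<n. A \<inter> Ic n i)"
    by (rule sum_emeasure) (use d A in auto)
  moreover have "emeasure lborel (A - {1}) = emeasure lborel A"
    by (rule emeasure_Diff_null_set) (use A in \<open>auto simp: null_sets_def\<close>)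
  ultimately show ?thesis by simp
qed

text \<open>On each cell the map is a translation onto another cell; the pieces are summed and
  reindexed by the permutation. The point 1 is null.\<close>

lemma permmap_emeasure:
  assumes n: "n > 0" and p: "\<pi> permutes {..<n}" and A: "A \<in> sets borel" "A \<subseteq> {0..1}"
  shows "emeasure lborel (permmap n \<pi> -` A \<inter> {0..1}) = emeasure lborel A"
proof -
  let ?B = "permmap n \<pi> -` A \<inter> {0..1}"
  have B: "?B \<in> sets borel" using measurable_sets[OF permmap_measurable A(1), of n \<pi>] by auto
  have piece: "emeasure lborel (?B \<inter> Ic n i) = emeasure lborel (A \<inter> Ic n (\<pi> i))" if i: "i < n" for i
  proof -
    let ?c = "(real (\<pi> i) - real i) / real n"
    have "?B \<inter> Ic n i = (\<lambda>x. ?c + x) -` (A \<inter> Ic n (\<pi> i)) \<inter> space lborel"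
    proof (intro set_eqI iffI)
      fix x assume x: "x \<in> ?B \<inter> Ic n i"
      then have "permmap n \<pi> x = ?c + x" using permmap_Ic[OF i, of x] by simp
      moreover have "permmap n \<pi> x \<in> Ic n (\<pi> i)" using permmap_Ic_mem[OF i] x by blast
      moreover have "permmap n \<pi> x \<in> A" using x by blast
      ultimately show "x \<in> (\<lambda>x. ?c + x) -` (A \<inter> Ic n (\<pi> i)) \<inter> space lborel" by simp
    next
      fix x assume x: "x \<in> (\<lambda>x. ?c + x) -` (A \<inter> Ic n (\<pi> i)) \<inter> space lborel"
      then have "x + ?c \<in> Ic n (\<pi> i)" "x + ?c \<in> A" by (simp_all add: add.commute)
      then have xi: "x \<in> Ic n i" using Ic_shift[OF n] by blast
      then have "x \<in> {0..<1}" using Ic_subset[OF i] by blast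
      then have "x \<in> {0..1}" by simp
      moreover have "permmap n \<pi> x \<in> A" using permmap_Ic[OF i xi] \<open>x + ?c \<in> A\<close> by simp
      ultimately show "x \<in> ?B \<inter> Ic n i" using xi by blast
    qed
    moreover have "emeasure (distr lborel borel (\<lambda>x. ?c + x)) (A \<inter> Ic n (\<pi> i))
        = emeasure lborel ((\<lambda>x. ?c + x) -` (A \<inter> Ic n (\<pi> i)) \<inter> space lborel)"
      by (rule emeasure_distr) (use A in auto)
    ultimately show ?thesis by (simp add: lborel_distr_plus)
  qed
  have "emeasure lborel ?B = (\<Sum>i<n. emeasure lborel (A \<inter> Ic n (\<pi> i)))"
    using emeasure_Ic_partition[OF n B] piece by simp
  also have "\<dots> = (\<Sum>i<n. emeasure lborel (A \<inter> Ic n i))"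
    using sum.permute[OF p, of "\<lambda>i. emeasure lborel (A \<inter> Ic n i)"] by (simp add: comp_def)
  finally show ?thesis using emeasure_Ic_partition[OF n A] by simp
qed

lemma permmap_mp_bij:
  assumes n: "n > 0" and p: "\<pi> permutes {..<n}"
  shows "mp_bij (permmap n \<pi>)"
proof -
  have ip: "inv \<pi> permutes {..<n}" by (rule permutes_inv[OF p])
  have inv1: "permmap n (inv \<pi>) (permmap n \<pi> x) = x" if "x \<in> {0..1}" for x
    by (rule permmap_inverse[OF n p that])
  have inv2: "permmap n \<pi> (permmap n (inv \<pi>) x) = x" if "x \<in> {0..1}" for x
    using permmap_inverse[OF n ip that] permutes_inv_inv[OF p] by simp
  show ?thesis unfolding mp_bij_def
  proof (intro conjI ballI impI)
    show "bij_betw (permmap n \<pi>) {0..1} {0..1}"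
      by (rule bij_betw_byWitness[where f' = "permmap n (inv \<pi>)"])
         (use inv1 inv2 permmap_mem[OF n p] permmap_mem[OF n ip] in \<open>auto simp del: atLeastAtMost_iff\<close>)
    fix A :: "real set" assume A: "A \<in> sets borel" "A \<subseteq> {0..1}"
    show "permmap n \<pi> -` A \<inter> {0..1} \<in> sets borel"
      using measurable_sets[OF permmap_measurable A(1), of n \<pi>] by auto
    show "emeasure lborel (permmap n \<pi> -` A \<inter> {0..1}) = emeasure lborel A"
      by (rule permmap_emeasure[OF n p A])
    have "permmap n \<pi> ` A = permmap n (inv \<pi>) -` A \<inter> {0..1}"
    proof
      show "permmap n \<pi> ` A \<subseteq> permmap n (inv \<pi>) -` A \<inter> {0..1}"
      proof
        fix y assume "y \<in> permmap n \<pi> ` A"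
        then obtain x where x: "x \<in> A" "y = permmap n \<pi> x" by blast
        then have "x \<in> {0..1}" using A by blast
        then show "y \<in> permmap n (inv \<pi>) -` A \<inter> {0..1}" using x inv1 permmap_mem[OF n p] by simp
      qed
      show "permmap n (inv \<pi>) -` A \<inter> {0..1} \<subseteq> permmap n \<pi> ` A"
      proof
        fix y assume y: "y \<in> permmap n (inv \<pi>) -` A \<inter> {0..1}"
        then show "y \<in> permmap n \<pi> ` A"
          by (intro image_eqI[of y _ "permmap n (inv \<pi>) y"]) (auto simp: inv2)
      qed
    qed
    then show "permmap n \<pi> ` A \<in> sets borel"
      using measurable_sets[OF permmap_measurable A(1), of n "inv \<pi>"] by auto
  qed
qed

lemma act_permmap_stepk:
  assumes n: "n > 0" and p: "\<pi> permutes {..<n}"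
  shows "AE q in usq. act (permmap n \<pi>) (stepk n a) q = stepk n (\<lambda>i j. a (\<pi> i) (\<pi> j)) q"
  using AE_usq_Ico
proof eventually_elim
  case (elim q)
  obtain x y where q: "q = (x, y)" by force
  have xy: "x \<in> {0..<1}" "y \<in> {0..<1}" using elim q by auto
  have c: "permmap n \<pi> x \<in> {0..<1} \<and> cell n (permmap n \<pi> x) = \<pi> (cell n x)" if x: "x \<in> {0..<1}" for x
  proof -
    obtain i where i: "i < n" "x \<in> Ic n i" using ex_Ic[OF n x] by blast
    have pi: "\<pi> i < n" using permutes_in_image[OF p, of i] i by simp
    have "cell n (permmap n \<pi> x) = \<pi> i" by (rule cell_Ic[OF pi permmap_Ic_mem[OF i, of \<pi>]])
    then show ?thesis using cell_Ic[OF i] permmap_Ic_mem[OF i, of \<pi>] Ic_subset[OF pi] by auto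
  qed
  have "act (permmap n \<pi>) (stepk n a) q = stepk n a (permmap n \<pi> x, permmap n \<pi> y)"
    using xy by (auto simp: q act_def unitsq_def)
  also have "\<dots> = a (\<pi> (cell n x)) (\<pi> (cell n y))"
    using c[OF xy(1)] c[OF xy(2)] by (subst stepk_val[OF n]) auto
  also have "\<dots> = stepk n (\<lambda>i j. a (\<pi> i) (\<pi> j)) q"
    using xy by (simp add: q stepk_val[OF n])
  finally show ?case .
qed

lemma cell_refine:
  assumes "n > 0" "m > 0" "0 \<le> x"
  shows "cell n x = cell (n * m) x div m"
proof -
  have "\<lfloor>real n * x\<rfloor> = \<lfloor>real (n * m) * x / real_of_int (int m)\<rfloor>" using assms by simp
  also have "\<dots> = \<lfloor>real (n * m) * x\<rfloor> div int m" by (rule floor_divide_real_eq_div) simp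
  finally show ?thesis using assms by (simp add: cell_def nat_div_distrib)
qed

lemma stepk_refine:
  assumes n: "n > 0" and m: "m > 0"
  shows "AE q in usq. stepk n a q = stepk (n * m) (\<lambda>i j. a (i div m) (j div m)) q"
  using AE_usq_Ico
proof eventually_elim
  case (elim q)
  have nm: "n * m > 0" using n m by simp
  show ?case using elim cell_refine[OF n m, of "fst q"] cell_refine[OF n m, of "snd q"]
    unfolding stepk_val[OF n elim] stepk_val[OF nm elim] by auto
qed

lemma stepk_kernels:
  assumes "\<And>i j. i < n \<Longrightarrow> j < n \<Longrightarrow> a i j = a j i"
  shows "stepk n a \<in> kernels"
proof (rule kernelsI)
  fix p assume p: "p \<notin> unitsq"
  have "indicator (cellsq n i j) p = (0 :: real)" if "i < n" "j < n" for i j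
    using Ic_subset[OF that(1)] Ic_subset[OF that(2)] p
    by (cases p) (auto simp: cellsq_def unitsq_def indicator_def)
  then show "stepk n a p = 0" by (simp add: stepk_def)
next
  fix x y
  have i: "indicator (cellsq n i j) (x, y) = (indicator (cellsq n j i) (y, x) :: real)" for i j
    by (simp add: cellsq_def indicator_def conj_commute)
  have "stepk n a (x, y) = (\<Sum>i<n. \<Sum>j<n. a j i * indicator (cellsq n j i) (y, x))"
    unfolding stepk_def by (intro sum.cong refl) (use assms i in auto)
  also have "\<dots> = stepk n a (y, x)" unfolding stepk_def by (rule sum.swap)
  finally show "stepk n a (x, y) = stepk n a (y, x)" .
next
  obtain B where B: "\<And>p. \<bar>stepk n a p\<bar> \<le> B" using stepk_bounded by blast
  have "(stepk n a p)\<^sup>2 \<le> B\<^sup>2" for p using B[of p] by (meson abs_ge_zero order.trans power2_le_iff_abs_le)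
  then show "integrable usq (\<lambda>p. (stepk n a p)\<^sup>2)"
    by (intro integrable_usq_bounded[of _ "B\<^sup>2"]) auto
qed auto

definition symm :: "(nat \<times> nat \<Rightarrow> real) \<Rightarrow> nat \<Rightarrow> nat \<Rightarrow> real" where
  "symm X i j = X (min i j, max i j)"

lemma symm_sym: "symm X i j = symm X j i"
  by (simp add: symm_def min.commute max.commute)

lemma AE_uint_point: "AE x in uint. x \<noteq> c"
proof -
  have "emeasure uint {c} = 0"
    by (subst emeasure_uint) (auto simp: emeasure_lborel_countable)
  then show ?thesis by (intro AE_I[where N = "{c}"]) auto
qed

lemma AE_usq_fst_snd:
  assumes "AE x in uint. P x"
  shows "AE p in usq. P (fst p) \<and> P (snd p)"
proof -
  obtain N where N: "N \<in> null_sets uint" "{x. \<not> P x} \<subseteq> N"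
    using assms by (auto simp: eventually_ae_filter)
  then have e0: "emeasure uint N = 0" and Nb: "N \<in> sets borel" by auto
  interpret u: prob_space uint by (rule prob_space_uint)
  have m: "N \<times> (UNIV :: real set) \<in> sets borel" "(UNIV :: real set) \<times> N \<in> sets borel"
    using Nb by (auto intro!: Times_borel)
  have "emeasure usq (N \<times> UNIV) = emeasure uint N * emeasure uint UNIV" unfolding usq_pair
    by (rule u.emeasure_pair_measure_Times) (use Nb in auto)
  moreover have "emeasure usq (UNIV \<times> N) = emeasure uint UNIV * emeasure uint N" unfolding usq_pair
    by (rule u.emeasure_pair_measure_Times) (use Nb in auto)
  ultimately have "N \<times> UNIV \<in> null_sets usq" "UNIV \<times> N \<in> null_sets usq" using m e0 by auto
  then have "N \<times> UNIV \<union> UNIV \<times> N \<in> null_sets usq" by (rule null_sets.Un)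
  then show ?thesis
    by (rule AE_I') (use N in auto)
qed

text \<open>The closed intervals of \<open>kmat\<close> and the cells differ in their right
  endpoints only, so the two sums agree outside finitely many horizontal and vertical lines.\<close>

lemma kmat_stepk:
  assumes n: "n > 0"
  shows "AE p in usq. kmat n X p = stepk n (symm X) p"
proof -
  have "AE x in uint. \<forall>i\<in>{..<n}. x \<noteq> (real i + 1) / real n"
    by (rule AE_finite_allI) (auto intro: AE_uint_point)
  then have "AE p in usq. (\<forall>i\<in>{..<n}. fst p \<noteq> (real i + 1) / real n) \<and> (\<forall>i\<in>{..<n}. snd p \<noteq> (real i + 1) / real n)"
    by (rule AE_usq_fst_snd)
  then show ?thesis
  proof eventually_elim
    case (elim p)
    have J: "indicator (Jint n i) x = (indicator (Ic n i) x :: real)" if "x \<noteq> (real i + 1) / real n" for x i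
      using that by (auto simp: Jint_def Ic_def indicator_def)
    show ?case using elim
      by (cases p) (auto simp: kmat_def stepk_def symm_def cellsq_def J indicator_times mult.assoc intro!: sum.cong)
  qed
qed

lemma kmat_kernels: "kmat n X \<in> kernels"
proof (cases "n = 0")
  case True
  have "integrable lborel (\<lambda>p::real\<times>real. 0 :: real)" by simp
  then show ?thesis using True by (simp add: kmat_def kernels_def)
next
  case False
  then have n: "n > 0" by simp
  have m: "kmat n X \<in> borel_measurable borel"
  proof -
    have "kmat n X \<in> borel_measurable (borel \<Otimes>\<^sub>M borel)"
      unfolding kmat_def Jint_def by measurable
    then show ?thesis by (simp only: borel_prod)
  qed
  show ?thesis
  proof (rule kernelsI[OF m])
    fix p assume p: "p \<notin> unitsq"
    have J: "Jint n i \<subseteq> {0..1}" if "i < n" for i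
    proof
      fix x assume "x \<in> Jint n i"
      then have "real i / real n \<le> x" "x \<le> (real i + 1) / real n" by (auto simp: Jint_def)
      moreover have "0 \<le> real i / real n" "(real i + 1) / real n \<le> 1" using that by (auto simp: field_simps)
      ultimately show "x \<in> {0..1}" by (simp del: divide_nonneg_nonneg)
    qed
    have "indicator (Jint n i) (fst p) * indicator (Jint n j) (snd p) = (0::real)" if "i < n" "j < n" for i j
      using J[OF that(1)] J[OF that(2)] p by (cases p) (auto simp: unitsq_def indicator_def)
    then have "X (min i j, max i j) * indicator (Jint n i) (fst p) * indicator (Jint n j) (snd p) = 0"
      if "i < n" "j < n" for i j using that by (simp only: mult.assoc mult_zero_right)
    then show "kmat n X p = 0" unfolding kmat_def split_def by (intro sum.neutral ballI) auto
  next
    fix x y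
    have "kmat n X (x, y) = (\<Sum>i<n. \<Sum>j<n. X (min j i, max j i) * indicator (Jint n j) y * indicator (Jint n i) x)"
      unfolding kmat_def prod.case
      by (intro sum.cong refl) (simp only: min.commute max.commute mult.assoc mult.commute[of "indicator _ x"])
    also have "\<dots> = kmat n X (y, x)" unfolding kmat_def prod.case by (rule sum.swap)
    finally show "kmat n X (x, y) = kmat n X (y, x)" .
  next
    have "integrable usq (\<lambda>p. (stepk n (symm X) p)\<^sup>2)"
      by (rule kernels_sq[OF stepk_kernels]) (rule symm_sym)
    then show "integrable usq (\<lambda>p. (kmat n X p)\<^sup>2)"
    proof (rule Bochner_Integration.integrable_bound)
      show "AE p in usq. norm ((kmat n X p)\<^sup>2) \<le> norm ((stepk n (symm X) p)\<^sup>2)"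
        using kmat_stepk[OF n, of X] by eventually_elim simp
      show "(\<lambda>p. (kmat n X p)\<^sup>2) \<in> borel_measurable usq" using m by simp
    qed
  qed
qed

lemma near_cong_AE:
  assumes k: "k1 \<in> kernels" "k1' \<in> kernels" "k2 \<in> kernels" and ae: "AE p in usq. k1 p = k1' p" and n: "near e k1 k2"
  shows "near e k1' k2"
proof -
  have "cut_dist k1' k1 = cutn (\<lambda>p. k1' p - k1 p)" by (rule cut_dist_kernels[OF k(2,1)])
  also have "\<dots> \<le> (\<integral>p. \<bar>k1' p - k1 p\<bar> \<partial>usq)" by (rule cutn_le_L1) (use k kernels_integrable in auto)
  also have "\<dots> = (\<integral>p. 0 \<partial>usq)"
    by (rule integral_cong_AE) (use k kernels_measurable ae in auto)
  finally have c: "cut_dist k1' k1 \<le> 0" by simp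
  obtain e' where e': "e' < e" "near e' k1 k2" using near_strict[OF n] by blast
  have "near ((e - e') + e') k1' k2"
    by (rule near_trans[OF k(2,1,3) nearI_cut e'(2)]) (use c e' k in auto)
  then show ?thesis by simp
qed

lemma near_kmat:
  assumes "n > 0" "k \<in> kernels"
  shows "near e (kmat n X) k \<longleftrightarrow> near e (stepk n (symm X)) k"
proof -
  have s: "stepk n (symm X) \<in> kernels" by (rule stepk_kernels) (rule symm_sym)
  have ae: "AE p in usq. stepk n (symm X) p = kmat n X p"
    using kmat_stepk[OF assms(1), of X] by eventually_elim simp
  show ?thesis
    using near_cong_AE[OF kmat_kernels s assms(2) kmat_stepk[OF assms(1)]]
      near_cong_AE[OF s kmat_kernels assms(2) ae] by blast
qed

section \<open>The cut norm of a step kernel\<close>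

lemma avg_rect:
  assumes i: "i < n" "j < n" and A: "A \<in> sets borel" "A \<subseteq> {0..1}" and B: "B \<in> sets borel" "B \<subseteq> {0..1}"
  shows "avg n (indicator (A \<times> B)) i j =
    (real n * measure lborel (A \<inter> Ic n i)) * (real n * measure lborel (B \<inter> Ic n j))"
proof -
  have e: "A \<times> B \<inter> cellsq n i j = (A \<inter> Ic n i) \<times> (B \<inter> Ic n j)" by (auto simp: cellsq_def)
  have "(\<integral>p. indicator (A \<times> B) p * indicator (cellsq n i j) p \<partial>usq) = (\<integral>p. (indicator ((A \<inter> Ic n i) \<times> (B \<inter> Ic n j)) p :: real) \<partial>usq)"
    by (simp add: indicator_inter_arith[symmetric] e)
  also have "\<dots> = measure usq ((A \<inter> Ic n i) \<times> (B \<inter> Ic n j))" by simp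
  also have "\<dots> = measure lborel (A \<inter> Ic n i) * measure lborel (B \<inter> Ic n j)"
    unfolding measure_def by (subst emeasure_usq_Times) (use A B in \<open>auto simp: enn2real_mult\<close>)
  finally show ?thesis unfolding avg_def by (simp add: power2_eq_square)
qed

lemma Ic_density_bounds:
  assumes "i < n" "A \<in> sets borel"
  shows "0 \<le> real n * measure lborel (A \<inter> Ic n i)" "real n * measure lborel (A \<inter> Ic n i) \<le> 1"
proof -
  have e: "emeasure lborel (Ic n i) = ennreal (1 / real n)" using emeasure_Ic[OF assms(1)] .
  then have "measure lborel (Ic n i) = 1 / real n" by (simp add: measure_def)
  moreover have "measure lborel (A \<inter> Ic n i) \<le> measure lborel (Ic n i)"
    by (rule measure_mono_fmeasurable) (use e assms in \<open>auto simp: fmeasurable_def\<close>)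
  ultimately show "real n * measure lborel (A \<inter> Ic n i) \<le> 1"
    using assms mult_left_mono[of "measure lborel (A \<inter> Ic n i)" "1 / real n" "real n"] by simp
qed simp

lemma fractional_sum_le:
  fixes v :: "nat \<Rightarrow> real"
  assumes "\<And>i. i < n \<Longrightarrow> 0 \<le> \<alpha> i" "\<And>i. i < n \<Longrightarrow> \<alpha> i \<le> 1"
  shows "(\<Sum>i<n. \<alpha> i * v i) \<le> (\<Sum>i\<in>{i. i < n \<and> v i > 0}. v i)"
proof -
  have "(\<Sum>i<n. \<alpha> i * v i) \<le> (\<Sum>i<n. if v i > 0 then v i else 0)"
  proof (rule sum_mono)
    fix i assume "i \<in> {..<n}"
    then have a: "0 \<le> \<alpha> i" "\<alpha> i \<le> 1" using assms by auto
    show "\<alpha> i * v i \<le> (if v i > 0 then v i else 0)"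
      using mult_right_mono[OF a(2), of "v i"] mult_nonneg_nonpos[OF a(1), of "v i"] by auto
  qed
  also have "\<dots> = (\<Sum>i\<in>{i. i < n \<and> v i > 0}. v i)"
    by (rule sum.mono_neutral_cong_right) auto
  finally show ?thesis .
qed

text \<open>A bilinear form in weights from [0,1] is maximal at a vertex: for fixed \<beta> the best
  \<alpha> selects the rows with positive weighted sum, and then the best \<beta> selects columns in
  the same way.\<close>

lemma fractional_rect_le:
  fixes d :: "nat \<Rightarrow> nat \<Rightarrow> real"
  assumes a: "\<And>i. i < n \<Longrightarrow> 0 \<le> \<alpha> i" "\<And>i. i < n \<Longrightarrow> \<alpha> i \<le> 1"
    and b: "\<And>i. i < n \<Longrightarrow> 0 \<le> \<beta> i" "\<And>i. i < n \<Longrightarrow> \<beta> i \<le> 1"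
    and c: "\<And>S T. S \<subseteq> {..<n} \<Longrightarrow> T \<subseteq> {..<n} \<Longrightarrow> (\<Sum>i\<in>S. \<Sum>j\<in>T. d i j) \<le> c"
  shows "(\<Sum>i<n. \<Sum>j<n. d i j * (\<alpha> i * \<beta> j)) \<le> c"
proof -
  define v where "v i = (\<Sum>j<n. \<beta> j * d i j)" for i
  define S where "S = {i. i < n \<and> v i > 0}"
  define w where "w j = (\<Sum>i\<in>S. d i j)" for j
  define T where "T = {j. j < n \<and> w j > 0}"
  have "(\<Sum>i<n. \<Sum>j<n. d i j * (\<alpha> i * \<beta> j)) = (\<Sum>i<n. \<alpha> i * v i)"
    by (simp add: v_def sum_distrib_left mult_ac)
  also have "\<dots> \<le> (\<Sum>i\<in>S. v i)" unfolding S_def by (rule fractional_sum_le[OF a])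
  also have "\<dots> = (\<Sum>j<n. \<beta> j * w j)"
    unfolding v_def w_def by (subst sum.swap) (simp add: sum_distrib_left)
  also have "\<dots> \<le> (\<Sum>j\<in>T. w j)" unfolding T_def by (rule fractional_sum_le[OF b])
  also have "\<dots> = (\<Sum>i\<in>S. \<Sum>j\<in>T. d i j)" unfolding w_def by (rule sum.swap)
  also have "\<dots> \<le> c" by (rule c) (auto simp: S_def T_def)
  finally show ?thesis .
qed

text \<open>A Borel rectangle meets a step kernel only through the fractions of the cells covered by
  its sides. These are weights in [0,1], so rectangles made of whole cells already decide, and the
  cut norm becomes a finite condition on the matrix.\<close>

lemma cutn_stepk_le:
  assumes n: "n > 0"
    and c: "\<And>S T. S \<subseteq> {..<n} \<Longrightarrow> T \<subseteq> {..<n} \<Longrightarrow> \<bar>\<Sum>i\<in>S. \<Sum>j\<in>T. d i j\<bar> \<le> c * (real n)\<^sup>2"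
  shows "cutn (stepk n d) \<le> c"
proof (rule cutn_least)
  fix A B :: "real set" assume *: "A \<in> sets borel" "A \<subseteq> {0..1}" "B \<in> sets borel" "B \<subseteq> {0..1}"
  let ?a = "\<lambda>i. real n * measure lborel (A \<inter> Ic n i)" and ?b = "\<lambda>i. real n * measure lborel (B \<inter> Ic n i)"
  have "(\<integral>p. indicator (A \<times> B) p * stepk n d p \<partial>usq) = (\<integral>p. stepk n d p * indicator (A \<times> B) p \<partial>usq)"
    by (simp add: mult.commute)
  also have "\<dots> = (\<Sum>i<n. \<Sum>j<n. d i j * avg n (indicator (A \<times> B)) i j / (real n)\<^sup>2)"
    by (rule integral_stepk_mult[OF n]) (use integrable_indicator_usq[OF Times_borel] * in auto)
  also have "\<dots> = (\<Sum>i<n. \<Sum>j<n. d i j * (?a i * ?b j) / (real n)\<^sup>2)"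
    by (intro sum.cong refl) (use avg_rect * in auto)
  also have "\<dots> = (\<Sum>i<n. \<Sum>j<n. d i j * (?a i * ?b j)) / (real n)\<^sup>2"
    by (simp add: sum_divide_distrib)
  finally have e: "(\<integral>p. indicator (A \<times> B) p * stepk n d p \<partial>usq) = (\<Sum>i<n. \<Sum>j<n. d i j * (?a i * ?b j)) / (real n)\<^sup>2" .
  have 1: "(\<Sum>i<n. \<Sum>j<n. d i j * (?a i * ?b j)) \<le> c * (real n)\<^sup>2"
    by (rule fractional_rect_le) (use Ic_density_bounds * c in \<open>auto simp: abs_le_iff\<close>)
  have 2: "(\<Sum>i<n. \<Sum>j<n. (- d i j) * (?a i * ?b j)) \<le> c * (real n)\<^sup>2"
    by (rule fractional_rect_le) (use Ic_density_bounds * c in \<open>auto simp: abs_le_iff sum_negf\<close>)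
  have "\<bar>\<Sum>i<n. \<Sum>j<n. d i j * (?a i * ?b j)\<bar> \<le> c * (real n)\<^sup>2"
    using 1 2 by (simp add: sum_negf abs_le_iff)
  then show "\<bar>\<integral>p. indicator (A \<times> B) p * stepk n d p \<partial>usq\<bar> \<le> c"
    unfolding e using n by (simp add: divide_le_eq)
qed

lemma stepk_diff: "stepk n a p - stepk n b p = stepk n (\<lambda>i j. a i j - b i j) p"
  by (simp only: stepk_def sum_subtractf left_diff_distrib)

lemma integral_abs_stepk_diff:
  assumes "n > 0"
  shows "(\<integral>p. \<bar>stepk n a p - stepk n b p\<bar> \<partial>usq) = (\<Sum>i<n. \<Sum>j<n. \<bar>a i j - b i j\<bar>) / (real n)\<^sup>2"
  unfolding stepk_diff by (rule integral_stepk_comp[OF assms, where \<phi> = abs]) simp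

section \<open>Weak regularity\<close>

definition cls :: "nat \<Rightarrow> (nat \<Rightarrow> nat) \<Rightarrow> nat \<Rightarrow> nat set" where
  "cls n l a = {i. i < n \<and> l i = a}"

lemma finite_cls [simp]: "finite (cls n l a)" by (simp add: cls_def)

text \<open>Empty classes give \<open>0 / 0 = 0\<close>; no label is attained on them, so the value is irrelevant.\<close>

definition bl :: "nat \<Rightarrow> (nat \<Rightarrow> nat) \<Rightarrow> (nat \<Rightarrow> nat \<Rightarrow> real) \<Rightarrow> nat \<Rightarrow> nat \<Rightarrow> real" where
  "bl n l x a b = (\<Sum>i\<in>cls n l a. \<Sum>j\<in>cls n l b. x i j) / (real (card (cls n l a)) * real (card (cls n l b)))"

text \<open>The orthogonal projection of the matrix \<open>x\<close> onto the matrices that are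
  constant on the blocks of \<open>l\<close>.\<close>

definition bavg :: "nat \<Rightarrow> (nat \<Rightarrow> nat) \<Rightarrow> (nat \<Rightarrow> nat \<Rightarrow> real) \<Rightarrow> nat \<Rightarrow> nat \<Rightarrow> real" where
  "bavg n l x i j = bl n l x (l i) (l j)"

text \<open>Each i' occurs in the averages of exactly the members of its own class, with weight one
  over the class size. The dependence of \<open>h\<close> on the label lets coefficients that are
  constant on classes be carried along.\<close>

lemma sum_class_avg:
  fixes h :: "nat \<Rightarrow> nat \<Rightarrow> real"
  shows "(\<Sum>i<n. (\<Sum>i'\<in>cls n l (l i). h (l i) i') / real (card (cls n l (l i)))) = (\<Sum>i<n. h (l i) i)"
proof -
  let ?c = "\<lambda>a. real (card (cls n l a))"
  have "(\<Sum>i<n. (\<Sum>i'\<in>cls n l (l i). h (l i) i') / ?c (l i))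
      = (\<Sum>i<n. \<Sum>i'<n. if l i' = l i then h (l i') i' / ?c (l i') else 0)"
  proof (intro sum.cong refl)
    fix i assume "i \<in> {..<n}"
    have "(\<Sum>i'\<in>cls n l (l i). h (l i) i') / ?c (l i) = (\<Sum>i'\<in>cls n l (l i). h (l i') i' / ?c (l i'))"
      by (simp add: sum_divide_distrib cls_def)
    also have "\<dots> = (\<Sum>i'<n. if l i' = l i then h (l i') i' / ?c (l i') else 0)"
      by (rule sum.mono_neutral_cong_left) (auto simp: cls_def)
    finally show "(\<Sum>i'\<in>cls n l (l i). h (l i) i') / ?c (l i) =
      (\<Sum>i'<n. if l i' = l i then h (l i') i' / ?c (l i') else 0)" .
  qed
  also have "\<dots> = (\<Sum>i'<n. \<Sum>i<n. if l i' = l i then h (l i') i' / ?c (l i') else 0)" by (rule sum.swap)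
  also have "\<dots> = (\<Sum>i'<n. h (l i') i')"
  proof (intro sum.cong refl)
    fix i' assume i': "i' \<in> {..<n}"
    have "(\<Sum>i<n. if l i' = l i then h (l i') i' / ?c (l i') else 0) = (\<Sum>i\<in>cls n l (l i'). h (l i') i' / ?c (l i'))"
      by (rule sum.mono_neutral_cong_right) (auto simp: cls_def)
    moreover have "cls n l (l i') \<noteq> {}" using i' by (auto simp: cls_def)
    ultimately show "(\<Sum>i<n. if l i' = l i then h (l i') i' / ?c (l i') else 0) = h (l i') i'"
      by (simp add: card_eq_0_iff)
  qed
  finally show ?thesis .
qed

text \<open>The defining property of the projection; columns and then rows are averaged with
  \<open>sum_class_avg\<close>. Besides yielding the energy identities it later converts a tilt of
  block averages into a tilt of entries.\<close>

lemma bavg_orthogonal: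
  "(\<Sum>i<n. \<Sum>j<n. G (l i) (l j) * bavg n l x i j) = (\<Sum>i<n. \<Sum>j<n. G (l i) (l j) * x i j)"
proof -
  let ?c = "\<lambda>a. real (card (cls n l a))"
  have "(\<Sum>i<n. \<Sum>j<n. G (l i) (l j) * bavg n l x i j) =
     (\<Sum>i<n. \<Sum>j<n. (\<Sum>j'\<in>cls n l (l j). G (l i) (l j) * (\<Sum>i'\<in>cls n l (l i). x i' j') / ?c (l i)) / ?c (l j))"
  proof (intro sum.cong refl)
    fix i j
    have "(\<Sum>i'\<in>cls n l (l i). \<Sum>j'\<in>cls n l (l j). x i' j') = (\<Sum>j'\<in>cls n l (l j). \<Sum>i'\<in>cls n l (l i). x i' j')"
      by (rule sum.swap)
    then show "G (l i) (l j) * bavg n l x i j =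
      (\<Sum>j'\<in>cls n l (l j). G (l i) (l j) * (\<Sum>i'\<in>cls n l (l i). x i' j') / ?c (l i)) / ?c (l j)"
      by (simp add: bavg_def bl_def sum_distrib_left[symmetric] sum_divide_distrib[symmetric])
  qed
  also have "\<dots> = (\<Sum>i<n. \<Sum>j<n. G (l i) (l j) * (\<Sum>i'\<in>cls n l (l i). x i' j) / ?c (l i))"
    by (intro sum.cong refl sum_class_avg)
  also have "\<dots> = (\<Sum>j<n. \<Sum>i<n. (\<Sum>i'\<in>cls n l (l i). G (l i) (l j) * x i' j) / ?c (l i))"
    by (subst sum.swap) (simp add: sum_distrib_left)
  also have "\<dots> = (\<Sum>j<n. \<Sum>i<n. G (l i) (l j) * x i j)"
    by (intro sum.cong refl sum_class_avg[where h = "\<lambda>a i. G a (l _) * x i _"])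
  also have "\<dots> = (\<Sum>i<n. \<Sum>j<n. G (l i) (l j) * x i j)" by (rule sum.swap)
  finally show ?thesis .
qed

lemma bavg_energy_le: "(\<Sum>i<n. \<Sum>j<n. (bavg n l x i j)\<^sup>2) \<le> (\<Sum>i<n. \<Sum>j<n. (x i j)\<^sup>2)"
proof -
  have o: "(\<Sum>i<n. \<Sum>j<n. bavg n l x i j * x i j) = (\<Sum>i<n. \<Sum>j<n. (bavg n l x i j)\<^sup>2)"
    using bavg_orthogonal[where G = "bl n l x" and n = n and l = l and x = x] by (simp add: bavg_def power2_eq_square)
  have "0 \<le> (\<Sum>i<n. \<Sum>j<n. (x i j - bavg n l x i j)\<^sup>2)" by (intro sum_nonneg) auto
  also have "\<dots> = (\<Sum>i<n. \<Sum>j<n. (x i j)\<^sup>2) - 2 * (\<Sum>i<n. \<Sum>j<n. bavg n l x i j * x i j) + (\<Sum>i<n. \<Sum>j<n. (bavg n l x i j)\<^sup>2)"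
    by (simp add: power2_diff sum.distrib sum_subtractf sum_distrib_left mult_ac)
  finally show ?thesis using o by simp
qed

text \<open>Pythagoras: the coarse averages are constant on the finer blocks, hence orthogonal to
  the difference of the two projections.\<close>

lemma bavg_energy_refine:
  assumes "\<And>i. i < n \<Longrightarrow> l i = r (l' i)"
  shows "(\<Sum>i<n. \<Sum>j<n. (bavg n l' x i j)\<^sup>2) = (\<Sum>i<n. \<Sum>j<n. (bavg n l x i j)\<^sup>2)
      + (\<Sum>i<n. \<Sum>j<n. (bavg n l' x i j - bavg n l x i j)\<^sup>2)"
proof -
  have "(\<Sum>i<n. \<Sum>j<n. bavg n l x i j * bavg n l' x i j) = (\<Sum>i<n. \<Sum>j<n. bl n l x (r (l' i)) (r (l' j)) * bavg n l' x i j)"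
    by (intro sum.cong refl) (simp add: bavg_def assms)
  also have "\<dots> = (\<Sum>i<n. \<Sum>j<n. bl n l x (r (l' i)) (r (l' j)) * x i j)"
    by (rule bavg_orthogonal[where G = "\<lambda>a b. bl n l x (r a) (r b)"])
  also have "\<dots> = (\<Sum>i<n. \<Sum>j<n. bl n l x (l i) (l j) * x i j)"
    by (intro sum.cong refl) (simp add: assms)
  also have "\<dots> = (\<Sum>i<n. \<Sum>j<n. (bavg n l x i j)\<^sup>2)"
    using bavg_orthogonal[where G = "bl n l x" and n = n and l = l and x = x] by (simp add: bavg_def power2_eq_square)
  finally have o: "(\<Sum>i<n. \<Sum>j<n. bavg n l x i j * bavg n l' x i j) = (\<Sum>i<n. \<Sum>j<n. (bavg n l x i j)\<^sup>2)" .
  have "(\<Sum>i<n. \<Sum>j<n. (bavg n l' x i j - bavg n l x i j)\<^sup>2) =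
    (\<Sum>i<n. \<Sum>j<n. (bavg n l' x i j)\<^sup>2) - 2 * (\<Sum>i<n. \<Sum>j<n. bavg n l x i j * bavg n l' x i j) + (\<Sum>i<n. \<Sum>j<n. (bavg n l x i j)\<^sup>2)"
    by (simp add: power2_diff sum.distrib sum_subtractf sum_distrib_left mult_ac)
  then show ?thesis using o by simp
qed

definition cut_close :: "real \<Rightarrow> nat \<Rightarrow> (nat \<Rightarrow> nat \<Rightarrow> real) \<Rightarrow> (nat \<Rightarrow> nat \<Rightarrow> real) \<Rightarrow> bool" where
  "cut_close e n x y \<longleftrightarrow> (\<forall>S T. S \<subseteq> {..<n} \<longrightarrow> T \<subseteq> {..<n} \<longrightarrow> \<bar>\<Sum>i\<in>S. \<Sum>j\<in>T. x i j - y i j\<bar> \<le> e * (real n)\<^sup>2)"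

text \<open>If \<open>S \<times> T\<close> witnesses a large cut error, then splitting every class by membership in \<open>S\<close> and in \<open>T\<close> raises the energy: the rectangle is a union of new blocks, so by orthogonality and Cauchy-Schwarz its error is controlled by the energy difference.\<close>

lemma energy_increment:
  assumes "\<not> cut_close e n x (bavg n l x)" and l: "\<forall>i<n. l i < R" and e: "e > 0"
  obtains l' where "\<forall>i<n. l' i < 4 * R"
    "(\<Sum>i<n. \<Sum>j<n. (bavg n l' x i j)\<^sup>2) \<ge> (\<Sum>i<n. \<Sum>j<n. (bavg n l x i j)\<^sup>2) + e\<^sup>2 * (real n)\<^sup>2"
proof -
  obtain S T where ST: "S \<subseteq> {..<n}" "T \<subseteq> {..<n}"
    and big: "\<bar>\<Sum>i\<in>S. \<Sum>j\<in>T. x i j - bavg n l x i j\<bar> > e * (real n)\<^sup>2"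
    using assms(1) unfolding cut_close_def not_all not_imp not_le by blast
  have n: "n > 0"
  proof (rule ccontr)
    assume "\<not> n > 0" then have "S = {}" using ST by auto
    then show False using big \<open>\<not> n > 0\<close> by simp
  qed
  \<comment> \<open>The two low bits of the new label record membership in \<open>S\<close> and
    \<open>T\<close>; the old label is recovered by division by 4, and \<open>s\<close> and
    \<open>t\<close> below read the bits.\<close>
  define l' where "l' i = 4 * l i + (2 * (if i \<in> S then 1 else 0) + (if i \<in> T then 1 else 0))" for i
  have ref: "l i = l' i div 4" for i by (simp add: l'_def)
  define s :: "nat \<Rightarrow> real" where "s a = (if a mod 4 \<ge> 2 then 1 else 0)" for a
  define t :: "nat \<Rightarrow> real" where "t a = (if odd a then 1 else 0)" for a
  have s: "s (l' i) = (if i \<in> S then 1 else 0)" for i by (simp add: s_def l'_def)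
  have t: "t (l' i) = (if i \<in> T then 1 else 0)" for i by (simp add: t_def l'_def)
  have rect: "(\<Sum>i\<in>S. \<Sum>j\<in>T. y i j) = (\<Sum>i<n. \<Sum>j<n. (s (l' i) * t (l' j)) * y i j)" for y :: "nat \<Rightarrow> nat \<Rightarrow> real"
  proof -
    have "(\<Sum>i<n. \<Sum>j<n. (s (l' i) * t (l' j)) * y i j) = (\<Sum>i\<in>S. \<Sum>j<n. (s (l' i) * t (l' j)) * y i j)"
      by (rule sum.mono_neutral_right) (use ST in \<open>auto simp: s\<close>)
    also have "\<dots> = (\<Sum>i\<in>S. \<Sum>j\<in>T. (s (l' i) * t (l' j)) * y i j)"
      by (intro sum.cong refl sum.mono_neutral_right) (use ST in \<open>auto simp: t\<close>)
    also have "\<dots> = (\<Sum>i\<in>S. \<Sum>j\<in>T. y i j)" by (intro sum.cong refl) (simp add: s t)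
    finally show ?thesis by simp
  qed
  let ?d = "\<lambda>i j. bavg n l' x i j - bavg n l x i j"
  have "(\<Sum>i\<in>S. \<Sum>j\<in>T. x i j) = (\<Sum>i\<in>S. \<Sum>j\<in>T. bavg n l' x i j)"
    unfolding rect by (rule bavg_orthogonal[symmetric, where G = "\<lambda>a b. s a * t b"])
  then have "(\<Sum>i\<in>S. \<Sum>j\<in>T. x i j - bavg n l x i j) = (\<Sum>i\<in>S. \<Sum>j\<in>T. ?d i j)"
    by (simp add: sum_subtractf)
  also have "\<dots> = (\<Sum>p\<in>S \<times> T. ?d (fst p) (snd p))" by (simp add: sum.cartesian_product split_def)
  finally have eq: "(\<Sum>i\<in>S. \<Sum>j\<in>T. x i j - bavg n l x i j) = (\<Sum>p\<in>S \<times> T. ?d (fst p) (snd p))" .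
  have sub: "S \<times> T \<subseteq> {..<n} \<times> {..<n}" using ST by auto
  have cardST: "card (S \<times> T) \<le> n * n" using card_mono[OF _ sub] by simp
  have "(e * (real n)\<^sup>2)\<^sup>2 \<le> \<bar>\<Sum>p\<in>S \<times> T. ?d (fst p) (snd p)\<bar>\<^sup>2"
    by (rule power_mono) (use big e eq in auto)
  also have "\<dots> \<le> (\<Sum>p\<in>S \<times> T. (?d (fst p) (snd p))\<^sup>2) * real (card (S \<times> T))"
    unfolding power2_abs by (rule sum_squared_le_sum_of_squares)
  also have "\<dots> \<le> (\<Sum>p\<in>{..<n} \<times> {..<n}. (?d (fst p) (snd p))\<^sup>2) * (real n)\<^sup>2"
  proof (rule mult_mono)
    show "(\<Sum>p\<in>S \<times> T. (?d (fst p) (snd p))\<^sup>2) \<le> (\<Sum>p\<in>{..<n} \<times> {..<n}. (?d (fst p) (snd p))\<^sup>2)"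
      by (rule sum_mono2) (use sub in auto)
    show "real (card (S \<times> T)) \<le> (real n)\<^sup>2"
      using cardST by (metis of_nat_le_iff of_nat_power power2_eq_square)
  qed (auto intro: sum_nonneg)
  also have "(\<Sum>p\<in>{..<n} \<times> {..<n}. (?d (fst p) (snd p))\<^sup>2) = (\<Sum>i<n. \<Sum>j<n. (?d i j)\<^sup>2)"
    by (simp add: sum.cartesian_product split_def)
  finally have "(e\<^sup>2 * (real n)\<^sup>2) * (real n)\<^sup>2 \<le> (\<Sum>i<n. \<Sum>j<n. (?d i j)\<^sup>2) * (real n)\<^sup>2"
    by (simp add: power_mult_distrib mult.assoc power2_eq_square[of "(real n)\<^sup>2"])
  then have "e\<^sup>2 * (real n)\<^sup>2 \<le> (\<Sum>i<n. \<Sum>j<n. (?d i j)\<^sup>2)"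
    using n by (simp add: mult_le_cancel_right)
  moreover have "\<forall>i<n. l' i < 4 * R"
  proof (intro allI impI)
    fix i assume "i < n" then have "l i + 1 \<le> R" using l by (simp add: Suc_leI)
    then show "l' i < 4 * R" by (auto simp: l'_def)
  qed
  ultimately show thesis
    using that[of l'] bavg_energy_refine[of n l "\<lambda>a. a div 4" l' x] ref by simp
qed

text \<open>The energy starts nonnegative, grows by at least \<open>e^2 n^2\<close> in each
  unsuccessful step and never exceeds that of \<open>x\<close>, so \<open>N\<close> failures in a
  row are impossible. Each step multiplies the number of labels by 4; the bound \<open>4 ^ N\<close>
  depends on \<open>M\<close> and \<open>e\<close> but not on n.\<close>

lemma weak_regularity:
  assumes x: "(\<Sum>i<n. \<Sum>j<n. (x i j)\<^sup>2) \<le> M * (real n)\<^sup>2" and e: "e > 0" and N: "M < real N * e\<^sup>2" and n: "n > 0"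
  obtains l where "\<forall>i<n. l i < 4 ^ N" "cut_close e n x (bavg n l x)"
proof -
  have "\<exists>l. (\<forall>i<n. l i < 4 ^ k) \<and> (cut_close e n x (bavg n l x) \<or>
      (\<Sum>i<n. \<Sum>j<n. (bavg n l x i j)\<^sup>2) \<ge> real k * e\<^sup>2 * (real n)\<^sup>2)" for k
  proof (induction k)
    case 0
    have "(\<Sum>i<n. \<Sum>j<n. (bavg n (\<lambda>_. 0) x i j)\<^sup>2) \<ge> 0" by (intro sum_nonneg) auto
    then show ?case by (intro exI[of _ "\<lambda>_. 0"]) auto
  next
    case (Suc k)
    then obtain l where l: "\<forall>i<n. l i < 4 ^ k"
      "cut_close e n x (bavg n l x) \<or> (\<Sum>i<n. \<Sum>j<n. (bavg n l x i j)\<^sup>2) \<ge> real k * e\<^sup>2 * (real n)\<^sup>2" by blast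
    show ?case
    proof (cases "cut_close e n x (bavg n l x)")
      case True
      moreover have "\<forall>i<n. l i < 4 ^ Suc k" using l(1) by (auto intro: less_le_trans)
      ultimately show ?thesis by blast
    next
      case False
      obtain l' where l': "\<forall>i<n. l' i < 4 * 4 ^ k"
        "(\<Sum>i<n. \<Sum>j<n. (bavg n l' x i j)\<^sup>2) \<ge> (\<Sum>i<n. \<Sum>j<n. (bavg n l x i j)\<^sup>2) + e\<^sup>2 * (real n)\<^sup>2"
        by (rule energy_increment[OF False l(1) e])
      then show ?thesis using l(2) False by (intro exI[of _ l']) (auto simp: algebra_simps)
    qed
  qed
  from this[of N] obtain l where l: "\<forall>i<n. l i < 4 ^ N"
    "cut_close e n x (bavg n l x) \<or> (\<Sum>i<n. \<Sum>j<n. (bavg n l x i j)\<^sup>2) \<ge> real N * e\<^sup>2 * (real n)\<^sup>2" by blast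
  have "\<not> (\<Sum>i<n. \<Sum>j<n. (bavg n l x i j)\<^sup>2) \<ge> real N * e\<^sup>2 * (real n)\<^sup>2"
  proof
    assume "(\<Sum>i<n. \<Sum>j<n. (bavg n l x i j)\<^sup>2) \<ge> real N * e\<^sup>2 * (real n)\<^sup>2"
    then have "real N * e\<^sup>2 * (real n)\<^sup>2 \<le> M * (real n)\<^sup>2" using bavg_energy_le[of n l x] x by linarith
    then show False using N n by simp
  qed
  then show thesis using l that by blast
qed

lemma cut_close_imp_cutn:
  assumes "n > 0" "cut_close e n x y"
  shows "cutn (\<lambda>p. stepk n x p - stepk n y p) \<le> e"
  unfolding stepk_diff by (rule cutn_stepk_le) (use assms in \<open>auto simp: cut_close_def\<close>)

lemma bavg_sym:
  assumes "\<And>i j. i < n \<Longrightarrow> j < n \<Longrightarrow> x i j = x j i"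
  shows "bl n l x a b = bl n l x b a"
proof -
  have "(\<Sum>i\<in>cls n l a. \<Sum>j\<in>cls n l b. x i j) = (\<Sum>i\<in>cls n l a. \<Sum>j\<in>cls n l b. x j i)"
    by (intro sum.cong refl) (use assms in \<open>auto simp: cls_def\<close>)
  also have "\<dots> = (\<Sum>j\<in>cls n l b. \<Sum>i\<in>cls n l a. x j i)" by (rule sum.swap)
  finally show ?thesis by (simp add: bl_def mult.commute)
qed

section \<open>Matching two labellings by a permutation\<close>

lemma extend_to_permutation:
  assumes X: "finite X" "B \<subseteq> X" "f ` B \<subseteq> X" and f: "inj_on f B"
  obtains \<pi> where "\<pi> permutes X" "\<And>b. b \<in> B \<Longrightarrow> \<pi> b = f b"
proof -
  have "card (f ` B) = card B" using f by (rule card_image)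
  then have "card (X - B) = card (X - f ` B)"
    using X by (simp add: card_Diff_subset finite_subset)
  then obtain g where g: "bij_betw g (X - B) (X - f ` B)"
    using finite_same_card_bij[of "X - B" "X - f ` B"] X by auto
  define \<pi> where "\<pi> y = (if y \<in> B then f y else if y \<in> X then g y else y)" for y
  have "bij_betw \<pi> B (f ` B)" using f by (simp add: bij_betw_def \<pi>_def inj_on_def image_def)
  moreover have "bij_betw \<pi> (X - B) (X - f ` B)"
    using g by (subst bij_betw_cong[of "X - B" \<pi> g]) (auto simp: \<pi>_def)
  ultimately have "bij_betw \<pi> (B \<union> (X - B)) (f ` B \<union> (X - f ` B))"
    by (rule bij_betw_combine) auto
  then have "bij_betw \<pi> X X" using X by (simp add: Un_absorb1)
  then have "\<pi> permutes X"
    by (rule bij_imp_permutes) (use X in \<open>auto simp: \<pi>_def\<close>)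
  then show thesis by (rule that) (simp add: \<pi>_def)
qed

text \<open>In every class as many indices are matched as both labellings have, and the partial
  injection is completed to a permutation. Only unmatched indices can disagree, and their number in
  a class is at most the difference of the class sizes.\<close>

lemma match_labels:
  assumes L: "\<And>i. i < N \<Longrightarrow> L i < R" and L': "\<And>i. i < N \<Longrightarrow> L' i < R"
  obtains \<pi> where "\<pi> permutes {..<N}"
    "real (card {i. i < N \<and> L (\<pi> i) \<noteq> L' i}) \<le> (\<Sum>a<R. \<bar>real (card (cls N L a)) - real (card (cls N L' a))\<bar>)"
proof -
  let ?m = "\<lambda>a. min (card (cls N L a)) (card (cls N L' a))"
  have "\<exists>A B f. A \<subseteq> cls N L a \<and> B \<subseteq> cls N L' a \<and> card B = ?m a \<and> bij_betw f B A" for a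
  proof -
    obtain A where A: "A \<subseteq> cls N L a" "card A = ?m a" "finite A"
      using obtain_subset_with_card_n[of "?m a" "cls N L a"] by auto
    obtain B where B: "B \<subseteq> cls N L' a" "card B = ?m a" "finite B"
      using obtain_subset_with_card_n[of "?m a" "cls N L' a"] by auto
    obtain f where "bij_betw f B A" using finite_same_card_bij[OF B(3) A(3)] A B by auto
    then show ?thesis using A B by blast
  qed
  then obtain A B F where AB: "\<And>a. A a \<subseteq> cls N L a" "\<And>a. B a \<subseteq> cls N L' a" "\<And>a. card (B a) = ?m a"
    "\<And>a. bij_betw (F a) (B a) (A a)" by metis
  define BB where "BB = (\<Union>a<R. B a)"
  define f where "f i = F (L' i) i" for i
  have fB: "L' i < R \<and> i \<in> B (L' i) \<and> f i \<in> A (L' i) \<and> L (f i) = L' i \<and> f i < N \<and> i < N" if "i \<in> BB" for i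
  proof -
    obtain a where a: "a < R" "i \<in> B a" using \<open>i \<in> BB\<close> by (auto simp: BB_def)
    then have la: "L' i = a" "i < N" using AB(2)[of a] by (auto simp: cls_def)
    have "F a i \<in> A a" using AB(4)[of a] a by (auto simp: bij_betw_def)
    then show ?thesis using AB(1)[of a] a la by (auto simp: f_def cls_def)
  qed
  have inj: "inj_on f BB"
  proof (rule inj_onI)
    fix i j assume ij: "i \<in> BB" "j \<in> BB" "f i = f j"
    then have eq: "L' i = L' j" using fB[of i] fB[of j] by metis
    have "inj_on (F (L' i)) (B (L' i))" using AB(4) by (simp add: bij_betw_def)
    moreover have "i \<in> B (L' i)" "j \<in> B (L' i)" using fB[OF ij(1)] fB[OF ij(2)] eq by auto
    moreover have "F (L' i) i = F (L' i) j" using ij(3) eq by (simp add: f_def)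
    ultimately show "i = j" by (meson inj_onD)
  qed
  obtain \<pi> where p: "\<pi> permutes {..<N}" "\<And>b. b \<in> BB \<Longrightarrow> \<pi> b = f b"
    by (rule extend_to_permutation[OF _ _ _ inj, of "{..<N}"]) (use fB in auto)
  have cardBB: "card BB = (\<Sum>a<R. ?m a)"
  proof -
    have "card BB = (\<Sum>a<R. card (B a))" unfolding BB_def
      by (rule card_UN_disjoint) (use AB(2) in \<open>auto simp: cls_def intro: finite_subset[OF AB(2)], (fastforce simp: cls_def)?\<close>)
    then show ?thesis by (simp add: AB(3))
  qed
  have cardN: "N = (\<Sum>a<R. card (cls N L' a))"
  proof -
    have "{..<N} = (\<Union>a<R. cls N L' a)" using L' by (auto simp: cls_def)
    then have "card {..<N} = card (\<Union>a<R. cls N L' a)" by (rule arg_cong)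
    also have "card (\<Union>a<R. cls N L' a) = (\<Sum>a<R. card (cls N L' a))"
      by (rule card_UN_disjoint) (auto simp: cls_def)
    finally show ?thesis by simp
  qed
  have "{i. i < N \<and> L (\<pi> i) \<noteq> L' i} \<subseteq> {..<N} - BB" using fB p(2) by auto
  then have "card {i. i < N \<and> L (\<pi> i) \<noteq> L' i} \<le> card ({..<N} - BB)" by (intro card_mono) auto
  also have "BB \<subseteq> {..<N}" using fB by blast
  then have "card ({..<N} - BB) = N - card BB" by (simp add: card_Diff_subset finite_subset)
  finally have "real (card {i. i < N \<and> L (\<pi> i) \<noteq> L' i}) \<le> real (N - card BB)" by simp
  also have "\<dots> = real N - real (card BB)"
    using \<open>BB \<subseteq> {..<N}\<close> card_mono[of "{..<N}" BB] by (simp add: of_nat_diff)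
  also have "real N = (\<Sum>a<R. real (card (cls N L' a)))" using cardN by (metis of_nat_sum)
  also have "\<dots> - real (card BB) = (\<Sum>a<R. real (card (cls N L' a)) - real (?m a))"
    unfolding cardBB by (simp add: sum_subtractf)
  also have "\<dots> \<le> (\<Sum>a<R. \<bar>real (card (cls N L a)) - real (card (cls N L' a))\<bar>)"
    by (rule sum_mono) (auto simp: min_def)
  finally show thesis using that p by blast
qed

lemma card_cls_refine:
  assumes "m > 0"
  shows "card (cls (n * m) (\<lambda>i. l (i div m)) a) = m * card (cls n l a)"
proof -
  have "bij_betw (\<lambda>(i, r). i * m + r) (cls n l a \<times> {..<m}) (cls (n * m) (\<lambda>i. l (i div m)) a)"
  proof (rule bij_betw_byWitness[where f' = "\<lambda>k. (k div m, k mod m)"])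
    show "(\<lambda>(i, r). i * m + r) ` (cls n l a \<times> {..<m}) \<subseteq> cls (n * m) (\<lambda>i. l (i div m)) a"
    proof (clarsimp simp: cls_def)
      fix i r assume "i < n" "r < m"
      then have "i * m + r < i * m + m" by simp
      also have "\<dots> = (i + 1) * m" by simp
      also have "\<dots> \<le> n * m" using \<open>i < n\<close> by (intro mult_right_mono) auto
      finally show "i * m + r < n * m" .
    qed
  qed (use assms in \<open>auto simp: cls_def less_mult_imp_div_less\<close>)
  then have "card (cls (n * m) (\<lambda>i. l (i div m)) a) = card (cls n l a \<times> {..<m})"
    by (rule bij_betw_same_card[symmetric])
  then show ?thesis by (simp add: mult.commute)
qed

text \<open>Both kernels are moved to the common grid of size \<open>n * n'\<close>, where some permutation of the cells matches all but a small fraction of the labels.\<close>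

lemma near_step_labels:
  assumes n: "n > 0" "n' > 0" and l: "\<forall>i<n. l i < R" and l': "\<forall>i<n'. l' i < R"
    and u: "\<And>a b. \<bar>u a b\<bar> \<le> T" "\<And>a b. u a b = u b a"
    and p: "\<And>a. a < R \<Longrightarrow> \<bar>real (card (cls n l a)) / real n - real (card (cls n' l' a)) / real n'\<bar> \<le> d"
    and e: "4 * T * real R * d < e"
  shows "near e (stepk n (\<lambda>i j. u (l i) (l j))) (stepk n' (\<lambda>i j. u (l' i) (l' j)))"
proof -
  define N where "N = n * n'"
  have N: "N > 0" using n by (simp add: N_def)
  have T: "T \<ge> 0" using u(1)[of 0 0] by linarith
  define L where "L i = l (i div n')" for i
  define L' where "L' i = l' (i div n)" for i
  have L: "L i < R" if "i < N" for i using l that by (auto simp: L_def N_def less_mult_imp_div_less)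
  have L': "L' i < R" if "i < N" for i using l' that by (auto simp: L'_def N_def mult.commute less_mult_imp_div_less)
  have c: "card (cls N L a) = n' * card (cls n l a)" for a
    unfolding N_def L_def by (rule card_cls_refine[OF n(2)])
  have c': "card (cls N L' a) = n * card (cls n' l' a)" for a
    unfolding N_def L'_def by (subst mult.commute) (rule card_cls_refine[OF n(1)])
  obtain \<pi> where pi: "\<pi> permutes {..<N}"
    "real (card {i. i < N \<and> L (\<pi> i) \<noteq> L' i}) \<le> (\<Sum>a<R. \<bar>real (card (cls N L a)) - real (card (cls N L' a))\<bar>)"
    by (rule match_labels[OF L L'])
  let ?bad = "{i. i < N \<and> L (\<pi> i) \<noteq> L' i}"
  have "(\<Sum>a<R. \<bar>real (card (cls N L a)) - real (card (cls N L' a))\<bar>) \<le> (\<Sum>a<R. real N * d)"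
  proof (rule sum_mono)
    fix a assume a: "a \<in> {..<R}"
    have "real (card (cls N L a)) - real (card (cls N L' a)) =
        real N * (real (card (cls n l a)) / real n - real (card (cls n' l' a)) / real n')"
      unfolding c c' using n by (simp add: N_def field_simps)
    then show "\<bar>real (card (cls N L a)) - real (card (cls N L' a))\<bar> \<le> real N * d"
      using p[of a] a by (simp add: abs_mult mult_left_mono)
  qed
  then have bad: "real (card ?bad) \<le> real R * (real N * d)" using pi(2) by simp
  define s where "s = stepk N (\<lambda>i j. u (L i) (L j))"
  define s' where "s' = stepk N (\<lambda>i j. u (L' i) (L' j))"
  define s0 where "s0 = stepk n (\<lambda>i j. u (l i) (l j))"
  define s0' where "s0' = stepk n' (\<lambda>i j. u (l' i) (l' j))"
  have ker: "s \<in> kernels" "s' \<in> kernels" "s0 \<in> kernels" "s0' \<in> kernels"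
    unfolding s_def s'_def s0_def s0'_def by (rule stepk_kernels, rule u(2))+
  have ae: "AE q in usq. s0 q = s q"
    unfolding s0_def s_def L_def N_def by (rule stepk_refine[OF n])
  have ae': "AE q in usq. s0' q = s' q"
    unfolding s0'_def s'_def L'_def N_def using stepk_refine[OF n(2,1)] by (simp add: mult.commute)
  have mp: "mp_bij (permmap N \<pi>)" by (rule permmap_mp_bij[OF N pi(1)])
  have "cut_dist (act (permmap N \<pi>) s) s' = cutn (\<lambda>q. act (permmap N \<pi>) s q - s' q)"
    by (rule cut_dist_kernels) (use ker act_kernels[OF mp] in auto)
  also have "\<dots> = cutn (\<lambda>q. stepk N (\<lambda>i j. u (L (\<pi> i)) (L (\<pi> j))) q - s' q)"
  proof (rule cutn_cong_AE)
    show "AE q in usq. act (permmap N \<pi>) s q - s' q = stepk N (\<lambda>i j. u (L (\<pi> i)) (L (\<pi> j))) q - s' q"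
      using act_permmap_stepk[OF N pi(1), of "\<lambda>i j. u (L i) (L j)"] unfolding s_def[symmetric]
      by eventually_elim simp
  qed (use ker act_kernels[OF mp] kernels_measurable in auto)
  also have "\<dots> \<le> (\<integral>q. \<bar>stepk N (\<lambda>i j. u (L (\<pi> i)) (L (\<pi> j))) q - s' q\<bar> \<partial>usq)"
    by (rule cutn_le_L1) (simp add: s'_def)
  also have "\<dots> = (\<Sum>i<N. \<Sum>j<N. \<bar>u (L (\<pi> i)) (L (\<pi> j)) - u (L' i) (L' j)\<bar>) / (real N)\<^sup>2"
    unfolding s'_def by (rule integral_abs_stepk_diff[OF N])
  \<comment> \<open>An entry differs only if its row or its column is bad, and then by at most
    \<open>2 * T\<close>; rows and columns together give the factor 4.\<close>
  also have "(\<Sum>i<N. \<Sum>j<N. \<bar>u (L (\<pi> i)) (L (\<pi> j)) - u (L' i) (L' j)\<bar>) \<le>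
     (\<Sum>i<N. \<Sum>j<N. (if i \<in> ?bad then 2 * T else 0) + (if j \<in> ?bad then 2 * T else 0))"
  proof (intro sum_mono)
    fix i j assume ij: "i \<in> {..<N}" "j \<in> {..<N}"
    have "\<bar>u (L (\<pi> i)) (L (\<pi> j)) - u (L' i) (L' j)\<bar> \<le> 2 * T"
      using u(1)[of "L (\<pi> i)" "L (\<pi> j)"] u(1)[of "L' i" "L' j"] by linarith
    then show "\<bar>u (L (\<pi> i)) (L (\<pi> j)) - u (L' i) (L' j)\<bar> \<le> (if i \<in> ?bad then 2 * T else 0) + (if j \<in> ?bad then 2 * T else 0)"
      using ij T by auto
  qed
  also have "(\<Sum>i<N. \<Sum>j<N. (if i \<in> ?bad then 2 * T else 0) + (if j \<in> ?bad then 2 * T else 0)) = 4 * T * real N * real (card ?bad)"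
  proof -
    have b: "(\<Sum>i<N. if i \<in> ?bad then 2 * T else 0) = 2 * T * real (card ?bad)"
    proof -
      have "(\<Sum>i<N. if i \<in> ?bad then 2 * T else 0) = (\<Sum>i\<in>?bad. 2 * T)"
        by (rule sum.mono_neutral_cong_right) auto
      then show ?thesis by simp
    qed
    show ?thesis unfolding sum.distrib b by (simp only: sum_constant card_lessThan sum_distrib_left[symmetric] b) simp
  qed
  finally have "cut_dist (act (permmap N \<pi>) s) s' \<le> 4 * T * real N * real (card ?bad) / (real N)\<^sup>2"
    by (simp add: divide_right_mono)
  also have "\<dots> \<le> 4 * T * real N * (real R * (real N * d)) / (real N)\<^sup>2"
    by (intro divide_right_mono mult_left_mono bad) (use T in auto)
  also have "\<dots> = 4 * T * real R * d" using N by (simp add: power2_eq_square)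
  finally have "near e s s'" unfolding near_def using mp e by (intro exI[of _ "permmap N \<pi>"]) auto
  then have "near e s0 s'" by (rule near_cong_AE[OF ker(1,3,2), rotated]) (use ae in eventually_elim, simp)
  then have "near e s' s0" by (rule near_sym[OF ker(3,2)])
  then have "near e s0' s0" by (rule near_cong_AE[OF ker(2,4,3), rotated]) (use ae' in eventually_elim, simp)
  then have "near e s0 s0'" by (rule near_sym[OF ker(4,3)])
  then show ?thesis by (simp only: s0_def s0'_def)
qed

section \<open>Compactness of the level sets\<close>

definition energy_ok :: "real \<Rightarrow> nat \<Rightarrow> (nat \<Rightarrow> nat \<Rightarrow> real) \<Rightarrow> bool" where
  "energy_ok M n a \<longleftrightarrow> n > 0 \<and> (\<forall>i<n. \<forall>j<n. a i j = a j i) \<and> (\<Sum>i<n. \<Sum>j<n. (a i j)\<^sup>2) \<le> M * (real n)\<^sup>2"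

lemma stepk_cong:
  assumes "\<And>i j. i < n \<Longrightarrow> j < n \<Longrightarrow> a i j = b i j"
  shows "stepk n a = stepk n b"
  unfolding stepk_def by (intro ext sum.cong refl) (use assms in auto)

lemma energy_ok_kernels: "energy_ok M n a \<Longrightarrow> stepk n a \<in> kernels"
  unfolding energy_ok_def by (intro stepk_kernels) auto

definition truncate_to :: "real \<Rightarrow> real \<Rightarrow> real" where
  "truncate_to T v = max (- T) (min T v)"

lemma truncate_to_error:
  assumes "T > 0"
  shows "\<bar>v - truncate_to T v\<bar> \<le> v\<^sup>2 / T"
proof (cases "\<bar>v\<bar> \<le> T")
  case True then show ?thesis using assms by (auto simp: truncate_to_def)
next
  case False
  have "\<bar>v\<bar> * T \<le> \<bar>v\<bar> * \<bar>v\<bar>" using False by (intro mult_left_mono) auto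
  then have "\<bar>v\<bar> \<le> v\<^sup>2 / T" using assms by (simp add: pos_le_divide_eq power2_eq_square)
  moreover have "\<bar>v - truncate_to T v\<bar> \<le> \<bar>v\<bar>" using False assms by (auto simp: truncate_to_def)
  ultimately show ?thesis by linarith
qed

lemma truncate_to_bound: "T > 0 \<Longrightarrow> - T \<le> truncate_to T v \<and> truncate_to T v \<le> T"
  by (auto simp: truncate_to_def)

lemma floor_grid:
  fixes e :: real
  assumes "e > 0"
  shows "\<bar>v - e * of_int \<lfloor>v / e\<rfloor>\<bar> \<le> e"
proof -
  obtain f :: int where f: "f = \<lfloor>v / e\<rfloor>" by blast
  have "of_int f \<le> v / e" "v / e < of_int f + 1" unfolding f by linarith+
  then have "e * of_int f \<le> v" "v < e * of_int f + e"
    using assms by (simp_all add: field_simps)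
  then show ?thesis unfolding f by linarith
qed

text \<open>The type of a matrix records its block averages (truncated and rounded) and the class frequencies (rounded) of a regular labelling.\<close>

lemma energy_types:
  assumes M: "M \<ge> 0" and e: "e > 0"
  shows "\<exists>F (\<tau> :: nat \<times> (nat \<Rightarrow> nat \<Rightarrow> real) \<Rightarrow> (nat \<times> nat \<Rightarrow> int) \<times> (nat \<Rightarrow> int)).
    finite F \<and> (\<forall>n a. energy_ok M n a \<longrightarrow> \<tau> (n, a) \<in> F) \<and>
    (\<forall>n a n' a'. energy_ok M n a \<longrightarrow> energy_ok M n' a' \<longrightarrow> \<tau> (n, a) = \<tau> (n', a') \<longrightarrow>
       near e (stepk n a) (stepk n' a'))"
proof -
  \<comment> \<open>Budget: each matrix is within \<open>7/2 * \<epsilon>\<close> of its rounded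
    block kernel, and the two block kernels are within \<epsilon> of each other, in all
    \<open>8 * \<epsilon>\<close>.\<close>
  define \<epsilon> where "\<epsilon> = e / 8"
  have eps: "\<epsilon> > 0" using e by (simp add: \<epsilon>_def)
  obtain N :: nat where "M / \<epsilon>\<^sup>2 < real N" using reals_Archimedean2 by blast
  then have N: "M < real N * \<epsilon>\<^sup>2" using eps by (simp add: pos_divide_less_eq)
  define R :: nat where "R = 4 ^ N"
  have R: "R > 0" by (simp add: R_def)
  \<comment> \<open>Truncation at \<open>T\<close> costs in mean at most the energy over
    \<open>T\<close>, hence at most \<epsilon>. Likewise \<open>d\<close> below makes the bound of
    \<open>near_step_labels\<close> equal to \<open>\<epsilon> / 2\<close> for frequencies within
    \<open>2 * d\<close>.\<close>
  define T where "T = M / \<epsilon> + 1"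
  have T: "T > 0" using M eps by (simp add: T_def add_nonneg_pos)
  have MT: "M / T \<le> \<epsilon>" using M eps T by (simp add: T_def pos_divide_le_eq field_simps)
  define d where "d = \<epsilon> / (16 * (T + \<epsilon>) * real R)"
  have d: "d > 0" using eps T R by (simp add: d_def)
  have "\<exists>l. energy_ok M n a \<longrightarrow> (\<forall>i<n. l i < R) \<and> cut_close \<epsilon> n a (bavg n l a)" for n a
  proof (cases "energy_ok M n a")
    case True
    then have en: "(\<Sum>i<n. \<Sum>j<n. (a i j)\<^sup>2) \<le> M * (real n)\<^sup>2" and n: "n > 0"
      by (auto simp: energy_ok_def)
    obtain l where "\<forall>i<n. l i < 4 ^ N" "cut_close \<epsilon> n a (bavg n l a)"
      by (rule weak_regularity[OF en eps N n])
    then show ?thesis unfolding R_def by blast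
  qed simp
  then obtain l where l: "\<And>n a. energy_ok M n a \<Longrightarrow> (\<forall>i<n. l n a i < R) \<and> cut_close \<epsilon> n a (bavg n (l n a) a)"
    by metis
  define ui where "ui n a x y = \<lfloor>truncate_to T (bl n (l n a) a x y) / \<epsilon>\<rfloor>" for n a x y
  define pf where "pf n a x = \<lfloor>real (card (cls n (l n a) x)) / real n / d\<rfloor>" for n a x
  define \<tau> where "\<tau> na = (restrict (\<lambda>(x, y). ui (fst na) (snd na) x y) ({..<R} \<times> {..<R}),
     restrict (pf (fst na) (snd na)) {..<R})" for na
  define F where "F = (({..<R} \<times> {..<R}) \<rightarrow>\<^sub>E {\<lfloor>- T / \<epsilon>\<rfloor>..\<lfloor>T / \<epsilon>\<rfloor>}) \<times> ({..<R} \<rightarrow>\<^sub>E {0..\<lfloor>1 / d\<rfloor>})"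
  show ?thesis
  proof (intro exI[of _ F] exI[of _ \<tau>] conjI allI impI)
    show "finite F" unfolding F_def by (intro finite_cartesian_product finite_PiE) auto
  next
    fix n a assume ok: "energy_ok M n a"
    have n: "n > 0" using ok by (simp add: energy_ok_def)
    have u: "ui n a x y \<in> {\<lfloor>- T / \<epsilon>\<rfloor>..\<lfloor>T / \<epsilon>\<rfloor>}" for x y
    proof -
      have b: "- T \<le> truncate_to T (bl n (l n a) a x y)" "truncate_to T (bl n (l n a) a x y) \<le> T"
        using truncate_to_bound[OF T] by auto
      show ?thesis
        using floor_mono[OF divide_right_mono[OF b(1), of \<epsilon>]] floor_mono[OF divide_right_mono[OF b(2), of \<epsilon>]] eps
        by (simp add: ui_def)
    qed
    have p: "pf n a x \<in> {0..\<lfloor>1 / d\<rfloor>}" for x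
    proof -
      have "card (cls n (l n a) x) \<le> card {..<n}" by (rule card_mono) (auto simp: cls_def)
      then have "real (card (cls n (l n a) x)) / real n \<le> 1" using n by simp
      from floor_mono[OF divide_right_mono[OF this, of d]] show ?thesis unfolding pf_def using d by simp
    qed
    show "\<tau> (n, a) \<in> F" unfolding F_def \<tau>_def using u p by auto
  next
    fix n a n' a'
    assume ok: "energy_ok M n a" and ok': "energy_ok M n' a'" and eq: "\<tau> (n, a) = \<tau> (n', a')"
    have eq1: "ui n a x y = ui n' a' x y" if "x < R" "y < R" for x y
      using eq that unfolding \<tau>_def by (auto dest!: fun_cong[where x = "(x, y)"])
    have eq2: "pf n a x = pf n' a' x" if "x < R" for x
      using eq that unfolding \<tau>_def by (auto dest!: fun_cong[where x = x])
    define w where "w n a = stepk n (\<lambda>i j. \<epsilon> * of_int (ui n a (l n a i) (l n a j)))" for n a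
    have uisym: "ui n a x y = ui n a y x" if "energy_ok M n a" for n a x y
      using bavg_sym[where n = n and x = a and l = "l n a" and a = x and b = y] that
      by (simp add: ui_def energy_ok_def)
    have wk: "w n a \<in> kernels" if "energy_ok M n a" for n a
      unfolding w_def by (rule stepk_kernels) (simp add: uisym[OF that])
    \<comment> \<open>One \<epsilon> each for regularity, truncation and rounding.\<close>
    have close: "cut_dist (stepk n a) (w n a) \<le> 3 * \<epsilon>" if ok: "energy_ok M n a" for n a
    proof -
      have n: "n > 0" using ok by (simp add: energy_ok_def)
      let ?b = "stepk n (bavg n (l n a) a)"
      have "cutn (\<lambda>p. stepk n a p - ?b p) \<le> \<epsilon>" using l[OF ok] n by (intro cut_close_imp_cutn) auto
      moreover have "cutn (\<lambda>p. ?b p - w n a p) \<le> 2 * \<epsilon>"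
      proof -
        have "cutn (\<lambda>p. ?b p - w n a p) \<le> (\<integral>p. \<bar>?b p - w n a p\<bar> \<partial>usq)"
          by (rule cutn_le_L1) (simp add: w_def)
        also have "\<dots> = (\<Sum>i<n. \<Sum>j<n. \<bar>bavg n (l n a) a i j - \<epsilon> * of_int (ui n a (l n a i) (l n a j))\<bar>) / (real n)\<^sup>2"
          unfolding w_def by (rule integral_abs_stepk_diff[OF n])
        also have "\<dots> \<le> (\<Sum>i<n. \<Sum>j<n. (bavg n (l n a) a i j)\<^sup>2 / T + \<epsilon>) / (real n)\<^sup>2"
        proof (intro divide_right_mono sum_mono)
          fix i j
          show "\<bar>bavg n (l n a) a i j - \<epsilon> * of_int (ui n a (l n a i) (l n a j))\<bar> \<le> (bavg n (l n a) a i j)\<^sup>2 / T + \<epsilon>"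
            using truncate_to_error[OF T, of "bavg n (l n a) a i j"] floor_grid[OF eps, of "truncate_to T (bavg n (l n a) a i j)"]
            unfolding ui_def bavg_def by linarith
        qed simp
        also have "\<dots> = ((\<Sum>i<n. \<Sum>j<n. (bavg n (l n a) a i j)\<^sup>2) / T + (real n)\<^sup>2 * \<epsilon>) / (real n)\<^sup>2"
          by (simp add: sum.distrib sum_divide_distrib power2_eq_square)
        also have "\<dots> \<le> (M * (real n)\<^sup>2 / T + (real n)\<^sup>2 * \<epsilon>) / (real n)\<^sup>2"
          using bavg_energy_le[of n "l n a" a] ok T
          by (intro divide_right_mono add_right_mono) (auto simp: energy_ok_def)
        also have "\<dots> = M / T + \<epsilon>" using n T by (simp add: field_simps)
        finally show ?thesis using MT by linarith
      qed
      moreover have "cutn (\<lambda>p. (stepk n a p - ?b p) + (?b p - w n a p)) \<le>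
          cutn (\<lambda>p. stepk n a p - ?b p) + cutn (\<lambda>p. ?b p - w n a p)"
        by (rule cutn_triangle) (simp_all add: w_def)
      ultimately show ?thesis
        by (simp add: cut_dist_kernels[OF energy_ok_kernels[OF ok] wk[OF ok]])
    qed
    have near1: "near (7/2 * \<epsilon>) (stepk n a) (w n a)" if "energy_ok M n a" for n a
      using close[OF that] eps by (intro nearI_cut energy_ok_kernels[OF that]) linarith
    have n: "n > 0" "n' > 0" using ok ok' by (auto simp: energy_ok_def)
    let ?u = "\<lambda>x y. \<epsilon> * of_int (ui n a x y)"
    \<comment> \<open>Equality of types lets the block values of the first matrix replace those of
      the second; only the labellings still differ.\<close>
    have w': "w n' a' = stepk n' (\<lambda>i j. ?u (l n' a' i) (l n' a' j))"
      unfolding w_def by (rule stepk_cong) (use l[OF ok'] in \<open>simp add: eq1\<close>)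
    have near2: "near \<epsilon> (w n a) (w n' a')"
      unfolding w' w_def[of n a]
    proof (rule near_step_labels[OF n])
      show "\<forall>i<n. l n a i < R" "\<forall>i<n'. l n' a' i < R" using l[OF ok] l[OF ok'] by auto
      show "\<bar>?u x y\<bar> \<le> T + \<epsilon>" for x y
        using floor_grid[OF eps, of "truncate_to T (bl n (l n a) a x y)"] truncate_to_bound[OF T, of "bl n (l n a) a x y"]
        unfolding ui_def by linarith
      show "?u x y = ?u y x" for x y using uisym[OF ok] by simp
      show "\<bar>real (card (cls n (l n a) x)) / real n - real (card (cls n' (l n' a') x)) / real n'\<bar> \<le> 2 * d" if "x < R" for x
      proof -
        let ?p = "real (card (cls n (l n a) x)) / real n" and ?q = "real (card (cls n' (l n' a') x)) / real n'"
        have e: "d * of_int \<lfloor>?p / d\<rfloor> = d * of_int \<lfloor>?q / d\<rfloor>"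
          using eq2[OF that] unfolding pf_def by simp
        show ?thesis using floor_grid[OF d, of ?p] floor_grid[OF d, of ?q] unfolding e by linarith
      qed
      have "(T + \<epsilon>) * real R > 0" using T eps R by simp
      then have "4 * (T + \<epsilon>) * real R * (2 * d) = \<epsilon> / 2" unfolding d_def by (simp add: field_simps)
      then show "4 * (T + \<epsilon>) * real R * (2 * d) < \<epsilon>" using eps by simp
    qed
    have "near (7/2 * \<epsilon>) (w n' a') (stepk n' a')"
      by (rule near_sym[OF energy_ok_kernels[OF ok'] wk[OF ok'] near1[OF ok']])
    then have "near (7/2 * \<epsilon> + \<epsilon> + 7/2 * \<epsilon>) (stepk n a) (stepk n' a')"
      by (intro near_trans[OF _ _ _ near_trans[OF _ _ _ near1[OF ok] near2]])
         (use energy_ok_kernels wk ok ok' in auto)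
    then show "near e (stepk n a) (stepk n' a')" by (simp add: \<epsilon>_def)
  qed
qed

section \<open>Extraction of a convergent sequence of orbits\<close>

lemma infinite_near_subset:
  assumes M: "M \<ge> 0" and ok: "\<And>i. energy_ok M (n i) (a i)" and S: "infinite (S :: nat set)" and e: "e > 0"
  obtains S' where "S' \<subseteq> S" "infinite S'"
    "\<And>x y. x \<in> S' \<Longrightarrow> y \<in> S' \<Longrightarrow> near e (stepk (n x) (a x)) (stepk (n y) (a y))"
proof -
  obtain F and \<tau> :: "nat \<times> (nat \<Rightarrow> nat \<Rightarrow> real) \<Rightarrow> (nat \<times> nat \<Rightarrow> int) \<times> (nat \<Rightarrow> int)"
    where F: "finite F" "\<forall>n a. energy_ok M n a \<longrightarrow> \<tau> (n, a) \<in> F"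
    and t: "\<forall>n a n' a'. energy_ok M n a \<longrightarrow> energy_ok M n' a' \<longrightarrow> \<tau> (n, a) = \<tau> (n', a') \<longrightarrow>
       near e (stepk n a) (stepk n' a')"
    using energy_types[OF M e] by (elim exE conjE) (rule that)
  have "finite ((\<lambda>i. \<tau> (n i, a i)) ` S)"
    by (rule finite_subset[OF _ F(1)]) (use F(2) ok in auto)
  from pigeonhole_infinite[OF S this] obtain x0 where x0: "infinite {x \<in> S. \<tau> (n x, a x) = \<tau> (n x0, a x0)}"
    by blast
  show thesis
    by (rule that[OF _ x0]) (use t ok in auto)
qed

text \<open>Pigeonhole on the finitely many types gives, for each tolerance, an infinite set of
  mutually near indices. The sets are nested, so consecutive picks lie in a common one.\<close>

lemma near_chain:
  assumes M: "M \<ge> 0" and ok: "\<And>i. energy_ok M (n i) (a i)"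
  obtains r :: "nat \<Rightarrow> nat" where "strict_mono r"
    "\<And>k. near ((1/2) ^ k) (stepk (n (r k)) (a (r k))) (stepk (n (r (Suc k))) (a (r (Suc k))))"
proof -
  let ?K = "\<lambda>i. stepk (n i) (a i)"
  define P where "P k Si \<longleftrightarrow> infinite (fst Si) \<and> snd Si \<in> fst Si \<and>
     (\<forall>x\<in>fst Si. \<forall>y\<in>fst Si. near ((1/2) ^ k) (?K x) (?K y))" for k and Si :: "nat set \<times> nat"
  define Q where "Q Si Si' \<longleftrightarrow> fst Si' \<subseteq> fst Si \<and> snd Si < snd Si'" for Si Si' :: "nat set \<times> nat"
  have step: "\<exists>Si'. P k Si' \<and> S \<supseteq> fst Si' \<and> i < snd Si'" if inf: "infinite S" for S i k
  proof -
    obtain S' where S': "S' \<subseteq> S" "infinite S'" "\<And>x y. x \<in> S' \<Longrightarrow> y \<in> S' \<Longrightarrow> near ((1/2)^k) (?K x) (?K y)"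
      by (rule infinite_near_subset[where n = n and a = a and e = "(1/2) ^ k", OF M ok inf]) simp_all
    obtain i' where "i' \<in> S'" "i < i'" using S'(2) infinite_nat_iff_unbounded by blast
    then show ?thesis using S' by (intro exI[of _ "(S', i')"]) (auto simp: P_def)
  qed
  have "\<exists>f. \<forall>k. P k (f k) \<and> Q (f k) (f (Suc k))"
  proof (rule dependent_nat_choice)
    show "\<exists>x. P 0 x" using step[of UNIV 0 0] by auto
    show "\<exists>y. P (Suc k) y \<and> Q x y" if "P k x" for x k
      using step[of "fst x" "Suc k" "snd x"] that by (auto simp: P_def Q_def)
  qed
  then obtain f where f: "\<And>k. P k (f k)" "\<And>k. Q (f k) (f (Suc k))" by blast
  show thesis
  proof (rule that[of "\<lambda>k. snd (f k)"])
    show "strict_mono (\<lambda>k. snd (f k))" using f(2) by (intro strict_monoI_Suc) (simp add: Q_def)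
    fix k
    have "snd (f k) \<in> fst (f k)" "snd (f (Suc k)) \<in> fst (f (Suc k))" "fst (f (Suc k)) \<subseteq> fst (f k)"
      using f(1)[of k] f(1)[of "Suc k"] f(2)[of k] by (auto simp: P_def Q_def)
    then show "near ((1/2) ^ k) (?K (snd (f k))) (?K (snd (f (Suc k))))"
      using f(1)[of k] unfolding P_def by blast
  qed
qed

text \<open>The orbits are aligned one after the other: the next bijection is chosen relative to the
  kernel already moved, which is possible since \<open>near\<close> is invariant. The limit can then
  be taken among kernels instead of orbits.\<close>

lemma cut_cauchy_representatives:
  assumes K: "\<And>k. K k \<in> kernels" and near: "\<And>k. near ((1/2) ^ k) (K k) (K (Suc k))"
  obtains \<sigma> where "\<And>k. mp_bij (\<sigma> k)" "\<And>k. cut_dist (act (\<sigma> k) (K k)) (act (\<sigma> (Suc k)) (K (Suc k))) < (1/2) ^ k"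
proof -
  have "\<exists>\<sigma>. \<forall>k. mp_bij (\<sigma> k) \<and> cut_dist (act (\<sigma> k) (K k)) (act (\<sigma> (Suc k)) (K (Suc k))) < (1/2) ^ k"
  proof (rule dependent_nat_choice)
    show "\<exists>x. mp_bij x" using mp_bij_id by blast
    fix s k assume s: "mp_bij s"
    have "near ((1/2) ^ k) (act s (K k)) (K (Suc k))"
      using near near_act_left[OF K K s] by blast
    then have "near ((1/2) ^ k) (K (Suc k)) (act s (K k))"
      by (rule near_sym[OF act_kernels[OF s K] K])
    then obtain t where "mp_bij t" "cut_dist (act t (K (Suc k))) (act s (K k)) < (1/2) ^ k"
      by (auto simp: near_def)
    then show "\<exists>t. mp_bij t \<and> cut_dist (act s (K k)) (act t (K (Suc k))) < (1/2) ^ k"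
      using cut_dist_sym[OF act_kernels[OF s K] act_kernels[OF _ K]] by metis
  qed
  then show thesis using that by blast
qed

section \<open>Tools for passing to the limit in averages and integrals\<close>

lemma Ic_le_1: "i < n \<Longrightarrow> Ic n i \<subseteq> {0..1}"
  by (drule Ic_subset) (meson atLeastLessThan_subseteq_atLeastAtMost_iff order_refl order_trans)

lemma avg_diff_le_cutn:
  assumes "integrable usq f" "i < n" "j < n"
  shows "\<bar>avg n f i j\<bar> \<le> (real n)\<^sup>2 * cutn f"
proof -
  have "\<bar>\<integral>p. indicator (Ic n i \<times> Ic n j) p * f p \<partial>usq\<bar> \<le> cutn f"
    by (rule cutn_upper) (use assms Ic_le_1 in auto)
  then have "\<bar>\<integral>p. f p * indicator (cellsq n i j) p \<partial>usq\<bar> \<le> cutn f"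
    by (simp add: cellsq_def mult.commute)
  from mult_left_mono[OF this, of "(real n)\<^sup>2"] show ?thesis by (simp add: avg_def abs_mult)
qed

lemma abs_avg_le_L1:
  assumes "integrable usq f" "i < n" "j < n"
  shows "\<bar>avg n f i j\<bar> \<le> (real n)\<^sup>2 * (\<integral>p. \<bar>f p\<bar> \<partial>usq)"
  using avg_diff_le_cutn[OF assms] cutn_le_L1[OF assms(1)]
  by (meson mult_left_mono order.trans zero_le_power2)

lemma integral_stepk_Eavg:
  assumes n: "n > 0" and f: "integrable usq f"
  shows "(\<integral>p. stepk n b p * Eavg n f p \<partial>usq) = (\<integral>p. stepk n b p * f p \<partial>usq)"
proof -
  have "(\<integral>p. stepk n b p * Eavg n f p \<partial>usq) = (\<integral>p. stepk n (\<lambda>i j. b i j * avg n f i j) p \<partial>usq)"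
  proof (rule integral_cong_AE)
    show "AE p in usq. stepk n b p * Eavg n f p = stepk n (\<lambda>i j. b i j * avg n f i j) p"
      unfolding Eavg_def by (rule stepk_comp2_AE[OF n])
  qed auto
  also have "\<dots> = (\<Sum>i<n. \<Sum>j<n. b i j * avg n f i j / (real n)\<^sup>2)"
    by (simp add: integral_stepk[OF n] sum_divide_distrib)
  also have "\<dots> = (\<integral>p. stepk n b p * f p \<partial>usq)" by (rule integral_stepk_mult[OF n f, symmetric])
  finally show ?thesis .
qed

text \<open>Tower property for nested grids: the indicator of a coarse cell is almost everywhere a
  step kernel on the finer grid and therefore does not see the averaging there.\<close>

lemma avg_Eavg_refine:
  assumes n: "n > 0" and m: "m > 0" and f: "integrable usq f" and ij: "i < n" "j < n"
  shows "avg n (Eavg (n * m) f) i j = avg n f i j"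
proof -
  have nm: "n * m > 0" using n m by simp
  let ?c = "\<lambda>i' j'. if i' = i \<and> j' = j then 1 else (0::real)"
  let ?b = "\<lambda>i' j'. ?c (i' div m) (j' div m)"
  have ae: "AE p in usq. stepk (n * m) ?b p = indicator (cellsq n i j) p"
    using stepk_refine[OF n m, of ?c] AE_usq_Ico
  proof eventually_elim
    case (elim p)
    have "indicator (cellsq n i j) p = stepk n ?c p"
      using elim(2) mem_Ic_iff[OF n] by (cases p) (auto simp: stepk_val[OF n] cellsq_def indicator_def)
    then show ?case using elim(1) by simp
  qed
  have conv: "(\<integral>p. g p * indicator (cellsq n i j) p \<partial>usq) = (\<integral>p. stepk (n * m) ?b p * g p \<partial>usq)"
    if g: "integrable usq g" for g
  proof (rule integral_cong_AE)
    have [measurable]: "g \<in> borel_measurable borel" using borel_measurable_integrable[OF g] by simp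
    show "AE p in usq. g p * indicator (cellsq n i j) p = stepk (n * m) ?b p * g p"
      using ae by eventually_elim simp
    show "(\<lambda>p. g p * indicator (cellsq n i j) p) \<in> borel_measurable usq" by simp
    show "(\<lambda>p. stepk (n * m) ?b p * g p) \<in> borel_measurable usq" by simp
  qed
  show ?thesis unfolding avg_def
    using conv[OF integrable_Eavg] conv[OF f] integral_stepk_Eavg[OF nm f] by simp
qed

text \<open>The elementary \<open>2 t |f| \<le> t^2 + f^2\<close> takes the place of Cauchy-Schwarz;
  the free \<open>t\<close> is chosen by the caller.\<close>

lemma L1_le_L2:
  fixes f :: "real \<times> real \<Rightarrow> real"
  assumes "f \<in> borel_measurable borel" "integrable usq (\<lambda>p. (f p)\<^sup>2)" "t > 0"
  shows "(\<integral>p. \<bar>f p\<bar> \<partial>usq) \<le> (t + (\<integral>p. (f p)\<^sup>2 \<partial>usq) / t) / 2"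
proof -
  have f: "integrable usq f" by (rule integrable_of_sq[OF assms(1,2)])
  have "(\<integral>p. \<bar>f p\<bar> \<partial>usq) \<le> (\<integral>p. t / 2 + (f p)\<^sup>2 / (2 * t) \<partial>usq)"
  proof (rule integral_mono)
    fix p
    have "0 \<le> (t - \<bar>f p\<bar>)\<^sup>2" by simp
    then have "2 * t * \<bar>f p\<bar> \<le> t\<^sup>2 + (f p)\<^sup>2" by (simp add: power2_diff)
    then have "\<bar>f p\<bar> \<le> (t\<^sup>2 + (f p)\<^sup>2) / (2 * t)" using assms(3) by (simp add: pos_le_divide_eq mult.commute)
    also have "\<dots> = t / 2 + (f p)\<^sup>2 / (2 * t)" using assms(3) by (simp add: add_divide_distrib power2_eq_square)
    finally show "\<bar>f p\<bar> \<le> t / 2 + (f p)\<^sup>2 / (2 * t)" .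
  qed (use f assms in auto)
  also have "\<dots> = t / 2 + (\<integral>p. (f p)\<^sup>2 \<partial>usq) / (2 * t)"
    using assms by (simp add: usq.prob_space[simplified])
  finally show ?thesis by (simp add: add_divide_distrib mult.commute)
qed

lemma nn_liminf_bound:
  fixes f :: "nat \<Rightarrow> real \<times> real \<Rightarrow> ennreal"
  assumes "\<And>j. f j \<in> borel_measurable borel" "AE p in usq. g p \<le> liminf (\<lambda>j. f j p)"
    "\<forall>\<^sub>F j in sequentially. (\<integral>\<^sup>+p. f j p \<partial>usq) \<le> c"
  shows "(\<integral>\<^sup>+p. g p \<partial>usq) \<le> c"
proof -
  have "(\<integral>\<^sup>+p. g p \<partial>usq) \<le> (\<integral>\<^sup>+p. liminf (\<lambda>j. f j p) \<partial>usq)"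
    by (rule nn_integral_mono_AE[OF assms(2)])
  also have "\<dots> \<le> liminf (\<lambda>j. \<integral>\<^sup>+p. f j p \<partial>usq)" by (rule nn_integral_liminf) (use assms in simp)
  also have "\<dots> \<le> liminf (\<lambda>j. c)" by (rule Liminf_mono[OF assms(3)])
  also have "\<dots> = c" by (simp add: Liminf_const)
  finally show ?thesis .
qed

text \<open>Indicators are approximated by step kernels only in L^1, while \<open>g\<close> is only
  square integrable. The error of the indicator is at most 1, hence its square is at most itself,
  and a weighted arithmetic-geometric mean separates it from \<open>g\<close>.\<close>

lemma rect_indicator_approx:
  assumes S: "S \<in> sets borel" and g: "g \<in> borel_measurable borel" "integrable usq (\<lambda>p. (g p)\<^sup>2)" and n: "n > 0" and t: "t > 0"
  shows "\<bar>(\<integral>p. indicator S p * g p \<partial>usq) - (\<integral>p. Eavg n (indicator S) p * g p \<partial>usq)\<bar>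
    \<le> (t * (\<integral>p. \<bar>indicator S p - Eavg n (indicator S) p\<bar> \<partial>usq) + (\<integral>p. (g p)\<^sup>2 \<partial>usq) / t) / 2"
proof -
  have gi: "integrable usq g" by (rule integrable_of_sq[OF g])
  have Si: "integrable usq (indicator S :: _ \<Rightarrow> real)" using integrable_indicator_usq[OF S] by simp
  let ?D = "Eavg n (indicator S)"
  have a: "avg n (indicator S) i j \<in> {0..1}" if "i < n" "j < n" for i j
    using avg_close[OF that Si, of "1/2" "1/2"] by (auto simp: abs_le_iff indicator_def field_simps)
  have D: "AE p in usq. \<bar>indicator S p - ?D p\<bar> \<le> 1"
    using AE_usq_Ico
  proof eventually_elim
    case (elim p)
    have "?D p \<in> {0..1}" unfolding Eavg_def stepk_val[OF n elim]
      using a cell_less[OF n] elim by (cases p) auto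
    then show ?case by (auto simp: indicator_def)
  qed
  have i1: "integrable usq (\<lambda>p. indicator S p * g p)" by (rule integrable_indicator_mult_usq[OF gi S])
  have i2: "integrable usq (\<lambda>p. ?D p * g p)" unfolding Eavg_def by (rule integrable_mult_stepk[OF gi])
  have "(\<integral>p. indicator S p * g p \<partial>usq) - (\<integral>p. ?D p * g p \<partial>usq) = (\<integral>p. indicator S p * g p - ?D p * g p \<partial>usq)"
    by (rule Bochner_Integration.integral_diff[symmetric, OF i1 i2])
  also have "\<bar>\<dots>\<bar> \<le> (\<integral>p. \<bar>indicator S p * g p - ?D p * g p\<bar> \<partial>usq)" by (rule integral_abs_bound)
  also have "\<dots> \<le> (\<integral>p. (t * \<bar>indicator S p - ?D p\<bar> + (g p)\<^sup>2 / t) / 2 \<partial>usq)"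
  proof (rule integral_mono_AE)
    show "integrable usq (\<lambda>p. \<bar>indicator S p * g p - ?D p * g p\<bar>)" using i1 i2 by simp
    show "integrable usq (\<lambda>p. (t * \<bar>indicator S p - ?D p\<bar> + (g p)\<^sup>2 / t) / 2)" using Si g by simp
    show "AE p in usq. \<bar>indicator S p * g p - ?D p * g p\<bar> \<le> (t * \<bar>indicator S p - ?D p\<bar> + (g p)\<^sup>2 / t) / 2"
      using D
    proof eventually_elim
      case (elim p)
      let ?d = "\<bar>indicator S p - ?D p\<bar>"
      have "0 \<le> (t * ?d - \<bar>g p\<bar>)\<^sup>2" by simp
      then have "2 * t * (?d * \<bar>g p\<bar>) \<le> t\<^sup>2 * ?d\<^sup>2 + (g p)\<^sup>2" by (simp add: power2_diff power_mult_distrib mult_ac)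
      also have "\<dots> \<le> t\<^sup>2 * ?d + (g p)\<^sup>2"
      proof -
        have "?d\<^sup>2 \<le> ?d" using mult_left_mono[OF elim, of ?d] by (simp add: power2_eq_square)
        then show ?thesis by (intro add_right_mono mult_left_mono) auto
      qed
      finally have "?d * \<bar>g p\<bar> \<le> (t\<^sup>2 * ?d + (g p)\<^sup>2) / (2 * t)" using t by (simp add: pos_le_divide_eq mult.commute)
      also have "\<dots> = (t * ?d + (g p)\<^sup>2 / t) / 2" using t by (simp add: field_simps power2_eq_square)
      finally show ?case by (simp add: abs_mult[symmetric] left_diff_distrib)
    qed
  qed
  also have "\<dots> = (t * (\<integral>p. \<bar>indicator S p - ?D p\<bar> \<partial>usq) + (\<integral>p. (g p)\<^sup>2 \<partial>usq) / t) / 2"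
    using Si g by simp
  finally show ?thesis .
qed

lemma avg_sym:
  assumes k: "k \<in> kernels"
  shows "avg n k i j = avg n k j i"
proof -
  interpret u: prob_space uint by (rule prob_space_uint)
  have p: "pair_sigma_finite uint uint" by standard
  have sym: "k (y, x) = k (x, y)" for x y using k unfolding kernels_def by auto
  have m: "(\<lambda>p. k p * indicator (cellsq n i j) p) \<in> borel_measurable (uint \<Otimes>\<^sub>M uint)"
    using kernels_measurable[OF k] unfolding usq_pair[symmetric] by simp
  have "(\<integral>p. k p * indicator (cellsq n i j) p \<partial>usq) = (\<integral>(x, y). k (y, x) * indicator (cellsq n i j) (y, x) \<partial>usq)"
    using pair_sigma_finite.integral_product_swap[OF p m] by (simp add: usq_pair)
  also have "\<dots> = (\<integral>p. k p * indicator (cellsq n j i) p \<partial>usq)"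
    by (rule Bochner_Integration.integral_cong) (auto simp: sym cellsq_def indicator_def)
  finally show ?thesis by (simp add: avg_def)
qed

text \<open>The properties of the Cramer function on which compactness and lower semicontinuity rest; the quadratic bound comes from the Gaussian moment.\<close>

locale rate_fun =
  fixes hh :: "real \<Rightarrow> ennreal" and C :: real
  assumes hh_measurable [measurable]: "hh \<in> borel_measurable borel"
    and hh_Jensen: "\<And>k n i j. integrable usq k \<Longrightarrow> i < n \<Longrightarrow> j < n \<Longrightarrow>
        hh (avg n k i j) * ennreal (1 / (real n)\<^sup>2) \<le> (\<integral>\<^sup>+p. hh (k p) * indicator (cellsq n i j) p \<partial>usq)"
    and hh_lsc: "\<And>y r. r \<longlonglongrightarrow> y \<Longrightarrow> hh y \<le> liminf (\<lambda>j. hh (r j))"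
    and hh_quad: "\<And>y. ennreal (y\<^sup>2) \<le> hh y + ennreal C"
    and C_nonneg: "0 \<le> C"
begin

text \<open>Twice the rate, kept in \<open>ennreal\<close>, where Fatou and Jensen apply to infinite
  values; \<open>rateI_II\<close> translates back.\<close>

definition II :: "(real \<times> real \<Rightarrow> real) \<Rightarrow> ennreal" where
  "II k = (\<integral>\<^sup>+p. hh (k p) \<partial>usq)"

lemma II_Eavg:
  assumes n: "n > 0" and k: "integrable usq k"
  shows "II (Eavg n k) \<le> II k"
proof -
  have [measurable]: "k \<in> borel_measurable borel" using borel_measurable_integrable[OF k] by simp
  have "II (Eavg n k) = (\<Sum>i<n. \<Sum>j<n. hh (avg n k i j) * ennreal (1 / (real n)\<^sup>2))"
    unfolding II_def Eavg_def by (rule nn_integral_stepk[OF n])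
  also have "\<dots> \<le> (\<Sum>i<n. \<Sum>j<n. \<integral>\<^sup>+p. hh (k p) * indicator (cellsq n i j) p \<partial>usq)"
    by (intro sum_mono hh_Jensen k) auto
  also have "\<dots> = II k" unfolding II_def by (rule nn_integral_cells[symmetric, OF n]) simp
  finally show ?thesis .
qed

lemma II_act: "mp_bij \<sigma> \<Longrightarrow> k \<in> kernels \<Longrightarrow> II (act \<sigma> k) = II k"
  unfolding II_def by (intro nn_integral_act kernels_measurable hh_measurable)

lemma II_square:
  assumes [measurable]: "k \<in> borel_measurable borel" and L: "II k \<le> ennreal L" "0 \<le> L"
  shows "integrable usq (\<lambda>p. (k p)\<^sup>2)" "(\<integral>p. (k p)\<^sup>2 \<partial>usq) \<le> L + C"
proof -
  have "(\<integral>\<^sup>+p. ennreal ((k p)\<^sup>2) \<partial>usq) \<le> (\<integral>\<^sup>+p. hh (k p) + ennreal C \<partial>usq)"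
    by (intro nn_integral_mono hh_quad)
  also have "\<dots> = II k + ennreal C"
    unfolding II_def by (subst nn_integral_add) (auto simp: usq.emeasure_space_1[simplified])
  also have "\<dots> \<le> ennreal L + ennreal C" by (intro add_right_mono L)
  also have "\<dots> = ennreal (L + C)" by (rule ennreal_plus[symmetric, OF L(2) C_nonneg])
  finally have *: "(\<integral>\<^sup>+p. ennreal ((k p)\<^sup>2) \<partial>usq) \<le> ennreal (L + C)" .
  show i: "integrable usq (\<lambda>p. (k p)\<^sup>2)"
  proof (rule integrableI_bounded)
    show "(\<integral>\<^sup>+p. ennreal (norm ((k p)\<^sup>2)) \<partial>usq) < \<infinity>"
      using * by (simp add: order.strict_trans1[OF _ ennreal_less_top])
  qed simp
  have "ennreal (\<integral>p. (k p)\<^sup>2 \<partial>usq) \<le> ennreal (L + C)"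
    using * nn_integral_eq_integral[OF i] by simp
  then show "(\<integral>p. (k p)\<^sup>2 \<partial>usq) \<le> L + C"
    using L C_nonneg ennreal_le_iff[of "L + C"] by (simp del: ennreal_plus)
qed

text \<open>The limit is built from its dyadic averages: these converge because cells are rectangles, form an \<open>L\<^sup>2\<close>-bounded martingale, and hence have an almost everywhere limit along a subsequence. Jensen, lower semicontinuity and Fatou bound its rate.\<close>

theorem cut_complete:
  assumes g: "\<And>r. g r \<in> kernels" and L: "\<And>r. II (g r) \<le> ennreal L" "0 \<le> L"
    and cau: "\<And>r. cut_dist (g r) (g (Suc r)) < (1/2) ^ r"
  obtains k where "k \<in> kernels" "II k \<le> ennreal L" "\<And>r. cut_dist (g r) k \<le> 2 * (1/2) ^ r"
proof -
  define M where "M = L + C"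
  have M: "M \<ge> 0" using L C_nonneg by (simp add: M_def)
  note gm [measurable] = kernels_measurable[OF g]
  note gi = kernels_integrable[OF g]
  have gM: "(\<integral>p. (g r p)\<^sup>2 \<partial>usq) \<le> M" for r
    unfolding M_def by (rule II_square(2)[OF gm L])
  \<comment> \<open>The partial geometric sum is kept in closed form so that the induction closes;
    \<open>cau3\<close> drops the subtracted term.\<close>
  have cau2: "cut_dist (g r) (g (r + s)) \<le> 2 * (1/2) ^ r - 2 * (1/2) ^ (r + s)" for r s
  proof (induction s)
    case 0
    have "cut_dist (g r) (g r) \<le> (\<integral>p. \<bar>g r p - g r p\<bar> \<partial>usq)"
      unfolding cut_dist_kernels[OF g g] by (rule cutn_le_L1) (use gi in auto)
    then show ?case by simp
  next
    case (Suc s)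
    have "cut_dist (g r) (g (r + Suc s)) \<le> cut_dist (g r) (g (r + s)) + cut_dist (g (r + s)) (g (Suc (r + s)))"
      using cut_dist_triangle[OF g g g] by simp
    also have "\<dots> \<le> 2 * (1/2) ^ r - 2 * (1/2) ^ (r + s) + (1/2) ^ (r + s)" using Suc cau[of "r + s"] by linarith
    finally show ?case by simp
  qed
  have cau3: "cutn (\<lambda>p. g r p - g s p) \<le> 2 * (1/2) ^ r" if "r \<le> s" for r s
  proof -
    have "(0 :: real) \<le> (1/2) ^ s" by simp
    moreover have "cut_dist (g r) (g s) \<le> 2 * (1/2) ^ r - 2 * (1/2) ^ s" using cau2[of r "s - r"] that by simp
    ultimately show ?thesis using cut_dist_kernels[OF g g, of r s] by linarith
  qed
  have conv: "convergent (\<lambda>r. avg n (g r) i j)" if "i < n" "j < n" for n i j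
  proof (rule real_Cauchy_convergent, rule metric_CauchyI)
    fix e :: real assume e: "e > 0"
    have "(\<lambda>r. (real n)\<^sup>2 * (2 * (1/2) ^ r)) \<longlonglongrightarrow> (real n)\<^sup>2 * (2 * 0)"
      by (intro tendsto_intros LIMSEQ_realpow_zero) auto
    then have "\<forall>\<^sub>F r in sequentially. (real n)\<^sup>2 * (2 * (1/2) ^ r) < e"
      using e by (intro order_tendstoD(2)) auto
    then obtain R where R: "\<And>r. r \<ge> R \<Longrightarrow> (real n)\<^sup>2 * (2 * (1/2) ^ r) < e"
      by (auto simp: eventually_sequentially)
    have *: "\<bar>avg n (g r) i j - avg n (g s) i j\<bar> < e" if "R \<le> r" "r \<le> s" for r s
    proof -
      have "\<bar>avg n (g r) i j - avg n (g s) i j\<bar> = \<bar>avg n (\<lambda>p. g r p - g s p) i j\<bar>"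
        by (simp add: avg_diff gi)
      also have "\<dots> \<le> (real n)\<^sup>2 * cutn (\<lambda>p. g r p - g s p)"
        by (rule avg_diff_le_cutn) (use gi \<open>i < n\<close> \<open>j < n\<close> in auto)
      also have "\<dots> \<le> (real n)\<^sup>2 * (2 * (1/2) ^ r)" by (intro mult_left_mono cau3 that) simp
      finally show ?thesis using R[OF that(1)] by linarith
    qed
    show "\<exists>R. \<forall>r\<ge>R. \<forall>s\<ge>R. dist (avg n (g r) i j) (avg n (g s) i j) < e"
    proof (intro exI[of _ R] allI impI)
      fix r s assume "R \<le> r" "R \<le> s"
      then show "dist (avg n (g r) i j) (avg n (g s) i j) < e"
        using *[of r s] *[of s r] by (cases "r \<le> s") (auto simp: dist_real_def abs_minus_commute)
    qed
  qed
  define \<alpha> where "\<alpha> n i j = lim (\<lambda>r. avg n (g r) i j)" for n i j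
  have al: "(\<lambda>r. avg n (g r) i j) \<longlonglongrightarrow> \<alpha> n i j" if "i < n" "j < n" for n i j
    unfolding \<alpha>_def using conv[OF that] by (simp add: convergent_LIMSEQ_iff)
  \<comment> \<open>Only dyadic grids are used, since they are nested.\<close>
  define f where "f m = stepk (2 ^ m) (\<alpha> (2 ^ m))" for m :: nat
  have fm [measurable]: "f m \<in> borel_measurable borel" for m by (simp add: f_def)
  have fi: "integrable usq (f m)" for m by (simp add: f_def)
  have flim: "(\<lambda>r. Eavg (2 ^ m) (g r) p) \<longlonglongrightarrow> f m p" for m p
    unfolding Eavg_def f_def stepk_def by (intro tendsto_intros al) auto
  have fII: "II (f m) \<le> ennreal L" for m
    unfolding II_def
  proof (rule nn_liminf_bound)
    show "AE p in usq. hh (f m p) \<le> liminf (\<lambda>r. hh (Eavg (2 ^ m) (g r) p))"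
      by (intro AE_I2 hh_lsc flim)
    show "\<forall>\<^sub>F r in sequentially. (\<integral>\<^sup>+ p. hh (Eavg (2 ^ m) (g r) p) \<partial>usq) \<le> ennreal L"
      using order.trans[OF II_Eavg[OF _ gi] L(1), of "2 ^ m"] by (intro always_eventually allI) (simp add: II_def)
  qed simp
  have asym: "\<alpha> n i j = \<alpha> n j i" for n i j
  proof -
    have "avg n (g r) i j = avg n (g r) j i" for r by (rule avg_sym[OF g])
    then show ?thesis by (simp only: \<alpha>_def)
  qed
  have fker: "f m \<in> kernels" for m unfolding f_def by (rule stepk_kernels) (rule asym)
  have fsq: "integrable usq (\<lambda>p. (f m p)\<^sup>2)" for m by (rule kernels_sq[OF fker])
  have fM: "(\<integral>p. (f m p)\<^sup>2 \<partial>usq) \<le> M" for m unfolding M_def by (rule II_square(2)[OF fm fII L(2)])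
  \<comment> \<open>The martingale property, inherited from the tower property: a cell average of a
    step kernel is a finite linear combination of its values and so passes to the limit.\<close>
  have cons: "avg (2 ^ m) (f m') i j = \<alpha> (2 ^ m) i j" if "m \<le> m'" and ij: "i < 2 ^ m" "j < 2 ^ m" for m m' i j
  proof -
    have e: "(2 :: nat) ^ m' = 2 ^ m * 2 ^ (m' - m)" using that by (simp flip: power_add)
    have "avg (2 ^ m) (Eavg (2 ^ m') (g r)) i j = avg (2 ^ m) (g r) i j" for r
      unfolding e by (rule avg_Eavg_refine[OF _ _ gi ij]) auto
    then have "(\<lambda>r. avg (2 ^ m) (Eavg (2 ^ m') (g r)) i j) \<longlonglongrightarrow> \<alpha> (2 ^ m) i j"
      using al[OF ij] by simp
    moreover have "(\<lambda>r. avg (2 ^ m) (Eavg (2 ^ m') (g r)) i j) \<longlonglongrightarrow> avg (2 ^ m) (f m') i j"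
    proof -
      have a: "avg (2 ^ m) (stepk (2 ^ m') b) i j =
          (real (2 ^ m))\<^sup>2 * (\<Sum>i'<2 ^ m'. \<Sum>j'<2 ^ m'. b i' j' * avg (2 ^ m') (indicator (cellsq (2 ^ m) i j)) i' j' / (real (2 ^ m'))\<^sup>2)" for b
        unfolding avg_def[of "2 ^ m"]
        by (subst integral_stepk_mult) (use integrable_indicator_usq[OF cellsq_borel] in auto)
      show ?thesis unfolding Eavg_def f_def a by (intro tendsto_intros al) auto
    qed
    ultimately show ?thesis using LIMSEQ_unique by blast
  qed
  have orth: "(\<integral>p. f m p * f m' p \<partial>usq) = (\<integral>p. (f m p)\<^sup>2 \<partial>usq)" if "m \<le> m'" for m m'
  proof -
    have "(\<integral>p. f m p * f m' p \<partial>usq) = (\<Sum>i<2^m. \<Sum>j<2^m. \<alpha> (2^m) i j * avg (2^m) (f m') i j / (real (2^m))\<^sup>2)"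
      unfolding f_def[of m] by (rule integral_stepk_mult[OF _ fi]) simp
    also have "\<dots> = (\<Sum>i<2^m. \<Sum>j<2^m. \<alpha> (2^m) i j * avg (2^m) (f m) i j / (real (2^m))\<^sup>2)"
      by (intro sum.cong refl) (simp add: cons that)
    also have "\<dots> = (\<integral>p. f m p * f m p \<partial>usq)"
      unfolding f_def[of m] by (rule integral_stepk_mult[symmetric]) simp_all
    finally show ?thesis by (simp add: power2_eq_square)
  qed
  have ff: "integrable usq (\<lambda>p. f m p * f m' p)" for m m'
    unfolding f_def[of m] by (rule integrable_mult_stepk[OF fi])
  have dsq: "(\<integral>p. (f m' p - f m p)\<^sup>2 \<partial>usq) = (\<integral>p. (f m' p)\<^sup>2 \<partial>usq) - (\<integral>p. (f m p)\<^sup>2 \<partial>usq)"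
    and dsqi: "integrable usq (\<lambda>p. (f m' p - f m p)\<^sup>2)" if "m \<le> m'" for m m'
  proof -
    have e: "(\<lambda>p. (f m' p - f m p)\<^sup>2) = (\<lambda>p. (f m' p)\<^sup>2 + (f m p)\<^sup>2 - 2 * (f m p * f m' p))"
      by (auto simp: power2_diff mult_ac)
    show "integrable usq (\<lambda>p. (f m' p - f m p)\<^sup>2)" unfolding e using fsq ff by simp
    have "(\<integral>p. (f m' p - f m p)\<^sup>2 \<partial>usq) = (\<integral>p. (f m' p)\<^sup>2 \<partial>usq) + (\<integral>p. (f m p)\<^sup>2 \<partial>usq) - 2 * (\<integral>p. f m p * f m' p \<partial>usq)"
      unfolding e using fsq ff by simp
    then show "(\<integral>p. (f m' p - f m p)\<^sup>2 \<partial>usq) = (\<integral>p. (f m' p)\<^sup>2 \<partial>usq) - (\<integral>p. (f m p)\<^sup>2 \<partial>usq)"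
      using orth[OF that] by simp
  qed
  let ?E = "\<lambda>m. \<integral>p. (f m p)\<^sup>2 \<partial>usq"
  have mono: "?E m \<le> ?E m'" if "m \<le> m'" for m m'
    using dsq[OF that] Bochner_Integration.integral_nonneg[of usq "\<lambda>p. (f m' p - f m p)\<^sup>2"] by simp
  have "convergent ?E"
    by (rule Bseq_monoseq_convergent[OF BseqI'[of _ M]]) (use fM mono in \<open>auto simp: monoseq_def\<close>)
  then have CE: "Cauchy ?E" by (simp add: Cauchy_convergent_iff)
  \<comment> \<open>By orthogonality the energies increase, and they are bounded by
    \<open>M\<close>, so squared differences of late terms integrate to at most
    \<open>e^2 / 2\<close>; \<open>L1_le_L2\<close> with t = e then gives at most
    \<open>3 * e / 4\<close>.\<close>
  have L1C: "\<exists>N. \<forall>i\<ge>N. \<forall>j\<ge>N. (\<integral>p. norm (f i p - f j p) \<partial>usq) < e" if e: "e > 0" for e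
  proof -
    have "e\<^sup>2 / 2 > 0" using e by simp
    then obtain N where N: "\<And>i j. i \<ge> N \<Longrightarrow> j \<ge> N \<Longrightarrow> \<bar>?E i - ?E j\<bar> < e\<^sup>2 / 2"
      using CE unfolding Cauchy_def dist_real_def by blast
    have *: "(\<integral>p. \<bar>f j p - f i p\<bar> \<partial>usq) < e" if "N \<le> i" "i \<le> j" for i j
    proof -
      have "(\<integral>p. \<bar>f j p - f i p\<bar> \<partial>usq) \<le> (e + (\<integral>p. (f j p - f i p)\<^sup>2 \<partial>usq) / e) / 2"
        by (rule L1_le_L2) (use dsqi[OF that(2)] e in auto)
      also have "\<dots> \<le> (e + (e\<^sup>2 / 2) / e) / 2"
      proof -
        have "?E j - ?E i \<le> e\<^sup>2 / 2" using abs_ge_self N[of j i] that by (meson less_imp_le order.trans)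
        then show ?thesis unfolding dsq[OF that(2)] using e by (intro divide_right_mono add_left_mono) auto
      qed
      also have "\<dots> < e" using e by (simp add: power2_eq_square)
      finally show ?thesis .
    qed
    show ?thesis
    proof (intro exI[of _ N] allI impI)
      fix i j assume ij: "N \<le> i" "N \<le> j"
      show "(\<integral>p. norm (f i p - f j p) \<partial>usq) < e"
      proof (cases "i \<le> j")
        case True then show ?thesis using *[of i j] ij by (simp add: abs_minus_commute)
      next
        case False then show ?thesis using *[of j i] ij by simp
      qed
    qed
  qed
  obtain \<phi> where phi: "strict_mono \<phi>" "AE p in usq. Cauchy (\<lambda>i. f (\<phi> i) p)"
    by (rule cauchy_L1_AE_cauchy_subseq[of usq f, OF fi L1C])
  define k where "k p = lim (\<lambda>i. f (\<phi> i) p)" for p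
  have km [measurable]: "k \<in> borel_measurable borel" unfolding k_def by measurable
  have klim: "AE p in usq. (\<lambda>i. f (\<phi> i) p) \<longlonglongrightarrow> k p"
    using phi(2) by eventually_elim (simp add: k_def Cauchy_convergent_iff convergent_LIMSEQ_iff)
  have kII: "II k \<le> ennreal L"
    unfolding II_def
  proof (rule nn_liminf_bound[where f = "\<lambda>i p. hh (f (\<phi> i) p)"])
    show "AE p in usq. hh (k p) \<le> liminf (\<lambda>i. hh (f (\<phi> i) p))"
      using klim by eventually_elim (rule hh_lsc)
    show "\<forall>\<^sub>F j in sequentially. (\<integral>\<^sup>+ p. hh (f (\<phi> j) p) \<partial>usq) \<le> ennreal L"
      using fII by (intro always_eventually allI) (simp add: II_def)
  qed simp
  have ksq: "integrable usq (\<lambda>p. (k p)\<^sup>2)" and kM: "(\<integral>p. (k p)\<^sup>2 \<partial>usq) \<le> M"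
    unfolding M_def by (rule II_square[OF km kII L(2)])+
  have kker: "k \<in> kernels"
  proof (rule kernelsI[OF km _ _ ksq])
    show "k p = 0" if "p \<notin> unitsq" for p
      using kernels_outside[OF fker that] by (simp add: k_def)
    show "k (x, y) = k (y, x)" for x y
    proof -
      have "f m (x, y) = f m (y, x)" for m using fker[of m] unfolding kernels_def by blast
      then show ?thesis by (simp add: k_def)
    qed
  qed
  have ki: "integrable usq k" by (rule kernels_integrable[OF kker])
  \<comment> \<open>Fatou along the subsequence \<open>\<phi>\<close> carries the Cauchy bound over
    to the limit, for every late term of the full sequence.\<close>
  have L1k: "\<exists>N. \<forall>i\<ge>N. (\<integral>p. \<bar>f i p - k p\<bar> \<partial>usq) \<le> e" if e: "e > 0" for e
  proof -
    obtain N where N: "\<And>i j. i \<ge> N \<Longrightarrow> j \<ge> N \<Longrightarrow> (\<integral>p. norm (f i p - f j p) \<partial>usq) < e"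
      using L1C[OF e] by blast
    have "(\<integral>p. \<bar>f i p - k p\<bar> \<partial>usq) \<le> e" if i: "i \<ge> N" for i
    proof -
      have "(\<integral>\<^sup>+p. ennreal \<bar>f i p - k p\<bar> \<partial>usq) \<le> ennreal e"
      proof (rule nn_liminf_bound[where f = "\<lambda>j p. ennreal \<bar>f i p - f (\<phi> j) p\<bar>"])
        show "AE p in usq. ennreal \<bar>f i p - k p\<bar> \<le> liminf (\<lambda>j. ennreal \<bar>f i p - f (\<phi> j) p\<bar>)"
          using klim
        proof eventually_elim
          case (elim p)
          have "(\<lambda>j. ennreal \<bar>f i p - f (\<phi> j) p\<bar>) \<longlonglongrightarrow> ennreal \<bar>f i p - k p\<bar>"
            by (intro tendsto_intros elim tendsto_ennrealI)
          from lim_imp_Liminf[OF sequentially_bot this] show ?case by (simp only: order_refl)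
        qed
        have "(\<integral>\<^sup>+ p. ennreal \<bar>f i p - f (\<phi> j) p\<bar> \<partial>usq) \<le> ennreal e" if "j \<ge> N" for j
        proof -
          have "\<phi> j \<ge> N" using that seq_suble[OF phi(1), of j] by simp
          have "(\<integral>\<^sup>+ p. ennreal \<bar>f i p - f (\<phi> j) p\<bar> \<partial>usq) = ennreal (\<integral>p. \<bar>f i p - f (\<phi> j) p\<bar> \<partial>usq)"
            by (rule nn_integral_eq_integral) (use fi in auto)
          also have "\<dots> \<le> ennreal e" using N[OF i \<open>\<phi> j \<ge> N\<close>] by (intro ennreal_leI) simp
          finally show ?thesis .
        qed
        then show "\<forall>\<^sub>F j in sequentially. (\<integral>\<^sup>+ p. ennreal \<bar>f i p - f (\<phi> j) p\<bar> \<partial>usq) \<le> ennreal e"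
          by (rule eventually_sequentiallyI)
      qed simp
      moreover have "(\<integral>\<^sup>+p. ennreal \<bar>f i p - k p\<bar> \<partial>usq) = ennreal (\<integral>p. \<bar>f i p - k p\<bar> \<partial>usq)"
        by (rule nn_integral_eq_integral) (use fi ki in auto)
      ultimately show ?thesis using e by (simp add: ennreal_le_iff)
    qed
    then show ?thesis by blast
  qed
  have kavg: "avg (2 ^ m) k i j = \<alpha> (2 ^ m) i j" if ij: "i < 2 ^ m" "j < 2 ^ m" for m i j
  proof -
    have "\<bar>avg (2 ^ m) k i j - \<alpha> (2 ^ m) i j\<bar> \<le> (real (2 ^ m))\<^sup>2 * e" if e: "e > 0" for e
    proof -
      obtain N where N: "\<forall>i\<ge>N. (\<integral>p. \<bar>f i p - k p\<bar> \<partial>usq) \<le> e" using L1k[OF e] by blast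
      let ?m = "max m N"
      have "\<bar>avg (2 ^ m) k i j - \<alpha> (2 ^ m) i j\<bar> = \<bar>avg (2 ^ m) (\<lambda>p. k p - f ?m p) i j\<bar>"
        using cons[of m ?m i j] ij by (simp add: avg_diff ki fi)
      also have "\<dots> \<le> (real (2 ^ m))\<^sup>2 * (\<integral>p. \<bar>k p - f ?m p\<bar> \<partial>usq)"
        by (rule abs_avg_le_L1) (use ki fi ij in auto)
      also have "\<dots> \<le> (real (2 ^ m))\<^sup>2 * e"
        using N by (intro mult_left_mono) (auto simp: abs_minus_commute)
      finally show ?thesis .
    qed
    note b = this
    have "\<bar>avg (2 ^ m) k i j - \<alpha> (2 ^ m) i j\<bar> \<le> 0"
    proof (rule field_le_epsilon)
      fix e :: real assume "e > 0"
      then show "\<bar>avg (2 ^ m) k i j - \<alpha> (2 ^ m) i j\<bar> \<le> 0 + e"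
        using b[of "e / (real (2 ^ m))\<^sup>2"] by simp
    qed
    then show ?thesis by simp
  qed
  \<comment> \<open>The bound \<open>M\<close> on the second moments makes the replacement of the
    indicator by its cell averages uniform in r, and for those the convergence is that of finitely
    many averages.\<close>
  have rect: "(\<lambda>r. \<integral>p. indicator S p * g r p \<partial>usq) \<longlonglongrightarrow> (\<integral>p. indicator S p * k p \<partial>usq)"
    if S: "S \<in> sets borel" for S
  proof (rule LIMSEQ_I)
    fix e :: real assume e: "e > 0"
    \<comment> \<open>With this \<open>t\<close> and \<open>\<eta>\<close> the two terms of
      \<open>rect_indicator_approx\<close> are at most \<open>e / 4\<close> each, before
      halving.\<close>
    define t where "t = (M + 1) * 4 / e"
    have t: "t > 0" using M e by (simp add: t_def)
    define \<eta> where "\<eta> = e / (4 * t)"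
    have eta: "\<eta> > 0" using e t by (simp add: \<eta>_def)
    have "avg_approx (indicator S)" by (rule avg_approx_borel[OF S])
    from LIMSEQ_D[OF this[unfolded avg_approx_def] eta]
    obtain N where N: "\<And>n. n \<ge> N \<Longrightarrow> (\<integral>p. \<bar>indicator S p - Eavg n (indicator S) p\<bar> \<partial>usq) < \<eta>" by auto
    let ?n = "2 ^ N :: nat"
    have n: "?n > 0" "?n \<ge> N" by (simp_all add: less_imp_le)
    let ?D = "Eavg ?n (indicator S)"
    have close: "\<bar>(\<integral>p. indicator S p * h p \<partial>usq) - (\<integral>p. ?D p * h p \<partial>usq)\<bar> \<le> e / 4"
      if h: "h \<in> borel_measurable borel" "integrable usq (\<lambda>p. (h p)\<^sup>2)" "(\<integral>p. (h p)\<^sup>2 \<partial>usq) \<le> M" for h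
    proof -
      have "\<bar>(\<integral>p. indicator S p * h p \<partial>usq) - (\<integral>p. ?D p * h p \<partial>usq)\<bar> \<le>
         (t * (\<integral>p. \<bar>indicator S p - ?D p\<bar> \<partial>usq) + (\<integral>p. (h p)\<^sup>2 \<partial>usq) / t) / 2"
        by (rule rect_indicator_approx[OF S h(1,2) n(1) t])
      also have "\<dots> \<le> (t * \<eta> + (M + 1) / t) / 2"
        by (intro divide_right_mono add_mono mult_left_mono less_imp_le[OF N[OF n(2)]])
           (use h(3) t in \<open>auto intro: divide_right_mono\<close>)
      also have "t * \<eta> = e / 4" using t by (simp add: \<eta>_def)
      also have "(M + 1) / t = e / 4" using M e by (simp add: t_def field_simps)
      finally show ?thesis by simp
    qed
    have Dint: "(\<integral>p. ?D p * h p \<partial>usq) = (\<Sum>i<?n. \<Sum>j<?n. avg ?n (indicator S) i j * avg ?n h i j / (real ?n)\<^sup>2)"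
      if "integrable usq h" for h
      unfolding Eavg_def by (rule integral_stepk_mult[OF n(1) that])
    have "(\<lambda>r. \<integral>p. ?D p * g r p \<partial>usq) \<longlonglongrightarrow> (\<integral>p. ?D p * k p \<partial>usq)"
      unfolding Dint[OF gi] Dint[OF ki]
      by (intro tendsto_intros) (use al kavg in auto)
    from LIMSEQ_D[OF this, of "e / 4"] e obtain R where R: "\<And>r. r \<ge> R \<Longrightarrow>
        \<bar>(\<integral>p. ?D p * g r p \<partial>usq) - (\<integral>p. ?D p * k p \<partial>usq)\<bar> < e / 4" by auto
    show "\<exists>R. \<forall>r\<ge>R. norm ((\<integral>p. indicator S p * g r p \<partial>usq) - (\<integral>p. indicator S p * k p \<partial>usq)) < e"
    proof (intro exI[of _ R] allI impI)
      fix r assume "R \<le> r"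
      then show "norm ((\<integral>p. indicator S p * g r p \<partial>usq) - (\<integral>p. indicator S p * k p \<partial>usq)) < e"
        using R[of r] close[OF gm[of r] kernels_sq[OF g] gM] close[OF km ksq kM] e
        unfolding real_norm_def by linarith
    qed
  qed
  \<comment> \<open>For a fixed rectangle the Cauchy bound passes to the limit in s; the supremum
    over rectangles is taken afterwards, so their convergence need not be uniform.\<close>
  have "cut_dist (g r) k \<le> 2 * (1/2) ^ r" for r
    unfolding cut_dist_kernels[OF g kker]
  proof (rule cutn_least)
    fix A B :: "real set" assume *: "A \<in> sets borel" "A \<subseteq> {0..1}" "B \<in> sets borel" "B \<subseteq> {0..1}"
    have S: "A \<times> B \<in> sets borel" using * by (intro Times_borel)
    have spl: "(\<integral>p. indicator (A \<times> B) p * (u p - v p) \<partial>usq) =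
        (\<integral>p. indicator (A \<times> B) p * u p \<partial>usq) - (\<integral>p. indicator (A \<times> B) p * v p \<partial>usq)"
      if "integrable usq u" "integrable usq v" for u v :: "real \<times> real \<Rightarrow> real"
      unfolding right_diff_distrib
      by (rule Bochner_Integration.integral_diff) (use that integrable_indicator_mult_usq S in auto)
    have "(\<lambda>s. \<bar>\<integral>p. indicator (A \<times> B) p * (g r p - g s p) \<partial>usq\<bar>) \<longlonglongrightarrow> \<bar>\<integral>p. indicator (A \<times> B) p * (g r p - k p) \<partial>usq\<bar>"
      unfolding spl[OF gi gi] spl[OF gi ki] by (intro tendsto_intros rect S)
    moreover have "\<bar>\<integral>p. indicator (A \<times> B) p * (g r p - g s p) \<partial>usq\<bar> \<le> 2 * (1/2) ^ r" if "s \<ge> r" for s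
      by (rule order.trans[OF cutn_upper cau3[OF that]]) (use gi * in auto)
    ultimately show "\<bar>\<integral>p. indicator (A \<times> B) p * (g r p - k p) \<partial>usq\<bar> \<le> 2 * (1/2) ^ r"
      by (intro LIMSEQ_le_const2) auto
  qed
  then show thesis using that kker kII by blast
qed

text \<open>Total boundedness (\<open>near_chain\<close>) and completeness
  (\<open>cut_complete\<close>) combine: a bound on \<open>II\<close> bounds the energy by
  \<open>L + C\<close>, and aligning the kernels does not change \<open>II\<close>. That the limit
  is approached infinitely often is what \<open>closed_neighbourhood_rate\<close> uses.\<close>

theorem level_compact:
  fixes n :: "nat \<Rightarrow> nat" and a :: "nat \<Rightarrow> nat \<Rightarrow> nat \<Rightarrow> real"
  assumes n: "\<And>i. n i > 0" and sym: "\<And>i x y. x < n i \<Longrightarrow> y < n i \<Longrightarrow> a i x y = a i y x"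
    and L: "\<And>i. II (stepk (n i) (a i)) \<le> ennreal L" "0 \<le> L"
  obtains k where "k \<in> kernels" "II k \<le> ennreal L"
    "\<And>e i0. e > 0 \<Longrightarrow> \<exists>i\<ge>i0. near e k (stepk (n i) (a i))"
proof -
  have ok: "energy_ok (L + C) (n i) (a i)" for i
  proof -
    have "(\<Sum>x<n i. \<Sum>y<n i. (a i x y)\<^sup>2) / (real (n i))\<^sup>2 = (\<integral>p. (stepk (n i) (a i) p)\<^sup>2 \<partial>usq)"
      by (rule integral_stepk_comp[OF n, where \<phi> = "\<lambda>x. x\<^sup>2", symmetric]) simp
    also have "\<dots> \<le> L + C" by (rule II_square(2)[OF stepk_measurable L])
    finally show ?thesis using n[of i] sym unfolding energy_ok_def by (auto simp: pos_divide_le_eq)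
  qed
  have M: "L + C \<ge> 0" using L C_nonneg by simp
  obtain r where r: "strict_mono r"
    "\<And>k. near ((1/2) ^ k) (stepk (n (r k)) (a (r k))) (stepk (n (r (Suc k))) (a (r (Suc k))))"
    by (rule near_chain[where n = n and a = a, OF M ok]) auto
  define K where "K k = stepk (n (r k)) (a (r k))" for k
  have K: "K k \<in> kernels" for k unfolding K_def by (rule energy_ok_kernels[OF ok])
  obtain \<sigma> where s: "\<And>k. mp_bij (\<sigma> k)" "\<And>k. cut_dist (act (\<sigma> k) (K k)) (act (\<sigma> (Suc k)) (K (Suc k))) < (1/2) ^ k"
    by (rule cut_cauchy_representatives[of K, OF K]) (use r in \<open>auto simp: K_def\<close>)
  obtain k where k: "k \<in> kernels" "II k \<le> ennreal L" "\<And>r. cut_dist (act (\<sigma> r) (K r)) k \<le> 2 * (1/2) ^ r"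
  proof (rule cut_complete[of "\<lambda>r. act (\<sigma> r) (K r)" L])
    show "act (\<sigma> r) (K r) \<in> kernels" for r by (rule act_kernels[OF s(1) K])
    show "II (act (\<sigma> r) (K r)) \<le> ennreal L" for r using L(1) by (simp add: II_act[OF s(1) K]) (simp add: K_def)
  qed (use s L in auto)
  show thesis
  proof (rule that[OF k(1,2)])
    fix e :: real and i0 :: nat assume e: "e > 0"
    have "(\<lambda>r. 2 * (1/2::real) ^ r) \<longlonglongrightarrow> 2 * 0" by (intro tendsto_intros LIMSEQ_realpow_zero) auto
    then have "\<forall>\<^sub>F r in sequentially. 2 * (1/2::real) ^ r < e" using e by (intro order_tendstoD(2)) auto
    then have "\<forall>\<^sub>F r in sequentially. 2 * (1/2::real) ^ r < e \<and> r \<ge> i0"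
      by (intro eventually_conj eventually_ge_at_top)
    then obtain q where q: "2 * (1/2::real) ^ q < e" "q \<ge> i0"
      by (metis (mono_tags, lifting) eventually_happens sequentially_bot)
    have "near e (K q) k" unfolding near_def using s(1)[of q] k(3)[of q] q by (intro exI[of _ "\<sigma> q"]) auto
    then have "near e k (K q)" by (rule near_sym[OF K k(1)])
    moreover have "r q \<ge> i0" using seq_suble[OF r(1), of q] q by simp
    ultimately show "\<exists>i\<ge>i0. near e k (stepk (n i) (a i))" unfolding K_def by blast
  qed
qed

end

section \<open>The Cramer function\<close>

lemma abs_exp_minus_one_le: "\<bar>exp t - 1\<bar> \<le> \<bar>t\<bar> * exp \<bar>t\<bar>" for t :: real
proof (cases "t \<ge> 0")
  case True
  have "exp (- t) * exp t \<ge> (1 - t) * exp t"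
    using exp_ge_add_one_self[of "- t"] by (intro mult_right_mono) auto
  then have "exp t - 1 \<le> t * exp t" by (simp add: exp_minus_inverse algebra_simps)
  then show ?thesis using True by simp
next
  case False
  have "1 + t \<le> exp t" by (rule exp_ge_add_one_self)
  moreover have "exp t \<le> 1" using False by simp
  ultimately have "\<bar>exp t - 1\<bar> \<le> \<bar>t\<bar> * 1" using False by linarith
  also have "\<dots> \<le> \<bar>t\<bar> * exp \<bar>t\<bar>" by (intro mult_left_mono) auto
  finally show ?thesis .
qed

lemma ennreal_integral_le:
  fixes f :: "'a \<Rightarrow> real"
  assumes "integrable M f"
  shows "ennreal (\<integral>x. f x \<partial>M) \<le> (\<integral>\<^sup>+x. ennreal (f x) \<partial>M)"
proof -
  have "ennreal (\<integral>x. f x \<partial>M) \<le> ennreal (\<integral>x. max 0 (f x) \<partial>M)"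
    by (intro ennreal_leI integral_mono) (use assms in auto)
  also have "\<dots> = (\<integral>\<^sup>+x. ennreal (max 0 (f x)) \<partial>M)"
    by (rule nn_integral_eq_integral[symmetric]) (use assms in auto)
  also have "\<dots> = (\<integral>\<^sup>+x. ennreal (f x) \<partial>M)"
    by (intro nn_integral_cong) (auto simp: max_def ennreal_neg)
  finally show ?thesis .
qed

locale gauss_tail = prob_space \<mu> for \<mu> :: "real measure" +
  assumes sets_mu [measurable_cong, simp]: "sets \<mu> = sets borel"
    and gauss: "integrable \<mu> (\<lambda>x. exp (x\<^sup>2))"
begin

lemma space_mu [simp]: "space \<mu> = UNIV"
  using sets_eq_imp_space_eq[OF sets_mu] by simp

definition \<Lambda> :: "real \<Rightarrow> real" where "\<Lambda> \<theta> = ln (mgf \<mu> \<theta>)"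

text \<open>The Cramer function is nonnegative, as \<theta> = 0 contributes 0, so the passage to
  \<open>ennreal\<close> loses nothing.\<close>

definition hh :: "real \<Rightarrow> ennreal" where "hh y = e2ennreal (cramer \<mu> y)"

definition mean :: real where "mean = (\<integral>x. x \<partial>\<mu>)"

definition A0 :: real where "A0 = (\<integral>x. exp (x\<^sup>2) \<partial>\<mu>)"

lemma prob_UNIV [simp]: "prob UNIV = 1" using prob_space by simp

lemma exp_le_gauss: "exp (\<theta> * x) \<le> exp (\<theta>\<^sup>2 / 4) * exp (x\<^sup>2)" for \<theta> x :: real
proof -
  have "0 \<le> (\<theta> / 2 - x)\<^sup>2" by simp
  then have "\<theta> * x \<le> \<theta>\<^sup>2 / 4 + x\<^sup>2" by (simp add: power2_diff power_divide)
  then show ?thesis by (simp flip: exp_add)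
qed

lemma integrable_exp: "integrable \<mu> (\<lambda>x. exp (\<theta> * x))"
  by (rule Bochner_Integration.integrable_bound[where f = "\<lambda>x. exp (\<theta>\<^sup>2 / 4) * exp (x\<^sup>2)"])
     (use gauss exp_le_gauss in \<open>auto\<close>)

lemma integrable_exp_abs: "integrable \<mu> (\<lambda>x. exp (c * \<bar>x\<bar>))"
proof (rule Bochner_Integration.integrable_bound)
  show "integrable \<mu> (\<lambda>x. exp (c * x) + exp ((- c) * x))"
    by (intro Bochner_Integration.integrable_add integrable_exp)
  have "exp (c * \<bar>x\<bar>) \<le> exp (c * x) + exp ((- c) * x)" for x :: real
    by (cases "x \<ge> 0") auto
  then show "AE x in \<mu>. norm (exp (c * \<bar>x\<bar>)) \<le> norm (exp (c * x) + exp ((- c) * x))"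
    by (intro AE_I2) (simp add: add_nonneg_nonneg)
qed simp

lemma integrable_id: "integrable \<mu> (\<lambda>x. x)"
proof (rule Bochner_Integration.integrable_bound[OF integrable_exp_abs[of 1]])
  have "\<bar>x\<bar> \<le> exp (1 * \<bar>x\<bar>)" for x :: real using exp_ge_add_one_self[of "\<bar>x\<bar>"] unfolding mult_1 by linarith
  then show "AE x in \<mu>. norm x \<le> norm (exp (1 * \<bar>x\<bar>))" by (intro AE_I2) simp
qed simp

text \<open>Jensen's inequality, from \<open>1 + u \<le> exp u\<close> at
  \<open>u = \<theta> * (x - mean)\<close>.\<close>

lemma mgf_ge: "exp (\<theta> * mean) \<le> mgf \<mu> \<theta>"
proof -
  have "exp (\<theta> * mean) * (\<integral>x. 1 + \<theta> * (x - mean) \<partial>\<mu>) \<le> exp (\<theta> * mean) * (\<integral>x. exp (\<theta> * (x - mean)) \<partial>\<mu>)"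
  proof (intro mult_left_mono integral_mono)
    show "integrable \<mu> (\<lambda>x. 1 + \<theta> * (x - mean))" using integrable_id by simp
    have "(\<lambda>x. exp (\<theta> * (x - mean))) = (\<lambda>x. exp (\<theta> * x) * exp (- \<theta> * mean))"
      by (simp flip: exp_add add: right_diff_distrib)
    then show "integrable \<mu> (\<lambda>x. exp (\<theta> * (x - mean)))" using integrable_exp by simp
  qed (use exp_ge_add_one_self in auto)
  moreover have "(\<integral>x. 1 + \<theta> * (x - mean) \<partial>\<mu>) = 1"
    using integrable_id by (simp add: mean_def)
  moreover have "exp (\<theta> * mean) * (\<integral>x. exp (\<theta> * (x - mean)) \<partial>\<mu>) = mgf \<mu> \<theta>"
  proof -
    have "exp (\<theta> * mean) * (\<integral>x. exp (\<theta> * (x - mean)) \<partial>\<mu>) = (\<integral>x. exp (\<theta> * mean) * exp (\<theta> * (x - mean)) \<partial>\<mu>)" by simp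
    also have "\<dots> = mgf \<mu> \<theta>" unfolding mgf_def
      by (intro Bochner_Integration.integral_cong refl) (simp flip: exp_add add: right_diff_distrib)
    finally show ?thesis .
  qed
  ultimately show ?thesis by simp
qed

lemma mgf_pos [simp]: "mgf \<mu> \<theta> > 0"
  using mgf_ge[of \<theta>] exp_gt_zero[of "\<theta> * mean"] by linarith

lemma exp_Lambda: "exp (\<Lambda> \<theta>) = mgf \<mu> \<theta>" by (simp add: \<Lambda>_def)

lemma Lambda_ge: "\<theta> * mean \<le> \<Lambda> \<theta>"
  unfolding \<Lambda>_def using mgf_ge[of \<theta>] by (simp add: ln_ge_iff)

lemma Lambda_0 [simp]: "\<Lambda> 0 = 0" by (simp add: \<Lambda>_def mgf_def)

text \<open>Integration of \<open>exp_le_gauss\<close>. The quadratic majorant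
  \<open>\<theta>^2 / 4\<close> is what dualises to the growth \<open>y^2\<close> of the Cramer
  function, with loss \<open>ln A0\<close>.\<close>

lemma A0_pos: "A0 > 0" and Lambda_le: "\<Lambda> \<theta> \<le> \<theta>\<^sup>2 / 4 + ln A0" and A0_ge_1: "A0 \<ge> 1"
proof -
  have *: "mgf \<mu> \<theta> \<le> exp (\<theta>\<^sup>2 / 4) * A0" for \<theta>
    unfolding mgf_def A0_def
    using integral_mono[OF integrable_exp[of \<theta>] integrable_mult_right[OF gauss, of "exp (\<theta>\<^sup>2 / 4)"] exp_le_gauss] by simp
  show "A0 \<ge> 1" using *[of 0] by (simp add: mgf_def)
  then show "A0 > 0" by simp
  then have "\<Lambda> \<theta> \<le> ln (exp (\<theta>\<^sup>2 / 4) * A0)" unfolding \<Lambda>_def using * by (subst ln_le_cancel_iff) auto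
  then show "\<Lambda> \<theta> \<le> \<theta>\<^sup>2 / 4 + ln A0" using \<open>A0 > 0\<close> by (simp add: ln_mult)
qed

lemma mgf_half: "(mgf \<mu> (\<theta> / 2))\<^sup>2 \<le> mgf \<mu> \<theta>"
proof -
  let ?c = "mgf \<mu> (\<theta> / 2)"
  have e: "(exp (\<theta> / 2 * x) - ?c)\<^sup>2 = exp (\<theta> * x) - 2 * ?c * exp (\<theta> / 2 * x) + ?c\<^sup>2" for x
    by (simp add: power2_diff flip: exp_double)
  have "0 \<le> (\<integral>x. (exp (\<theta> / 2 * x) - ?c)\<^sup>2 \<partial>\<mu>)" by simp
  also have "\<dots> = mgf \<mu> \<theta> - 2 * ?c * ?c + ?c\<^sup>2"
    unfolding e using integrable_exp[of \<theta>] integrable_exp[of "\<theta> / 2"] by (simp add: mgf_def)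
  finally show ?thesis by (simp add: power2_eq_square)
qed

text \<open>Convexity between 0 and \<theta>, obtained from the nonnegative variance of
  \<open>exp (\<theta> / 2 * x)\<close>.\<close>

lemma Lambda_half: "2 * \<Lambda> (\<theta> / 2) \<le> \<Lambda> \<theta>"
proof -
  have "ln ((mgf \<mu> (\<theta> / 2))\<^sup>2) \<le> \<Lambda> \<theta>" unfolding \<Lambda>_def using mgf_half[of \<theta>] by (intro ln_mono) (auto simp: less_imp_neq[OF mgf_pos, symmetric])
  then show ?thesis by (simp add: \<Lambda>_def ln_realpow)
qed

section \<open>Semicontinuity, Jensen's inequality and growth of the Cramer function\<close>

lemma hh_lower: "ennreal (\<theta> * y - \<Lambda> \<theta>) \<le> hh y"
proof -
  have "ereal (\<theta> * y - \<Lambda> \<theta>) \<le> cramer \<mu> y"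
    unfolding cramer_def \<Lambda>_def by (rule SUP_upper) simp
  then have "e2ennreal (ereal (\<theta> * y - \<Lambda> \<theta>)) \<le> hh y" unfolding hh_def by (rule e2ennreal_mono)
  then show ?thesis by simp
qed

lemma hh_approx:
  assumes "u < hh y"
  obtains \<theta> where "u < ennreal (\<theta> * y - \<Lambda> \<theta>)"
proof -
  have "u \<noteq> \<top>" using assms by auto
  then obtain c where c: "u = ennreal c" "c \<ge> 0" by (cases u) auto
  have "ereal c < cramer \<mu> y"
  proof (rule ccontr)
    assume "\<not> ereal c < cramer \<mu> y"
    then have "hh y \<le> e2ennreal (ereal c)" unfolding hh_def by (intro e2ennreal_mono) simp
    then show False using assms c by simp
  qed
  then obtain \<theta> where "c < \<theta> * y - \<Lambda> \<theta>"
    unfolding cramer_def \<Lambda>_def by (auto simp: less_SUP_iff)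
  then show thesis using that c by (simp add: ennreal_less_iff)
qed

lemma hh_SUP: "hh y = (SUP \<theta>. ennreal (\<theta> * y - \<Lambda> \<theta>))"
proof (rule antisym)
  show "hh y \<le> (SUP \<theta>. ennreal (\<theta> * y - \<Lambda> \<theta>))"
  proof (rule ccontr)
    assume "\<not> hh y \<le> (SUP \<theta>. ennreal (\<theta> * y - \<Lambda> \<theta>))"
    then obtain \<theta> where "(SUP \<theta>. ennreal (\<theta> * y - \<Lambda> \<theta>)) < ennreal (\<theta> * y - \<Lambda> \<theta>)"
      using hh_approx[of "SUP \<theta>. ennreal (\<theta> * y - \<Lambda> \<theta>)" y] by (auto simp: not_le)
    moreover have "ennreal (\<theta> * y - \<Lambda> \<theta>) \<le> (SUP \<theta>. ennreal (\<theta> * y - \<Lambda> \<theta>))"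
      by (rule SUP_upper) simp
    ultimately show False by simp
  qed
qed (auto intro: SUP_least hh_lower)

lemma hh_open: "open {y. u < hh y}"
proof -
  have "{y. u < hh y} = (\<Union>\<theta>. (\<lambda>y. ennreal (\<theta> * y - \<Lambda> \<theta>)) -` {u<..})"
    unfolding hh_SUP less_SUP_iff by auto
  moreover have "open ((\<lambda>y. ennreal (\<theta> * y - \<Lambda> \<theta>)) -` {u<..})" for \<theta>
    by (rule open_vimage) (auto intro!: continuous_on_ennreal continuous_intros)
  ultimately show ?thesis by auto
qed

lemma hh_borel: "hh \<in> borel_measurable borel"
  by (rule borel_measurableI_greater) (use hh_open in simp)

lemma hh_lower_semi:
  assumes "r \<longlonglongrightarrow> y"
  shows "hh y \<le> liminf (\<lambda>j. hh (r j))"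
  unfolding le_Liminf_iff
proof (intro allI impI)
  fix u assume "u < hh y"
  then have "\<forall>\<^sub>F x in nhds y. x \<in> {y. u < hh y}"
    using hh_open by (intro eventually_nhds_in_open) auto
  then have "\<forall>\<^sub>F j in sequentially. r j \<in> {y. u < hh y}" using assms unfolding filterlim_iff by blast
  then show "\<forall>\<^sub>F j in sequentially. u < hh (r j)" by simp
qed

text \<open>Each affine minorant can be averaged exactly, and the supremum over \<theta> is taken at
  the end. Negative values are cut off by \<open>ennreal\<close>, whence
  \<open>ennreal_integral_le\<close>.\<close>

lemma hh_Jensen_cell:
  assumes k: "integrable usq k" and ij: "i < n" "j < n"
  shows "hh (avg n k i j) * ennreal (1 / (real n)\<^sup>2) \<le> (\<integral>\<^sup>+p. hh (k p) * indicator (cellsq n i j) p \<partial>usq)"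
proof -
  have "ennreal (\<theta> * avg n k i j - \<Lambda> \<theta>) * ennreal (1 / (real n)\<^sup>2) \<le> (\<integral>\<^sup>+p. hh (k p) * indicator (cellsq n i j) p \<partial>usq)" for \<theta>
  proof -
    have n: "n > 0" using ij by simp
    have i1: "integrable usq (\<lambda>p. (\<theta> * k p - \<Lambda> \<theta>) * indicator (cellsq n i j) p)"
      by (rule integrable_mult_indicator_usq) (use k in auto)
    have "avg n (\<lambda>p. \<theta> * k p - \<Lambda> \<theta>) i j = \<theta> * avg n k i j - \<Lambda> \<theta>"
      using avg_diff[of "\<lambda>p. \<theta> * k p" "\<lambda>_. \<Lambda> \<theta>" n i j] k by (simp add: avg_cmult avg_const[OF ij])
    then have e: "(\<theta> * avg n k i j - \<Lambda> \<theta>) * (1 / (real n)\<^sup>2) = (\<integral>p. (\<theta> * k p - \<Lambda> \<theta>) * indicator (cellsq n i j) p \<partial>usq)"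
      using n unfolding avg_def by (simp add: field_simps)
    have "ennreal (\<theta> * avg n k i j - \<Lambda> \<theta>) * ennreal (1 / (real n)\<^sup>2) = ennreal ((\<theta> * avg n k i j - \<Lambda> \<theta>) * (1 / (real n)\<^sup>2))"
      by (rule ennreal_mult''[symmetric]) simp
    also have "\<dots> \<le> (\<integral>\<^sup>+p. ennreal ((\<theta> * k p - \<Lambda> \<theta>) * indicator (cellsq n i j) p) \<partial>usq)"
      unfolding e by (rule ennreal_integral_le[OF i1])
    also have "\<dots> \<le> (\<integral>\<^sup>+p. hh (k p) * indicator (cellsq n i j) p \<partial>usq)"
      by (intro nn_integral_mono) (auto simp: indicator_def hh_lower)
    finally show ?thesis .
  qed
  then show ?thesis unfolding hh_SUP[of "avg n k i j"] SUP_mult_right_ennreal by (intro SUP_least) auto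
qed

text \<open>\<theta> = 2 y maximises \<open>\<theta> * y - \<theta>^2 / 4\<close>, the dual of the
  majorant in \<open>Lambda_le\<close>, with value \<open>y^2\<close>.\<close>

lemma hh_ge_square: "ennreal (y\<^sup>2) \<le> hh y + ennreal (ln A0)"
proof -
  let ?v = "2 * y * y - \<Lambda> (2 * y)"
  have "y\<^sup>2 \<le> ?v + ln A0" using Lambda_le[of "2 * y"] by (simp add: power2_eq_square)
  then have "ennreal (y\<^sup>2) \<le> ennreal (max 0 ?v + ln A0)" by (intro ennreal_leI) simp
  also have "\<dots> = ennreal (max 0 ?v) + ennreal (ln A0)"
    using A0_ge_1 by (intro ennreal_plus) auto
  also have "ennreal (max 0 ?v) = ennreal ?v" by (auto simp: max_def ennreal_neg)
  also have "ennreal ?v + ennreal (ln A0) \<le> hh y + ennreal (ln A0)" by (intro add_right_mono hh_lower)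
  finally show ?thesis .
qed

sublocale rate_fun hh "ln A0"
  by standard (auto intro: hh_borel hh_Jensen_cell hh_lower_semi hh_ge_square simp: A0_ge_1)

text \<open>The hypothesis puts \<open>b\<close> between \<open>a\<close> and the mean. A \<theta>
  pointing from \<open>b\<close> to \<open>a\<close> has a larger value at \<open>a\<close>; any
  other points to the mean, and there \<open>Lambda_ge\<close> makes the value at \<open>b\<close>
  nonpositive.\<close>

lemma hh_toward_mean:
  assumes "(a - b) * (mean - b) \<le> 0"
  shows "hh b \<le> hh a"
  unfolding hh_SUP[of b]
proof (rule SUP_least)
  fix \<theta>
  show "ennreal (\<theta> * b - \<Lambda> \<theta>) \<le> hh a"
  proof (cases "\<theta> * (a - b) \<ge> 0")
    case True
    then have "\<theta> * b - \<Lambda> \<theta> \<le> \<theta> * a - \<Lambda> \<theta>" by (simp add: right_diff_distrib)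
    then show ?thesis using hh_lower[of \<theta> a] ennreal_leI order.trans by blast
  next
    case False
    then have "\<theta> * (mean - b) \<ge> 0" using assms by (auto simp: mult_le_0_iff zero_le_mult_iff)
    then have "\<theta> * b - \<Lambda> \<theta> \<le> 0" using Lambda_ge[of \<theta>] by (simp add: right_diff_distrib)
    then show ?thesis by (simp add: ennreal_neg)
  qed
qed

section \<open>Exponential tilting\<close>

lemma mgf_differentiable: "(mgf \<mu> has_real_derivative (\<integral>x. x * exp (\<theta> * x) \<partial>\<mu>)) (at \<theta>)"
  unfolding DERIV_def LIMSEQ_SEQ_conv[symmetric]
proof (intro allI impI)
  fix s :: "nat \<Rightarrow> real" assume "(\<forall>n. s n \<noteq> 0) \<and> s \<longlonglongrightarrow> 0"
  then have s: "\<And>n. s n \<noteq> 0" "s \<longlonglongrightarrow> 0" by auto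
  obtain B where B: "B > 0" "\<And>n. \<bar>s n\<bar> \<le> B"
    using convergent_imp_Bseq[of s] s(2) unfolding Bseq_def convergent_def by auto
  let ?f = "\<lambda>n x. (exp ((\<theta> + s n) * x) - exp (\<theta> * x)) / s n"
  have "(\<lambda>n. \<integral>x. ?f n x \<partial>\<mu>) \<longlonglongrightarrow> (\<integral>x. x * exp (\<theta> * x) \<partial>\<mu>)"
  proof (rule integral_dominated_convergence[where w = "\<lambda>x. exp ((1 + B + \<bar>\<theta>\<bar>) * \<bar>x\<bar>)"])
    show "integrable \<mu> (\<lambda>x. exp ((1 + B + \<bar>\<theta>\<bar>) * \<bar>x\<bar>))" by (rule integrable_exp_abs)
    show "AE x in \<mu>. (\<lambda>n. ?f n x) \<longlonglongrightarrow> x * exp (\<theta> * x)"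
    proof (rule AE_I2)
      fix x
      have "((\<lambda>t. exp (t * x)) has_real_derivative x * exp (\<theta> * x)) (at \<theta>)"
        by (auto intro!: derivative_eq_intros)
      then show "(\<lambda>n. ?f n x) \<longlonglongrightarrow> x * exp (\<theta> * x)"
        unfolding DERIV_def LIMSEQ_SEQ_conv[symmetric] using s by blast
    qed
    show "AE x in \<mu>. norm (?f n x) \<le> exp ((1 + B + \<bar>\<theta>\<bar>) * \<bar>x\<bar>)" for n
    proof (rule AE_I2)
      fix x
      have "?f n x = exp (\<theta> * x) * ((exp (s n * x) - 1) / s n)"
        by (simp add: distrib_right exp_add right_diff_distrib)
      then have "\<bar>?f n x\<bar> = exp (\<theta> * x) * (\<bar>exp (s n * x) - 1\<bar> / \<bar>s n\<bar>)"
        by (simp only: abs_mult abs_divide abs_exp_cancel)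
      also have "\<dots> \<le> exp (\<theta> * x) * ((\<bar>s n * x\<bar> * exp \<bar>s n * x\<bar>) / \<bar>s n\<bar>)"
        by (intro mult_left_mono divide_right_mono abs_exp_minus_one_le) auto
      also have "\<dots> = exp (\<theta> * x) * (\<bar>x\<bar> * exp (\<bar>s n\<bar> * \<bar>x\<bar>))" using s(1)[of n] by (simp add: abs_mult)
      also have "\<dots> \<le> exp (\<bar>\<theta>\<bar> * \<bar>x\<bar>) * (exp \<bar>x\<bar> * exp (B * \<bar>x\<bar>))"
      proof (intro mult_mono)
        show "exp (\<theta> * x) \<le> exp (\<bar>\<theta>\<bar> * \<bar>x\<bar>)" using abs_ge_self[of "\<theta> * x"] by (simp add: abs_mult)
        show "\<bar>x\<bar> \<le> exp \<bar>x\<bar>" using exp_ge_add_one_self[of "\<bar>x\<bar>"] by linarith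
        show "exp (\<bar>s n\<bar> * \<bar>x\<bar>) \<le> exp (B * \<bar>x\<bar>)" using B(2)[of n] by (simp add: mult_right_mono)
      qed auto
      also have "\<dots> = exp ((1 + B + \<bar>\<theta>\<bar>) * \<bar>x\<bar>)" by (simp add: distrib_right exp_add)
      finally show "norm (?f n x) \<le> exp ((1 + B + \<bar>\<theta>\<bar>) * \<bar>x\<bar>)" by simp
    qed
  qed auto
  moreover have "(\<integral>x. ?f n x \<partial>\<mu>) = (mgf \<mu> (\<theta> + s n) - mgf \<mu> \<theta>) / s n" for n
    using integrable_exp by (simp add: mgf_def)
  ultimately show "(\<lambda>n. (mgf \<mu> (\<theta> + s n) - mgf \<mu> \<theta>) / s n) \<longlonglongrightarrow> (\<integral>x. x * exp (\<theta> * x) \<partial>\<mu>)"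
    by (simp only:)
qed

text \<open>Says that \<open>b\<close> is the mean of \<open>\<mu>\<close> tilted by \<open>exp (\<theta> x)\<close>.\<close>

definition tilt_at :: "real \<Rightarrow> real \<Rightarrow> bool" where
  "tilt_at b \<theta> \<longleftrightarrow> ((\<lambda>s. mgf \<mu> (\<theta> + s) * exp (- (s * b))) has_real_derivative 0) (at 0)"

text \<open>Up to the constant factor \<open>exp (\<theta> * b)\<close> the function in
  \<open>tilt_at\<close> is the minimised one shifted to 0, so this is the first-order
  condition.\<close>

lemma tilt_at_minimum:
  assumes min: "\<And>t. mgf \<mu> \<theta> * exp (- (\<theta> * b)) \<le> mgf \<mu> t * exp (- (t * b))"
  shows "tilt_at b \<theta>"
proof -
  let ?g = "\<lambda>s. mgf \<mu> (\<theta> + s) * exp (- (s * b))"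
  have sh: "((\<lambda>s. mgf \<mu> (\<theta> + s)) has_real_derivative (\<integral>x. x * exp (\<theta> * x) \<partial>\<mu>)) (at 0)"
    using DERIV_shift[of "mgf \<mu>" "\<integral>x. x * exp (\<theta> * x) \<partial>\<mu>" 0 \<theta>] mgf_differentiable[of \<theta>]
    by (simp add: add.commute)
  have "\<exists>D. (?g has_real_derivative D) (at 0)"
    by (rule exI, rule DERIV_mult[OF sh]) (auto intro!: derivative_eq_intros)
  then obtain D where D: "(?g has_real_derivative D) (at 0)" by blast
  have "?g 0 \<le> ?g s" for s
  proof -
    have e: "exp (- ((\<theta> + s) * b)) = exp (- (\<theta> * b)) * exp (- (s * b))" by (simp flip: exp_add add: distrib_right)
    have "mgf \<mu> \<theta> * exp (- (\<theta> * b)) \<le> ?g s * exp (- (\<theta> * b))"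
      using min[of "\<theta> + s"] unfolding e by (simp add: mult_ac)
    then show ?thesis by simp
  qed
  then have "D = 0" by (intro DERIV_local_min[OF D, of 1]) auto
  then show ?thesis using D by (simp add: tilt_at_def)
qed

text \<open>The function \<open>mgf \<mu> t * exp (- (t * b))\<close> is minimised; only coercivity
  is at stake. Its value at 0 is 1. For t on the side of \<open>a\<close>, finiteness of the Cramer
  function at \<open>a\<close>, strictly beyond \<open>b\<close>, keeps it at least 1 once |t|
  exceeds \<open>H / \<bar>a - b\<bar>\<close>; on the side of the mean \<open>Lambda_ge\<close>
  does. A minimum of a continuous function over a compact interval remains.\<close>

lemma tilt_exists:
  assumes "b = mean \<or> a \<noteq> b \<and> (a - b) * (mean - b) \<le> 0 \<and> hh a < \<top>"
  shows "\<exists>\<theta>. tilt_at b \<theta>"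
proof (cases "b = mean")
  case True
  have "tilt_at b 0"
  proof (rule tilt_at_minimum)
    fix t
    have "1 \<le> mgf \<mu> t * exp (- (t * mean))"
      using mult_right_mono[OF mgf_ge[of t], of "exp (- (t * mean))"] by (simp flip: exp_add)
    then show "mgf \<mu> 0 * exp (- (0 * b)) \<le> mgf \<mu> t * exp (- (t * b))" using True by (simp add: mgf_def)
  qed
  then show ?thesis by blast
next
  case False
  then have a: "a \<noteq> b" "(a - b) * (mean - b) \<le> 0" "hh a < \<top>" using assms by auto
  then obtain H where H: "hh a = ennreal H" "H \<ge> 0" by (cases "hh a") auto
  let ?\<psi> = "\<lambda>t. mgf \<mu> t * exp (- (t * b))"
  define K where "K = H / \<bar>a - b\<bar>"
  have K: "K \<ge> 0" using H by (simp add: K_def)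
  have big: "1 \<le> ?\<psi> t" if t: "\<bar>t\<bar> > K" for t
  proof -
    have "t * b \<le> \<Lambda> t"
    proof (cases "t * (a - b) \<ge> 0")
      case True
      have "ennreal (t * a - \<Lambda> t) \<le> ennreal H" using hh_lower[of t a] H by simp
      then have "t * a - \<Lambda> t \<le> H" using H by (simp add: ennreal_le_iff)
      moreover have "H \<le> t * (a - b)"
      proof -
        have "H \<le> \<bar>t\<bar> * \<bar>a - b\<bar>" using t a(1) by (simp add: K_def pos_divide_less_eq less_imp_le)
        then show ?thesis using True by (simp add: abs_mult[symmetric])
      qed
      ultimately show ?thesis by (simp add: right_diff_distrib)
    next
      case False
      then have "t * (mean - b) \<ge> 0" using a by (auto simp: mult_le_0_iff zero_le_mult_iff)
      then show ?thesis using Lambda_ge[of t] by (simp add: right_diff_distrib)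
    qed
    then have "1 \<le> exp (\<Lambda> t) * exp (- (t * b))" by (simp flip: exp_add)
    then show ?thesis by (simp add: exp_Lambda)
  qed
  have "continuous_on {- K..K} ?\<psi>"
  proof (intro continuous_intros continuous_at_imp_continuous_on ballI)
    show "isCont (mgf \<mu>) x" for x using mgf_differentiable by (rule DERIV_isCont)
  qed
  then obtain \<theta> where th: "\<theta> \<in> {- K..K}" "\<And>t. t \<in> {- K..K} \<Longrightarrow> ?\<psi> \<theta> \<le> ?\<psi> t"
    using continuous_attains_inf[of "{- K..K}" ?\<psi>] K by auto
  have "?\<psi> \<theta> \<le> ?\<psi> t" for t
  proof (cases "t \<in> {- K..K}")
    case True then show ?thesis by (rule th(2))
  next
    case False
    then have "1 \<le> ?\<psi> t" by (intro big) auto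
    moreover have "?\<psi> \<theta> \<le> ?\<psi> 0" using K by (intro th(2)) auto
    ultimately show ?thesis by (simp add: mgf_def)
  qed
  then show ?thesis using tilt_at_minimum by blast
qed

end

section \<open>The upper bound\<close>

lemma finite_upper_idx [simp]: "finite (upper_idx n)"
  by (rule finite_subset[of _ "{..<n} \<times> {..<n}"]) (auto simp: upper_idx_def)

lemma card_upper_idx: "card (upper_idx n) \<le> n\<^sup>2"
proof -
  have "card (upper_idx n) \<le> card ({..<n} \<times> {..<n})" by (rule card_mono) (auto simp: upper_idx_def)
  then show ?thesis by (simp add: power2_eq_square)
qed

lemma symm_index: "i < n \<Longrightarrow> j < n \<Longrightarrow> (min i j, max i j) \<in> upper_idx n"
  by (auto simp: upper_idx_def)

lemma sum_upper_idx:
  fixes F :: "nat \<Rightarrow> nat \<Rightarrow> real"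
  assumes "\<And>i j. i < n \<Longrightarrow> j < n \<Longrightarrow> F i j = F j i"
  shows "(\<Sum>i<n. \<Sum>j<n. F i j) = (\<Sum>p\<in>upper_idx n. (if fst p < snd p then 2 else 1) * F (fst p) (snd p))"
proof -
  let ?U = "{p \<in> {..<n} \<times> {..<n}. fst p < snd p}" and ?D = "{p \<in> {..<n} \<times> {..<n}. fst p = snd p}"
    and ?V = "{p \<in> {..<n} \<times> {..<n}. snd p < fst p}"
  let ?f = "\<lambda>p. F (fst p) (snd p)"
  have fin: "finite ?U" "finite ?D" "finite ?V" by auto
  have "(\<Sum>i<n. \<Sum>j<n. F i j) = sum ?f ({..<n} \<times> {..<n})" by (simp add: sum.cartesian_product split_def)
  also have "{..<n} \<times> {..<n} = ?U \<union> (?D \<union> ?V)" by auto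
  also have "sum ?f (?U \<union> (?D \<union> ?V)) = sum ?f ?U + (sum ?f ?D + sum ?f ?V)"
    using fin by (subst sum.union_disjoint, simp, simp, force, subst sum.union_disjoint) auto
  also have "sum ?f ?V = sum ?f ?U"
    by (rule sum.reindex_bij_witness[of _ prod.swap prod.swap]) (use assms in auto)
  finally have "(\<Sum>i<n. \<Sum>j<n. F i j) = (\<Sum>p\<in>?U. 2 * ?f p) + sum ?f ?D" by (simp add: sum_distrib_left[symmetric])
  moreover have "(\<Sum>p\<in>upper_idx n. (if fst p < snd p then 2 else 1) * ?f p) =
     (\<Sum>p\<in>?U. (if fst p < snd p then 2 else 1) * ?f p) + (\<Sum>p\<in>?D. (if fst p < snd p then 2 else 1) * ?f p)"
    by (subst sum.union_disjoint[symmetric]) (auto simp: upper_idx_def intro!: sum.cong)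
  ultimately show ?thesis by simp
qed

lemma symm_upper: "p \<in> upper_idx n \<Longrightarrow> symm X (fst p) (snd p) = X p"
  by (auto simp: upper_idx_def symm_def)

context gauss_tail
begin

section \<open>Exponential bounds under the product law\<close>

abbreviation PP :: "nat \<Rightarrow> (nat \<times> nat \<Rightarrow> real) measure" where
  "PP n \<equiv> PiM (upper_idx n) (\<lambda>_. \<mu>)"

lemma prob_space_PP: "prob_space (PP n)"
  by (rule prob_space_PiM) (rule prob_space_axioms)

lemma PP_component_measurable [measurable]:
  "p \<in> upper_idx n \<Longrightarrow> (\<lambda>X. X p) \<in> borel_measurable (PP n)"
  using measurable_component_singleton[of p "upper_idx n" "\<lambda>_. \<mu>"]
  by (simp add: measurable_cong_sets[OF refl sets_mu])

lemma nn_integral_PP_prod: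
  assumes "\<And>p. p \<in> upper_idx n \<Longrightarrow> f p \<in> borel_measurable borel"
  shows "(\<integral>\<^sup>+X. (\<Prod>p\<in>upper_idx n. f p (X p)) \<partial>PP n) = (\<Prod>p\<in>upper_idx n. \<integral>\<^sup>+x. f p x \<partial>\<mu>)"
proof -
  interpret product_sigma_finite "\<lambda>_ :: nat \<times> nat. \<mu>"
    by standard
  show ?thesis by (rule product_nn_integral_prod) (simp_all add: measurable_cong_sets[OF sets_mu refl] assms)
qed

lemma nn_integral_exp_mu: "(\<integral>\<^sup>+x. ennreal (exp (\<theta> * x)) \<partial>\<mu>) = ennreal (exp (\<Lambda> \<theta>))"
  unfolding exp_Lambda mgf_def by (rule nn_integral_eq_integral[OF integrable_exp]) simp

lemma nn_integral_exp_PP: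
  "(\<integral>\<^sup>+X. ennreal (exp (\<Sum>p\<in>upper_idx n. c p * X p)) \<partial>PP n) = ennreal (exp (\<Sum>p\<in>upper_idx n. \<Lambda> (c p)))"
proof -
  have "(\<integral>\<^sup>+X. ennreal (exp (\<Sum>p\<in>upper_idx n. c p * X p)) \<partial>PP n)
      = (\<integral>\<^sup>+X. (\<Prod>p\<in>upper_idx n. ennreal (exp (c p * X p))) \<partial>PP n)"
    by (simp add: exp_sum prod_ennreal)
  also have "\<dots> = (\<Prod>p\<in>upper_idx n. \<integral>\<^sup>+x. ennreal (exp (c p * x)) \<partial>\<mu>)"
    by (rule nn_integral_PP_prod[where f = "\<lambda>p x. ennreal (exp (c p * x))"]) simp
  also have "\<dots> = ennreal (exp (\<Sum>p\<in>upper_idx n. \<Lambda> (c p)))"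
    by (simp add: nn_integral_exp_mu exp_sum prod_ennreal)
  finally show ?thesis .
qed

lemma exp_Markov:
  assumes W: "W \<in> borel_measurable (PP n)" and int: "(\<integral>\<^sup>+X. ennreal (exp (W X)) \<partial>PP n) \<le> ennreal (exp b)"
  shows "measure (PP n) {X \<in> space (PP n). s \<le> W X} \<le> exp (b - s)"
proof -
  interpret P: prob_space "PP n" by (rule prob_space_PP)
  note W[measurable]
  let ?A = "{X \<in> space (PP n). s \<le> W X}"
  have "emeasure (PP n) ?A = (\<integral>\<^sup>+X. indicator ?A X \<partial>PP n)" by simp
  also have "\<dots> \<le> (\<integral>\<^sup>+X. ennreal (exp (- s)) * ennreal (exp (W X)) \<partial>PP n)"
  proof (intro nn_integral_mono)
    fix X
    show "indicator ?A X \<le> ennreal (exp (- s)) * ennreal (exp (W X))"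
    proof (cases "X \<in> ?A")
      case True
      then have "1 \<le> exp (- s) * exp (W X)" by (simp flip: exp_add)
      then have "ennreal 1 \<le> ennreal (exp (- s) * exp (W X))" by (rule ennreal_leI)
      then show ?thesis using True by (simp add: ennreal_mult)
    qed simp
  qed
  also have "\<dots> = ennreal (exp (- s)) * (\<integral>\<^sup>+X. ennreal (exp (W X)) \<partial>PP n)" by (rule nn_integral_cmult) simp
  also have "\<dots> \<le> ennreal (exp (- s)) * ennreal (exp b)" by (intro mult_left_mono int) simp
  also have "\<dots> = ennreal (exp (b - s))" by (simp add: ennreal_mult[symmetric] flip: exp_add)
  finally show ?thesis by (simp add: P.emeasure_eq_measure ennreal_le_iff)
qed

lemma chernoff:
  "measure (PP n) {X \<in> space (PP n). s \<le> (\<Sum>p\<in>upper_idx n. c p * X p)} \<le> exp ((\<Sum>p\<in>upper_idx n. \<Lambda> (c p)) - s)"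
  by (rule exp_Markov) (auto simp: nn_integral_exp_PP)

text \<open>A diagonal entry occurs only once in the double sum; convexity, in the form of \<open>Lambda_half\<close>, absorbs the resulting factor 1/2.\<close>

lemma chernoff_symmetric:
  assumes sym: "\<And>i j. i < n \<Longrightarrow> j < n \<Longrightarrow> \<kappa> i j = \<kappa> j i"
  shows "{X \<in> space (PP n). s \<le> (\<Sum>i<n. \<Sum>j<n. \<kappa> i j * symm X i j) / 2} \<in> sets (PP n)" (is "?H \<in> _")
    and "measure (PP n) {X \<in> space (PP n). s \<le> (\<Sum>i<n. \<Sum>j<n. \<kappa> i j * symm X i j) / 2} \<le> exp ((\<Sum>i<n. \<Sum>j<n. \<Lambda> (\<kappa> i j)) / 2 - s)"
proof -
  define c where "c p = (if fst p < snd p then \<kappa> (fst p) (snd p) else \<kappa> (fst p) (snd p) / 2)" for p :: "nat \<times> nat"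
  have eq: "(\<Sum>i<n. \<Sum>j<n. \<kappa> i j * symm X i j) / 2 = (\<Sum>p\<in>upper_idx n. c p * X p)" for X
  proof -
    have "(\<Sum>i<n. \<Sum>j<n. \<kappa> i j * symm X i j) = (\<Sum>p\<in>upper_idx n. (if fst p < snd p then 2 else 1) * (\<kappa> (fst p) (snd p) * symm X (fst p) (snd p)))"
      by (rule sum_upper_idx) (use sym symm_sym in auto)
    also have "\<dots> = (\<Sum>p\<in>upper_idx n. 2 * (c p * X p))"
      by (intro sum.cong refl) (simp add: symm_upper c_def)
    finally show ?thesis by (simp add: sum_distrib_left[symmetric])
  qed
  show "?H \<in> sets (PP n)" unfolding eq by measurable
  have "measure (PP n) ?H \<le> exp ((\<Sum>p\<in>upper_idx n. \<Lambda> (c p)) - s)"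
    unfolding eq by (rule chernoff)
  also have "\<dots> \<le> exp ((\<Sum>i<n. \<Sum>j<n. \<Lambda> (\<kappa> i j)) / 2 - s)"
  proof -
    have "(\<Sum>p\<in>upper_idx n. 2 * \<Lambda> (c p)) \<le> (\<Sum>p\<in>upper_idx n. (if fst p < snd p then 2 else 1) * \<Lambda> (\<kappa> (fst p) (snd p)))"
      by (intro sum_mono) (use Lambda_half in \<open>auto simp: c_def\<close>)
    also have "\<dots> = (\<Sum>i<n. \<Sum>j<n. \<Lambda> (\<kappa> i j))" by (rule sum_upper_idx[symmetric]) (use sym in auto)
    finally show ?thesis by (simp add: sum_distrib_left[symmetric])
  qed
  finally show "measure (PP n) ?H \<le> exp ((\<Sum>i<n. \<Sum>j<n. \<Lambda> (\<kappa> i j)) / 2 - s)" .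
qed

text \<open>Off-diagonal squares are counted twice in the energy, so it is at most twice the sum
  over the independent entries, hence \<open>M / 2\<close>; each entry has Gaussian moment
  \<open>A0 \<ge> 1\<close>, and there are at most n^2 of them.\<close>

lemma energy_tail:
  shows "{X \<in> space (PP n). M * (real n)\<^sup>2 \<le> (\<Sum>i<n. \<Sum>j<n. (symm X i j)\<^sup>2)} \<in> sets (PP n)" (is "?H \<in> _")
    and "measure (PP n) {X \<in> space (PP n). M * (real n)\<^sup>2 \<le> (\<Sum>i<n. \<Sum>j<n. (symm X i j)\<^sup>2)} \<le> exp ((real n)\<^sup>2 * (ln A0 - M / 2))"
proof -
  let ?W = "\<lambda>X. \<Sum>p\<in>upper_idx n. (X p)\<^sup>2"
  have eq: "(\<Sum>i<n. \<Sum>j<n. (symm X i j)\<^sup>2) = (\<Sum>p\<in>upper_idx n. (if fst p < snd p then 2 else 1) * (X p)\<^sup>2)" for X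
    by (subst sum_upper_idx) (auto simp: symm_sym symm_upper intro!: sum.cong)
  show "?H \<in> sets (PP n)" unfolding eq by measurable
  have le: "(\<Sum>i<n. \<Sum>j<n. (symm X i j)\<^sup>2) \<le> 2 * ?W X" for X
    unfolding eq sum_distrib_left by (intro sum_mono) auto
  have int: "(\<integral>\<^sup>+X. ennreal (exp (?W X)) \<partial>PP n) \<le> ennreal (exp ((real n)\<^sup>2 * ln A0))"
  proof -
    have "(\<integral>\<^sup>+X. ennreal (exp (?W X)) \<partial>PP n) = (\<integral>\<^sup>+X. (\<Prod>p\<in>upper_idx n. ennreal (exp ((X p)\<^sup>2))) \<partial>PP n)"
      by (simp add: exp_sum prod_ennreal)
    also have "\<dots> = (\<Prod>p\<in>upper_idx n. \<integral>\<^sup>+x. ennreal (exp (x\<^sup>2)) \<partial>\<mu>)"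
      by (rule nn_integral_PP_prod[where f = "\<lambda>p x. ennreal (exp (x\<^sup>2))"]) simp
    also have "(\<integral>\<^sup>+x. ennreal (exp (x\<^sup>2)) \<partial>\<mu>) = ennreal A0"
      unfolding A0_def by (rule nn_integral_eq_integral[OF gauss]) simp
    also have "(\<Prod>p\<in>upper_idx n. ennreal A0) = ennreal (A0 ^ card (upper_idx n))"
      using A0_pos by (simp add: ennreal_power)
    also have "\<dots> \<le> ennreal (A0 ^ (n\<^sup>2))"
      by (intro ennreal_leI power_increasing card_upper_idx A0_ge_1)
    also have "A0 ^ (n\<^sup>2) = exp ((real n)\<^sup>2 * ln A0)"
      using A0_pos exp_of_nat_mult[of "n\<^sup>2" "ln A0"] by simp
    finally show ?thesis .
  qed
  interpret P: prob_space "PP n" by (rule prob_space_PP)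
  have "measure (PP n) ?H \<le> measure (PP n) {X \<in> space (PP n). M * (real n)\<^sup>2 / 2 \<le> ?W X}"
  proof (rule P.finite_measure_mono)
    show "?H \<subseteq> {X \<in> space (PP n). M * (real n)\<^sup>2 / 2 \<le> ?W X}"
    proof
      fix X assume "X \<in> ?H"
      then show "X \<in> {X \<in> space (PP n). M * (real n)\<^sup>2 / 2 \<le> ?W X}"
        using le[of X] by simp
    qed
  qed measurable
  also have "\<dots> \<le> exp ((real n)\<^sup>2 * ln A0 - M * (real n)\<^sup>2 / 2)"
    by (rule exp_Markov[OF _ int]) measurable
  also have "\<dots> = exp ((real n)\<^sup>2 * (ln A0 - M / 2))" by (simp add: algebra_simps)
  finally show "measure (PP n) ?H \<le> exp ((real n)\<^sup>2 * (ln A0 - M / 2))" .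
qed

text \<open>By \<open>Lambda_ge\<close> a \<theta> with positive value at \<open>y\<close> has the
  sign of \<open>y - mean\<close>, so restricting to such \<theta> and 0 does not lower the
  supremum. A common index for all \<open>y\<close> lets finite sums over cells pass to the limit
  even where the Cramer function is infinite.\<close>

lemma hh_signed_sequence:
  obtains \<theta> :: "nat \<Rightarrow> real \<Rightarrow> real"
  where "\<And>N y. \<theta> N y * y - \<Lambda> (\<theta> N y) \<ge> 0" "\<And>N y. \<theta> N y = 0 \<or> \<theta> N y * (y - mean) > 0"
    "\<And>y. (\<lambda>N. ennreal (\<theta> N y * y - \<Lambda> (\<theta> N y))) \<longlonglongrightarrow> hh y"
proof -
  have "\<exists>\<theta>. (\<forall>N :: nat. \<theta> N * y - \<Lambda> (\<theta> N) \<ge> 0 \<and> (\<theta> N = 0 \<or> \<theta> N * (y - mean) > 0)) \<and>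
     (\<lambda>N. ennreal (\<theta> N * y - \<Lambda> (\<theta> N))) \<longlonglongrightarrow> hh y" for y
  proof -
    define T where "T = {\<theta>. \<theta> * y - \<Lambda> \<theta> \<ge> 0 \<and> (\<theta> = 0 \<or> \<theta> * (y - mean) > 0)}"
    have T0: "0 \<in> T" by (simp add: T_def)
    have S: "(SUP \<theta>\<in>T. ennreal (\<theta> * y - \<Lambda> \<theta>)) = hh y"
    proof (rule antisym)
      show "(SUP \<theta>\<in>T. ennreal (\<theta> * y - \<Lambda> \<theta>)) \<le> hh y" by (intro SUP_least hh_lower)
      show "hh y \<le> (SUP \<theta>\<in>T. ennreal (\<theta> * y - \<Lambda> \<theta>))"
      proof (rule ccontr)
        assume "\<not> hh y \<le> (SUP \<theta>\<in>T. ennreal (\<theta> * y - \<Lambda> \<theta>))"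
        then have "(SUP \<theta>\<in>T. ennreal (\<theta> * y - \<Lambda> \<theta>)) < hh y" by simp
        then obtain \<theta> where t: "(SUP \<theta>\<in>T. ennreal (\<theta> * y - \<Lambda> \<theta>)) < ennreal (\<theta> * y - \<Lambda> \<theta>)"
          by (rule hh_approx)
        then have "0 < ennreal (\<theta> * y - \<Lambda> \<theta>)" using order.strict_trans1 zero_le by blast
        then have "0 < \<theta> * y - \<Lambda> \<theta>" by simp
        then have "\<theta> \<in> T" using Lambda_ge[of \<theta>] by (simp add: T_def right_diff_distrib)
        then have "ennreal (\<theta> * y - \<Lambda> \<theta>) \<le> (SUP \<theta>\<in>T. ennreal (\<theta> * y - \<Lambda> \<theta>))" by (rule SUP_upper)
        then show False using t by simp
      qed
    qed
    have "(\<lambda>\<theta>. ennreal (\<theta> * y - \<Lambda> \<theta>)) ` T \<noteq> {}" using T0 by blast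
    from ennreal_Sup_countable_SUP[OF this] obtain f :: "nat \<Rightarrow> ennreal"
      where f: "incseq f" "range f \<subseteq> (\<lambda>\<theta>. ennreal (\<theta> * y - \<Lambda> \<theta>)) ` T" "hh y = (SUP i. f i)"
      unfolding S by blast
    have "\<forall>N. \<exists>\<theta>\<in>T. f N = ennreal (\<theta> * y - \<Lambda> \<theta>)" using f(2) by blast
    then obtain \<theta> where th: "\<And>N. \<theta> N \<in> T" "\<And>N. f N = ennreal (\<theta> N * y - \<Lambda> (\<theta> N))" by metis
    have "f \<longlonglongrightarrow> hh y" unfolding f(3) by (rule LIMSEQ_SUP[OF f(1)])
    then have "(\<lambda>N. ennreal (\<theta> N * y - \<Lambda> (\<theta> N))) \<longlonglongrightarrow> hh y" unfolding th(2) .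
    then show ?thesis using th(1) by (intro exI[of _ \<theta>]) (auto simp: T_def)
  qed
  then have "\<forall>y. \<exists>\<theta>. (\<forall>N :: nat. \<theta> N * y - \<Lambda> (\<theta> N) \<ge> 0 \<and> (\<theta> N = 0 \<or> \<theta> N * (y - mean) > 0)) \<and>
     (\<lambda>N. ennreal (\<theta> N * y - \<Lambda> (\<theta> N))) \<longlonglongrightarrow> hh y" by (intro allI)
  from choice[OF this] obtain \<theta> where "\<forall>y. (\<forall>N :: nat. \<theta> y N * y - \<Lambda> (\<theta> y N) \<ge> 0 \<and> (\<theta> y N = 0 \<or> \<theta> y N * (y - mean) > 0)) \<and>
     (\<lambda>N. ennreal (\<theta> y N * y - \<Lambda> (\<theta> y N))) \<longlonglongrightarrow> hh y" by (rule exE)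
  then show thesis by (intro that[of "\<lambda>N y. \<theta> y N"]) simp_all
qed

text \<open>The tilt is a function of the value alone, so it inherits symmetry and constancy on
  blocks from the matrix \<open>Y\<close>.\<close>

lemma II_stepk_dual:
  assumes n: "n > 0" and t: "t \<ge> 0" "ennreal t < II (stepk n Y)"
  obtains \<theta> :: "real \<Rightarrow> real" where "\<And>y. \<theta> y = 0 \<or> \<theta> y * (y - mean) > 0"
    "t * (real n)\<^sup>2 < (\<Sum>i<n. \<Sum>j<n. \<theta> (Y i j) * Y i j - \<Lambda> (\<theta> (Y i j)))"
proof -
  obtain \<theta> :: "nat \<Rightarrow> real \<Rightarrow> real" where th: "\<And>N y. \<theta> N y * y - \<Lambda> (\<theta> N y) \<ge> 0" "\<And>N y. \<theta> N y = 0 \<or> \<theta> N y * (y - mean) > 0"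
    "\<And>y. (\<lambda>N. ennreal (\<theta> N y * y - \<Lambda> (\<theta> N y))) \<longlonglongrightarrow> hh y"
    by (rule hh_signed_sequence) (rule that)
  let ?v = "\<lambda>N y. \<theta> N y * y - \<Lambda> (\<theta> N y)"
  have "(\<lambda>N. \<Sum>i<n. \<Sum>j<n. ennreal (1 / (real n)\<^sup>2) * ennreal (?v N (Y i j))) \<longlonglongrightarrow>
      (\<Sum>i<n. \<Sum>j<n. ennreal (1 / (real n)\<^sup>2) * hh (Y i j))"
    by (intro tendsto_sum ennreal_tendsto_cmult th(3)) simp
  also have "(\<Sum>i<n. \<Sum>j<n. ennreal (1 / (real n)\<^sup>2) * hh (Y i j)) = II (stepk n Y)"
    unfolding II_def nn_integral_stepk[OF n] by (simp add: mult.commute)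
  finally have "\<forall>\<^sub>F N in sequentially. ennreal t < (\<Sum>i<n. \<Sum>j<n. ennreal (1 / (real n)\<^sup>2) * ennreal (?v N (Y i j)))"
    using t(2) by (rule order_tendstoD(1))
  then obtain N where N: "ennreal t < (\<Sum>i<n. \<Sum>j<n. ennreal (1 / (real n)\<^sup>2) * ennreal (?v N (Y i j)))"
    by (metis (mono_tags, lifting) eventually_happens sequentially_bot)
  also have "\<dots> = (\<Sum>i<n. \<Sum>j<n. ennreal (?v N (Y i j) / (real n)\<^sup>2))"
    by (intro sum.cong refl) (use th(1) in \<open>simp add: ennreal_mult[symmetric]\<close>)
  also have "\<dots> = ennreal (\<Sum>i<n. \<Sum>j<n. ?v N (Y i j) / (real n)\<^sup>2)"
    using th(1) by (simp add: sum_nonneg)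
  finally have "t < (\<Sum>i<n. \<Sum>j<n. ?v N (Y i j) / (real n)\<^sup>2)" using t by (simp add: ennreal_less_iff)
  also have "\<dots> = (\<Sum>i<n. \<Sum>j<n. ?v N (Y i j)) / (real n)\<^sup>2" by (simp add: sum_divide_distrib)
  finally have "t * (real n)\<^sup>2 < (\<Sum>i<n. \<Sum>j<n. ?v N (Y i j))" using n by (simp add: pos_less_divide_eq)
  then show thesis using that[of "\<theta> N"] th(2) by blast
qed

text \<open>The point of the box closest to the mean minimises the Cramer function there, and a half-space through it with the right sign of \<open>\<theta>\<close> contains the whole box.\<close>

definition nearest_mean :: "real \<Rightarrow> int \<Rightarrow> real" where
  "nearest_mean d z = max (d * of_int z) (min mean (d * of_int z + d))"

definition box_event :: "nat \<Rightarrow> real \<Rightarrow> (nat \<Rightarrow> nat) \<Rightarrow> (nat \<Rightarrow> nat \<Rightarrow> int) \<Rightarrow> (nat \<times> nat \<Rightarrow> real) set" where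
  "box_event n d l z = {X \<in> space (PP n). \<forall>i<n. \<forall>j<n. \<lfloor>bavg n l (symm X) i j / d\<rfloor> = z (l i) (l j)}"

text \<open>A point of the box makes \<open>z\<close> symmetric on the labels in use, as the
  Chernoff bound requires. The threshold is \<open>2 * t\<close> because \<open>II\<close> is twice
  the rate. A measurable superset is delivered instead of a bound on the box itself.\<close>

lemma box_event_prob:
  assumes n: "n > 0" and d: "d > 0" and t: "t \<ge> 0"
    "ennreal (2 * t) < II (stepk n (\<lambda>i j. nearest_mean d (z (l i) (l j))))"
    and ne: "box_event n d l z \<noteq> {}"
  obtains H where "H \<in> sets (PP n)" "box_event n d l z \<subseteq> H" "measure (PP n) H \<le> exp (- (real n)\<^sup>2 * t)"
proof -
  let ?Y = "\<lambda>i j. nearest_mean d (z (l i) (l j))"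
  obtain X0 where X0: "X0 \<in> box_event n d l z" using ne by blast
  have zsym: "z (l i) (l j) = z (l j) (l i)" if "i < n" "j < n" for i j
  proof -
    have "bavg n l (symm X0) i j = bavg n l (symm X0) j i" unfolding bavg_def by (rule bavg_sym) (rule symm_sym)
    then show ?thesis using X0 that unfolding box_event_def by (metis (mono_tags, lifting) mem_Collect_eq)
  qed
  obtain \<theta> where th: "\<And>y. \<theta> y = 0 \<or> \<theta> y * (y - mean) > 0"
    "2 * t * (real n)\<^sup>2 < (\<Sum>i<n. \<Sum>j<n. \<theta> (?Y i j) * ?Y i j - \<Lambda> (\<theta> (?Y i j)))"
    by (rule II_stepk_dual[OF n _ t(2)]) (use t(1) in simp, rule that)
  let ?l = "\<lambda>i j. \<theta> (?Y i j)"
  define s where "s = (\<Sum>i<n. \<Sum>j<n. ?l i j * ?Y i j) / 2"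
  have lsym: "?l i j = ?l j i" if "i < n" "j < n" for i j using zsym[OF that] by simp
  let ?H = "{X \<in> space (PP n). s \<le> (\<Sum>i<n. \<Sum>j<n. ?l i j * symm X i j) / 2}"
  show thesis
  proof (rule that[of ?H])
    show "?H \<in> sets (PP n)" by (rule chernoff_symmetric(1)[OF lsym])
    have "measure (PP n) ?H \<le> exp ((\<Sum>i<n. \<Sum>j<n. \<Lambda> (?l i j)) / 2 - s)" by (rule chernoff_symmetric(2)[OF lsym])
    also have "\<dots> \<le> exp (- (real n)\<^sup>2 * t)"
      using th(2) by (simp add: s_def sum_subtractf field_simps)
    finally show "measure (PP n) ?H \<le> exp (- (real n)\<^sup>2 * t)" .
    show "box_event n d l z \<subseteq> ?H"
    proof
      fix X assume X: "X \<in> box_event n d l z"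
      \<comment> \<open>The sign of \<theta> tells which end of the box is nearest to the mean: the
        lower end for a box above the mean, the upper end for one below. Moving to any average in
        the box therefore does not decrease the pairing.\<close>
      have "(\<Sum>i<n. \<Sum>j<n. ?l i j * ?Y i j) \<le> (\<Sum>i<n. \<Sum>j<n. ?l i j * bavg n l (symm X) i j)"
      proof (intro sum_mono)
        fix i j assume "i \<in> {..<n}" "j \<in> {..<n}"
        then have zz: "z (l i) (l j) = \<lfloor>bavg n l (symm X) i j / d\<rfloor>" using X by (simp add: box_event_def)
        let ?b = "bavg n l (symm X) i j" and ?z = "z (l i) (l j)"
        have b1: "of_int ?z \<le> ?b / d" "?b / d < of_int ?z + 1" using zz by linarith+
        have b: "d * of_int ?z \<le> ?b" "?b < d * of_int ?z + d"
          using b1 d by (simp_all add: pos_le_divide_eq pos_divide_less_eq algebra_simps)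
        consider "?l i j = 0" | "?l i j > 0" "?Y i j > mean" | "?l i j < 0" "?Y i j < mean"
          using th(1)[of "?Y i j"] by (auto simp: zero_less_mult_iff)
        then show "?l i j * ?Y i j \<le> ?l i j * ?b"
        proof cases
          case 2
          then have "?Y i j = d * of_int ?z" by (auto simp: nearest_mean_def max_def min_def split: if_splits)
          then show ?thesis using b(1) 2(1) by (simp add: mult_left_mono)
        next
          case 3
          then have "?Y i j = d * of_int ?z + d" using d by (auto simp: nearest_mean_def max_def min_def split: if_splits)
          then show ?thesis using b(2) 3(1) by (simp add: mult_left_mono_neg)
        qed simp
      qed
      \<comment> \<open>The tilt depends on the labels only, so the averages may be replaced by the
        entries.\<close>
      also have "\<dots> = (\<Sum>i<n. \<Sum>j<n. ?l i j * symm X i j)"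
        by (rule bavg_orthogonal[where G = "\<lambda>a b. \<theta> (nearest_mean d (z a b))"])
      finally show "X \<in> ?H" using X by (simp add: s_def box_event_def)
    qed
  qed
qed

lemma nearest_mean_close:
  assumes "d > 0"
  shows "\<bar>b - nearest_mean d \<lfloor>b / d\<rfloor>\<bar> \<le> d"
proof -
  obtain z where z: "z = \<lfloor>b / d\<rfloor>" by blast
  then have b1: "of_int z \<le> b / d" "b / d < of_int z + 1" by linarith+
  have "d * of_int z \<le> b" "b < d * of_int z + d"
    using b1 assms by (simp_all add: pos_le_divide_eq pos_divide_less_eq algebra_simps)
  then show ?thesis unfolding z[symmetric] by (auto simp: nearest_mean_def)
qed

lemma rateI_II:
  assumes "k \<in> kernels"
  shows "rateI \<mu> k = ereal (1 / 2) * enn2ereal (II k)"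
proof -
  have "(\<lambda>p. hh (k p)) \<in> borel_measurable borel" using kernels_measurable[OF assms] by measurable
  from nn_integral_usq[OF this] show ?thesis unfolding rateI_def II_def hh_def by simp
qed

lemma rateItil_orbit:
  assumes "k \<in> kernels"
  shows "rateItil \<mu> (orbit k) = ereal (1 / 2) * enn2ereal (II k)"
proof -
  obtain \<sigma> where s: "mp_bij \<sigma>" "rep (orbit k) = act \<sigma> k" by (rule rep_orbit[OF assms])
  then show ?thesis unfolding rateItil_def using rateI_II[OF act_kernels[OF s(1) assms]] II_act[OF s(1) assms] by simp
qed

text \<open>Otherwise there are step kernels arbitrarily near \<open>C\<close> with
  \<open>II\<close> at most \<open>2 * t\<close>; compactness gives a limit of rate at most
  \<open>t\<close>, and closedness puts its orbit into \<open>C\<close>, against the choice of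
  \<open>t\<close>. Step kernels suffice, since rounding the matrix produces one.\<close>

lemma closed_neighbourhood_rate:
  assumes C: "til_closed C" and t: "t \<ge> 0" "ereal t < (INF Ob \<in> C. rateItil \<mu> Ob)"
  obtains \<epsilon> where "\<epsilon> > 0" "\<And>n Y c. n > 0 \<Longrightarrow> (\<And>i j. i < n \<Longrightarrow> j < n \<Longrightarrow> Y i j = Y j i) \<Longrightarrow>
     c \<in> kernels \<Longrightarrow> orbit c \<in> C \<Longrightarrow> near \<epsilon> c (stepk n Y) \<Longrightarrow> ennreal (2 * t) < II (stepk n Y)"
proof (rule ccontr)
  assume neg: "\<not> thesis"
  have "\<exists>n Y c. n > 0 \<and> (\<forall>i j. i < n \<longrightarrow> j < n \<longrightarrow> Y i j = Y j i) \<and> c \<in> kernels \<and> orbit c \<in> C \<and>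
     near (1 / real (Suc m)) c (stepk n Y) \<and> II (stepk n Y) \<le> ennreal (2 * t)" for m :: nat
  proof (rule ccontr)
    assume c: "\<not> ?thesis"
    have "thesis"
    proof (rule that[of "1 / real (Suc m)"])
      fix n Y c'
      assume *: "n > 0" "\<And>i j. i < n \<Longrightarrow> j < n \<Longrightarrow> Y i j = Y j i" "c' \<in> kernels" "orbit c' \<in> C"
        "near (1 / real (Suc m)) c' (stepk n Y)"
      show "ennreal (2 * t) < II (stepk n Y)"
      proof (rule ccontr)
        assume "\<not> ennreal (2 * t) < II (stepk n Y)"
        then have "II (stepk n Y) \<le> ennreal (2 * t)" by simp
        moreover have "\<forall>i j. i < n \<longrightarrow> j < n \<longrightarrow> Y i j = Y j i" using *(2) by blast
        ultimately show False using c *(1,3-5) by blast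
      qed
    qed simp
    then show False using neg by blast
  qed
  then obtain n Y c where h: "\<And>m :: nat. n m > 0" "\<And>m i j. i < n m \<Longrightarrow> j < n m \<Longrightarrow> Y m i j = Y m j i"
    "\<And>m. c m \<in> kernels" "\<And>m. orbit (c m) \<in> C" "\<And>m. near (1 / real (Suc m)) (c m) (stepk (n m) (Y m))"
    "\<And>m. II (stepk (n m) (Y m)) \<le> ennreal (2 * t)" by metis
  obtain k where k: "k \<in> kernels" "II k \<le> ennreal (2 * t)"
    "\<And>e i0. e > 0 \<Longrightarrow> \<exists>i\<ge>i0. near e k (stepk (n i) (Y i))"
    by (rule level_compact[where n = n and a = Y and L = "2 * t", OF h(1) h(2) h(6)]) (use t in auto)
  have "orbit k \<in> C"
  proof (rule ccontr)
    assume "orbit k \<notin> C"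
    then have "orbit k \<in> Ktil - C" using orbit_in_Ktil[OF k(1)] by blast
    then obtain e where e: "e > 0" "\<And>v. v \<in> Ktil \<Longrightarrow> dtil (orbit k) v < e \<Longrightarrow> v \<in> Ktil - C"
      using C unfolding til_closed_def til_open_def by blast
    obtain i0 :: nat where i0: "2 / e < real i0" using reals_Archimedean2 by blast
    obtain i where i: "i \<ge> i0" "near (e / 2) k (stepk (n i) (Y i))" using k(3)[of "e / 2" i0] e by auto
    have "2 / e < real (Suc i)" using i0 i by simp
    then have "1 / real (Suc i) \<le> e / 2" using e(1) by (simp add: field_simps)
    then have nc: "near (e / 2) (c i) (stepk (n i) (Y i))" using near_mono[OF h(5)[of i]] by blast
    have sk: "stepk (n i) (Y i) \<in> kernels" by (rule stepk_kernels) (rule h(2))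
    have "near (e / 2 + e / 2) k (c i)"
      by (rule near_trans[OF k(1) sk h(3) i(2) near_sym[OF h(3) sk nc]])
    then have "dtil (orbit k) (orbit (c i)) < e" using dtil_less_iff[OF k(1) h(3)] by simp
    then show False using e(2)[OF orbit_in_Ktil[OF h(3)]] h(4) by blast
  qed
  then have "(INF Ob \<in> C. rateItil \<mu> Ob) \<le> rateItil \<mu> (orbit k)" by (rule INF_lower)
  also have "\<dots> = ereal (1 / 2) * enn2ereal (II k)" by (rule rateItil_orbit[OF k(1)])
  also have "\<dots> \<le> ereal (1 / 2) * ereal (2 * t)"
  proof (rule ereal_mult_left_mono)
    have "enn2ereal (II k) \<le> enn2ereal (ennreal (2 * t))" using k(2) by (simp add: less_eq_ennreal.rep_eq)
    then show "enn2ereal (II k) \<le> ereal (2 * t)" using t by (simp add: enn2ereal_ennreal)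
  qed simp
  finally show False using t by simp
qed

end

lemma cls_restrict: "cls n (restrict l {..<n}) a = cls n l a"
  by (auto simp: cls_def)

lemma bavg_restrict: "i < n \<Longrightarrow> j < n \<Longrightarrow> bavg n (restrict l {..<n}) x i j = bavg n l x i j"
  by (simp add: bavg_def bl_def cls_restrict)

text \<open>A single block average is bounded by the whole energy. Growth linear in n is harmless,
  as only the logarithm of the number of roundings counts.\<close>

lemma abs_bl_le:
  assumes x: "(\<Sum>i<n. \<Sum>j<n. (x i j)\<^sup>2) \<le> M * (real n)\<^sup>2" and M: "M \<ge> 0"
  shows "\<bar>bl n l x a b\<bar> \<le> real n * sqrt M"
proof (cases "cls n l a = {} \<or> cls n l b = {}")
  case True
  then have "bl n l x a b = 0" by (auto simp: bl_def)
  then show ?thesis using M by simp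
next
  case False
  then obtain i j where ij: "i < n" "l i = a" "j < n" "l j = b" by (auto simp: cls_def)
  have "(bavg n l x i j)\<^sup>2 \<le> (\<Sum>j<n. (bavg n l x i j)\<^sup>2)"
    using member_le_sum[of j "{..<n}" "\<lambda>j. (bavg n l x i j)\<^sup>2"] ij by simp
  also have "\<dots> \<le> (\<Sum>i<n. \<Sum>j<n. (bavg n l x i j)\<^sup>2)"
    using member_le_sum[of i "{..<n}" "\<lambda>i. \<Sum>j<n. (bavg n l x i j)\<^sup>2"] ij by (simp add: sum_nonneg)
  also have "\<dots> \<le> M * (real n)\<^sup>2" using bavg_energy_le x by (rule order.trans)
  finally have "\<bar>bavg n l x i j\<bar> \<le> sqrt (M * (real n)\<^sup>2)" by (intro real_le_rsqrt) simp
  then show ?thesis using ij by (simp add: bavg_def real_sqrt_mult mult.commute)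
qed

context gauss_tail
begin

section \<open>Covering the event by boxes\<close>

definition box_index :: "nat \<Rightarrow> nat \<Rightarrow> int \<Rightarrow> ((nat \<Rightarrow> nat) \<times> (nat \<times> nat \<Rightarrow> int)) set" where
  "box_index n R K = ({..<n} \<rightarrow>\<^sub>E {..<R}) \<times> (({..<R} \<times> {..<R}) \<rightarrow>\<^sub>E {- K..K})"

lemma finite_box_index: "finite (box_index n R K)"
  unfolding box_index_def by (intro finite_cartesian_product finite_PiE) auto

lemma card_box_index: "K \<ge> 0 \<Longrightarrow> card (box_index n R K) = R ^ n * nat (2 * K + 1) ^ (R * R)"
  unfolding box_index_def by (simp add: card_cartesian_product card_PiE)

text \<open>Regularity and rounding cost \<open>e\<close> each in cut distance; the radius
  \<open>3 * e\<close> leaves room for the strict inequality in \<open>near\<close>. Labellings are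
  restricted to indices below n so that they lie in a finite set.\<close>

lemma box_cover:
  assumes n: "n > 0" and X: "X \<in> space (PP n)" and en: "(\<Sum>i<n. \<Sum>j<n. (symm X i j)\<^sup>2) \<le> M * (real n)\<^sup>2"
    and e: "e > 0" and N: "M < real N * e\<^sup>2" and M: "M \<ge> 0" and Z: "sqrt M / e + 1 \<le> real_of_int Z"
  shows "\<exists>(l, z)\<in>box_index n (4 ^ N) (Z * int n). X \<in> box_event n e l (curry z) \<and>
    near (3 * e) (kmat n X) (stepk n (\<lambda>i j. nearest_mean e (z (l i, l j))))"
proof -
  let ?x = "symm X" and ?R = "4 ^ N :: nat"
  obtain l0 where l0: "\<forall>i<n. l0 i < ?R" "cut_close e n ?x (bavg n l0 ?x)"
    by (rule weak_regularity[OF en e N n])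
  define l where "l = restrict l0 {..<n}"
  define z where "z = restrict (\<lambda>(a, b). \<lfloor>bl n l ?x a b / e\<rfloor>) ({..<?R} \<times> {..<?R})"
  have lR: "l i < ?R" if "i < n" for i using l0 that by (simp add: l_def)
  have bav: "bavg n l ?x i j = bavg n l0 ?x i j" if "i < n" "j < n" for i j
    unfolding l_def by (rule bavg_restrict[OF that])
  have zv: "z (l i, l j) = \<lfloor>bavg n l ?x i j / e\<rfloor>" if "i < n" "j < n" for i j
    using lR that by (simp add: z_def bavg_def)
  have zb: "\<lfloor>bl n l ?x a b / e\<rfloor> \<in> {- (Z * int n)..Z * int n}" for a b
  proof -
    have "\<bar>bl n l ?x a b / e\<bar> \<le> real n * sqrt M / e"
      using abs_bl_le[OF en M, of l a b] e by (simp add: divide_right_mono)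
    moreover have "real n * sqrt M / e + 1 \<le> real_of_int (Z * int n)"
    proof -
      have "real n * (sqrt M / e + 1) \<le> real n * real_of_int Z" by (intro mult_left_mono Z) simp
      moreover have "1 \<le> real n" using n by simp
      ultimately show ?thesis by (simp add: algebra_simps)
    qed
    ultimately have "- real_of_int (Z * int n) + 1 \<le> bl n l ?x a b / e" "bl n l ?x a b / e \<le> real_of_int (Z * int n)" by linarith+
    then have "real_of_int \<lfloor>bl n l ?x a b / e\<rfloor> \<le> real_of_int (Z * int n)"
      "real_of_int (- (Z * int n)) \<le> real_of_int \<lfloor>bl n l ?x a b / e\<rfloor>" by linarith+
    then show ?thesis by (simp only: of_int_le_iff atLeastAtMost_iff)
  qed
  have idx: "(l, z) \<in> box_index n ?R (Z * int n)"
    unfolding box_index_def using zb l0(1) by (auto simp: l_def z_def)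
  have box: "X \<in> box_event n e l (curry z)"
    unfolding box_event_def using X zv by (simp add: curry_def)
  let ?Y = "\<lambda>i j. nearest_mean e (z (l i, l j))"
  have zsym: "z (l i, l j) = z (l j, l i)" if "i < n" "j < n" for i j
    using zv[OF that] zv[OF that(2,1)] bavg_sym[where n = n and x = ?x and l = l and a = "l i" and b = "l j"] symm_sym[of X]
    by (simp add: bavg_def)
  have Yk: "stepk n ?Y \<in> kernels" by (rule stepk_kernels) (simp add: zsym)
  have xk: "stepk n ?x \<in> kernels" by (rule stepk_kernels) (rule symm_sym)
  have "cutn (\<lambda>p. stepk n ?x p - stepk n (bavg n l0 ?x) p) \<le> e"
    by (rule cut_close_imp_cutn[OF n l0(2)])
  moreover have "cutn (\<lambda>p. stepk n (bavg n l0 ?x) p - stepk n ?Y p) \<le> e"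
  proof -
    have "cutn (\<lambda>p. stepk n (bavg n l0 ?x) p - stepk n ?Y p) \<le> (\<integral>p. \<bar>stepk n (bavg n l0 ?x) p - stepk n ?Y p\<bar> \<partial>usq)"
      by (rule cutn_le_L1) simp
    also have "\<dots> = (\<Sum>i<n. \<Sum>j<n. \<bar>bavg n l0 ?x i j - ?Y i j\<bar>) / (real n)\<^sup>2"
      by (rule integral_abs_stepk_diff[OF n])
    also have "\<dots> \<le> (\<Sum>i<n. \<Sum>j<n. e) / (real n)\<^sup>2"
      by (intro divide_right_mono sum_mono) (use nearest_mean_close[OF e] zv bav in auto)
    also have "\<dots> = e" using n by (simp add: power2_eq_square)
    finally show ?thesis .
  qed
  moreover have "cutn (\<lambda>p. (stepk n ?x p - stepk n (bavg n l0 ?x) p) + (stepk n (bavg n l0 ?x) p - stepk n ?Y p))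
     \<le> cutn (\<lambda>p. stepk n ?x p - stepk n (bavg n l0 ?x) p) + cutn (\<lambda>p. stepk n (bavg n l0 ?x) p - stepk n ?Y p)"
    by (rule cutn_triangle) simp_all
  ultimately have "cut_dist (stepk n ?x) (stepk n ?Y) \<le> 2 * e" by (simp add: cut_dist_kernels[OF xk Yk])
  then have "near (3 * e) (stepk n ?x) (stepk n ?Y)" using e by (intro nearI_cut xk) simp
  then have "near (3 * e) (kmat n X) (stepk n ?Y)" using near_kmat[OF n Yk] by simp
  then show ?thesis using idx box by blast
qed

lemma Qtil_le_1: "Qtil \<mu> n C \<le> 1"
proof -
  interpret P: prob_space "PP n" by (rule prob_space_PP)
  show ?thesis unfolding Qtil_def by simp
qed

text \<open>There are only \<open>exp (O (n))\<close> labellings and polynomially many roundings of the block averages, which is negligible at speed \<open>n\<^sup>2\<close>. The event itself need not be measurable, as then its measure is 0.\<close>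

lemma upper_prob_fixed:
  assumes C: "til_closed C" and t: "t \<ge> 0" "ereal t < (INF Ob \<in> C. rateItil \<mu> Ob)"
  obtains R :: nat and Z :: int where "R > 0" "Z > 0"
    "\<And>n. n > 0 \<Longrightarrow> Qtil \<mu> n C \<le> exp (- (real n)\<^sup>2 * (t + 1)) + real R ^ n * real_of_int (2 * (Z * int n) + 1) ^ (R * R) * exp (- (real n)\<^sup>2 * t)"
proof -
  obtain \<epsilon> where eps: "\<epsilon> > 0" "\<And>n Y c. n > 0 \<Longrightarrow> (\<And>i j. i < n \<Longrightarrow> j < n \<Longrightarrow> Y i j = Y j i) \<Longrightarrow>
     c \<in> kernels \<Longrightarrow> orbit c \<in> C \<Longrightarrow> near \<epsilon> c (stepk n Y) \<Longrightarrow> ennreal (2 * t) < II (stepk n Y)"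
    using closed_neighbourhood_rate[OF C t] by blast
  define e where "e = \<epsilon> / 3"
  have e: "e > 0" using eps by (simp add: e_def)
  \<comment> \<open>Chosen so that \<open>energy_tail\<close> gives the exponent
    \<open>t + 1\<close>, a whole unit beyond the target.\<close>
  define M where "M = 2 * (ln A0 + t + 1)"
  have M: "M \<ge> 0" using t A0_ge_1 by (simp add: M_def)
  obtain N :: nat where "M / e\<^sup>2 < real N" using reals_Archimedean2 by blast
  then have N: "M < real N * e\<^sup>2" using e by (simp add: pos_divide_less_eq)
  define R :: nat where "R = 4 ^ N"
  define Z where "Z = \<lceil>sqrt M / e + 1\<rceil>"
  have Z: "sqrt M / e + 1 \<le> real_of_int Z" by (simp add: Z_def)
  have "0 \<le> sqrt M / e" using M e by simp
  then have Z0: "Z > 0" using Z by linarith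
  show thesis
  proof (rule that[of R Z])
    show "R > 0" by (simp add: R_def)
    show "Z > 0" by (rule Z0)
    fix n :: nat assume n: "n > 0"
    interpret P: prob_space "PP n" by (rule prob_space_PP)
    let ?I = "box_index n R (Z * int n)"
    \<comment> \<open>Only boxes that have a suitable half-space enter the union;
      \<open>box_event_prob\<close> supplies one for every box that the event meets at bounded
      energy.\<close>
    let ?good = "{lz \<in> ?I. \<exists>H. H \<in> sets (PP n) \<and> box_event n e (fst lz) (curry (snd lz)) \<subseteq> H \<and> measure (PP n) H \<le> exp (- (real n)\<^sup>2 * t)}"
    have "\<forall>lz\<in>?good. \<exists>H. H \<in> sets (PP n) \<and> box_event n e (fst lz) (curry (snd lz)) \<subseteq> H \<and> measure (PP n) H \<le> exp (- (real n)\<^sup>2 * t)"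
      by simp
    from bchoice[OF this] obtain H where H: "\<And>lz. lz \<in> ?good \<Longrightarrow> H lz \<in> sets (PP n)"
      "\<And>lz. lz \<in> ?good \<Longrightarrow> box_event n e (fst lz) (curry (snd lz)) \<subseteq> H lz"
      "\<And>lz. lz \<in> ?good \<Longrightarrow> measure (PP n) (H lz) \<le> exp (- (real n)\<^sup>2 * t)" by blast
    let ?E = "{X \<in> space (PP n). M * (real n)\<^sup>2 \<le> (\<Sum>i<n. \<Sum>j<n. (symm X i j)\<^sup>2)}"
    let ?D = "{X \<in> space (PP n). orbit (kmat n X) \<in> C}"
    have fin: "finite ?good" using finite_box_index by simp
    have cov: "?D \<subseteq> ?E \<union> (\<Union>lz\<in>?good. H lz)"
    proof
      fix X assume X: "X \<in> ?D"
      show "X \<in> ?E \<union> (\<Union>lz\<in>?good. H lz)"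
      proof (cases "X \<in> ?E")
        case False
        then have en: "(\<Sum>i<n. \<Sum>j<n. (symm X i j)\<^sup>2) \<le> M * (real n)\<^sup>2" using X by simp
        obtain l z where lz: "(l, z) \<in> ?I" "X \<in> box_event n e l (curry z)"
          "near (3 * e) (kmat n X) (stepk n (\<lambda>i j. nearest_mean e (z (l i, l j))))"
          using box_cover[OF n _ en e N M Z] X unfolding R_def by blast
        let ?Y = "\<lambda>i j. nearest_mean e (curry z (l i) (l j))"
        have ysym: "?Y i j = ?Y j i" if "i < n" "j < n" for i j
        proof -
          have "bavg n l (symm X) i j = bavg n l (symm X) j i" unfolding bavg_def by (rule bavg_sym) (rule symm_sym)
          moreover have "\<lfloor>bavg n l (symm X) i j / e\<rfloor> = curry z (l i) (l j)" "\<lfloor>bavg n l (symm X) j i / e\<rfloor> = curry z (l j) (l i)"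
            using lz(2) that unfolding box_event_def by blast+
          ultimately have "curry z (l i) (l j) = curry z (l j) (l i)" by metis
          then show ?thesis by simp
        qed
        have "ennreal (2 * t) < II (stepk n ?Y)"
          by (rule eps(2)[OF n ysym kmat_kernels[of n X]]) (use X lz(3) in \<open>auto simp: e_def\<close>)
        moreover have "box_event n e l (curry z) \<noteq> {}" using lz(2) by blast
        ultimately obtain H' where "H' \<in> sets (PP n)" "box_event n e l (curry z) \<subseteq> H'" "measure (PP n) H' \<le> exp (- (real n)\<^sup>2 * t)"
          using box_event_prob[OF n e t(1)] by blast
        then have g: "(l, z) \<in> ?good" using lz(1) by auto
        have "X \<in> H (l, z)" using H(2)[OF g] lz(2) by (simp only: fst_conv snd_conv) (rule subsetD)
        then show ?thesis using g by blast
      qed simp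
    qed
    have Em: "?E \<in> sets (PP n)" by (rule energy_tail(1))
    have Um: "(\<Union>lz\<in>?good. H lz) \<in> sets (PP n)" by (rule sets.finite_UN[OF fin]) (rule H(1))
    have "Qtil \<mu> n C \<le> measure (PP n) (?E \<union> (\<Union>lz\<in>?good. H lz))"
      unfolding Qtil_def by (rule P.finite_measure_mono[OF cov]) (use Em Um in blast)
    also have "\<dots> \<le> measure (PP n) ?E + measure (PP n) (\<Union>lz\<in>?good. H lz)"
      by (rule measure_Un_le[OF Em Um])
    also have "measure (PP n) ?E \<le> exp (- (real n)\<^sup>2 * (t + 1))"
    proof -
      have "(real n)\<^sup>2 * (ln A0 - M / 2) = - (real n)\<^sup>2 * (t + 1)" by (simp add: M_def algebra_simps)
      then show ?thesis using energy_tail(2)[of n M] by simp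
    qed
    also have "measure (PP n) (\<Union>lz\<in>?good. H lz) \<le> (\<Sum>lz\<in>?good. measure (PP n) (H lz))"
      by (rule measure_UNION_le[OF fin]) (rule H(1))
    also have "\<dots> \<le> (\<Sum>lz\<in>?good. exp (- (real n)\<^sup>2 * t))" by (rule sum_mono) (rule H(3))
    also have "\<dots> \<le> real (card ?I) * exp (- (real n)\<^sup>2 * t)"
    proof -
      have "card ?good \<le> card ?I" by (rule card_mono[OF finite_box_index]) auto
      then show ?thesis by (simp add: mult_right_mono)
    qed
    also have "real (card ?I) = real R ^ n * real_of_int (2 * (Z * int n) + 1) ^ (R * R)"
    proof -
      have z: "Z * int n \<ge> 0" using Z0 by simp
      have "real (nat (2 * (Z * int n) + 1)) = real_of_int (2 * (Z * int n) + 1)" using z by (subst of_nat_nat) auto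
      then show ?thesis unfolding card_box_index[OF z] by simp
    qed
    finally show "Qtil \<mu> n C \<le> exp (- (real n)\<^sup>2 * (t + 1)) + real R ^ n * real_of_int (2 * (Z * int n) + 1) ^ (R * R) * exp (- (real n)\<^sup>2 * t)"
      by simp
  qed
qed

text \<open>Polynomial growth is bounded crudely by an exponential linear in n, which is negligible
  at speed n^2.\<close>

lemma linear_exponent_bound:
  assumes "R > 0" "Z > (0 :: int)" "n > 0"
  shows "real R ^ n * real_of_int (2 * (Z * int n) + 1) ^ (R * R) \<le> exp (real n * (ln (real R) + real_of_int (2 * Z + 1) * real (R * R)))"
proof -
  have "real R ^ n = exp (real n * ln (real R))" using assms by (simp add: exp_of_nat_mult)
  moreover have "real_of_int (2 * (Z * int n) + 1) ^ (R * R) \<le> exp (real n * real_of_int (2 * Z + 1)) ^ (R * R)"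
  proof (rule power_mono)
    have "real_of_int (2 * (Z * int n) + 1) \<le> real n * real_of_int (2 * Z + 1)" using assms by (simp add: algebra_simps)
    also have "\<dots> \<le> exp (real n * real_of_int (2 * Z + 1))"
      using exp_ge_add_one_self[of "real n * real_of_int (2 * Z + 1)"] by linarith
    finally show "real_of_int (2 * (Z * int n) + 1) \<le> exp (real n * real_of_int (2 * Z + 1))" .
    show "0 \<le> real_of_int (2 * (Z * int n) + 1)" using assms by simp
  qed
  moreover have "exp (real n * real_of_int (2 * Z + 1)) ^ (R * R) = exp (real n * real_of_int (2 * Z + 1) * real (R * R))"
    by (metis exp_of_nat_mult mult.commute)
  ultimately have "real R ^ n * real_of_int (2 * (Z * int n) + 1) ^ (R * R) \<le> exp (real n * ln (real R)) * exp (real n * real_of_int (2 * Z + 1) * real (R * R))"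
    by (metis exp_ge_zero mult_left_mono)
  also have "\<dots> = exp (real n * (ln (real R) + real_of_int (2 * Z + 1) * real (R * R)))"
    unfolding exp_add[symmetric] by (simp only: distrib_left mult.assoc)
  finally show ?thesis .
qed

lemma exp_quadratic_eventually:
  fixes c s :: real
  assumes "s > 0"
  shows "\<forall>\<^sub>F n in sequentially. exp (real n * c - (real n)\<^sup>2 * s) \<le> 1 / 2"
proof -
  obtain N :: nat where N: "(\<bar>c\<bar> + 1) / s < real N" using reals_Archimedean2 by blast
  show ?thesis
  proof (rule eventually_sequentiallyI[of "Suc N"])
    fix n assume n: "Suc N \<le> n"
    then have "(\<bar>c\<bar> + 1) / s < real n" using N by linarith
    then have "\<bar>c\<bar> + 1 \<le> real n * s" using assms by (simp add: pos_divide_less_eq)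
    then have "real n * (\<bar>c\<bar> + 1) \<le> real n * (real n * s)" by (rule mult_left_mono) simp
    then have "real n * \<bar>c\<bar> + real n \<le> (real n)\<^sup>2 * s" by (simp add: power2_eq_square algebra_simps)
    moreover have "real n * c \<le> real n * \<bar>c\<bar>" by (rule mult_left_mono) auto
    moreover have "1 \<le> real n" using n by simp
    ultimately have "real n * c - (real n)\<^sup>2 * s \<le> - 1" by linarith
    then have "exp (real n * c - (real n)\<^sup>2 * s) \<le> exp (- 1)" by simp
    also have "\<dots> \<le> 1 / 2"
    proof -
      have "2 \<le> exp (1 :: real)" using exp_ge_add_one_self[of 1] by simp
      then show ?thesis by (simp add: exp_minus field_simps)
    qed
    finally show "exp (real n * c - (real n)\<^sup>2 * s) \<le> 1 / 2" .
  qed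
qed

text \<open>A rate \<open>t'\<close> strictly between \<open>t\<close> and the infimum leaves a
  factor \<open>exp (- n^2 (t' - t))\<close> that beats the linear exponent of the number of boxes.
  For negative \<open>t\<close> the bound is at least 1.\<close>

theorem upper_prob:
  assumes C: "til_closed C" and t: "ereal t < (INF Ob \<in> C. rateItil \<mu> Ob)"
  shows "\<forall>\<^sub>F n in sequentially. Qtil \<mu> n C \<le> exp (- (real n)\<^sup>2 * t)"
proof (cases "t < 0")
  case True
  have "1 \<le> exp (- (real n)\<^sup>2 * t)" for n :: nat using True by (simp add: mult_nonneg_nonpos)
  then show ?thesis using Qtil_le_1 order.trans by (intro always_eventually allI) blast
next
  case False
  obtain t' where t': "t < t'" "ereal t' < (INF Ob \<in> C. rateItil \<mu> Ob)"
    using ereal_dense2[OF t] by auto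
  then have "t' \<ge> 0" using False by simp
  from upper_prob_fixed[OF C this t'(2)] obtain R Z where RZ: "R > 0" "Z > 0"
    and b: "\<And>n. n > 0 \<Longrightarrow> Qtil \<mu> n C \<le> exp (- (real n)\<^sup>2 * (t' + 1)) + real R ^ n * real_of_int (2 * (Z * int n) + 1) ^ (R * R) * exp (- (real n)\<^sup>2 * t')"
    by blast
  define c where "c = ln (real R) + real_of_int (2 * Z + 1) * real (R * R)"
  have "\<forall>\<^sub>F n in sequentially. exp (real n * 0 - (real n)\<^sup>2 * 1) \<le> 1 / 2"
    by (rule exp_quadratic_eventually) simp
  moreover have "\<forall>\<^sub>F n in sequentially. exp (real n * c - (real n)\<^sup>2 * (t' - t)) \<le> 1 / 2"
    by (rule exp_quadratic_eventually) (use t' in simp)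
  moreover have "\<forall>\<^sub>F n in sequentially. (n :: nat) > 0" by (rule eventually_gt_at_top)
  ultimately show ?thesis
  proof eventually_elim
    case (elim n)
    let ?e = "exp (- (real n)\<^sup>2 * t)"
    have "exp (- (real n)\<^sup>2 * (t' + 1)) \<le> exp (- (real n)\<^sup>2 * t + (real n * 0 - (real n)\<^sup>2 * 1))"
      using mult_left_mono[OF less_imp_le[OF t'(1)], of "(real n)\<^sup>2"] by (simp add: algebra_simps)
    also have "\<dots> = ?e * exp (real n * 0 - (real n)\<^sup>2 * 1)" by (simp only: exp_add)
    also have "\<dots> \<le> ?e * (1 / 2)" by (rule mult_left_mono[OF elim(1)]) simp
    finally have 1: "exp (- (real n)\<^sup>2 * (t' + 1)) \<le> ?e / 2" by simp
    have "real R ^ n * real_of_int (2 * (Z * int n) + 1) ^ (R * R) * exp (- (real n)\<^sup>2 * t') \<le> exp (real n * c) * exp (- (real n)\<^sup>2 * t')"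
      unfolding c_def by (intro mult_right_mono linear_exponent_bound RZ elim) simp
    also have "\<dots> = ?e * exp (real n * c - (real n)\<^sup>2 * (t' - t))" by (simp flip: exp_add add: algebra_simps)
    also have "\<dots> \<le> ?e * (1 / 2)" by (rule mult_left_mono[OF elim(2)]) simp
    finally show ?case using b[OF elim(3)] 1 by simp
  qed
qed

end

section \<open>The lower bound\<close>

text \<open>The multiplicity of an independent entry in the sum of a symmetric matrix over
  \<open>S \<times> T\<close>. That it takes only the values 0, 1, 2, whatever n is, allows one
  Chernoff exponent for all rectangles.\<close>

definition rect_coef :: "nat set \<Rightarrow> nat set \<Rightarrow> nat \<times> nat \<Rightarrow> real" where
  "rect_coef S T p = (if fst p < snd p
     then of_bool (fst p \<in> S \<and> snd p \<in> T) + of_bool (snd p \<in> S \<and> fst p \<in> T)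
     else of_bool (fst p \<in> S \<and> fst p \<in> T))"

lemma rect_coef_range: "rect_coef S T p \<in> {0, 1, 2}"
  by (auto simp: rect_coef_def)

text \<open>Adding the transposed sum makes the summand symmetric, so that
  \<open>sum_upper_idx\<close> applies; the factor 2 cancels.\<close>

lemma sum_rect_upper:
  fixes d :: "nat \<Rightarrow> nat \<Rightarrow> real"
  assumes ST: "S \<subseteq> {..<n}" "T \<subseteq> {..<n}" and d: "\<And>i j. i < n \<Longrightarrow> j < n \<Longrightarrow> d i j = d j i"
  shows "(\<Sum>i\<in>S. \<Sum>j\<in>T. d i j) = (\<Sum>p\<in>upper_idx n. rect_coef S T p * d (fst p) (snd p))"
proof -
  let ?F = "\<lambda>i j. of_bool (i \<in> S \<and> j \<in> T) * d i j"
  have "(\<Sum>i\<in>S. \<Sum>j\<in>T. d i j) = (\<Sum>i<n. \<Sum>j<n. ?F i j)"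
  proof -
    have "(\<Sum>i<n. \<Sum>j<n. ?F i j) = (\<Sum>i\<in>S. \<Sum>j<n. ?F i j)"
      by (rule sum.mono_neutral_right) (use ST in auto)
    also have "\<dots> = (\<Sum>i\<in>S. \<Sum>j\<in>T. ?F i j)"
      by (intro sum.cong refl sum.mono_neutral_right) (use ST in auto)
    finally show ?thesis by simp
  qed
  moreover have "(\<Sum>i<n. \<Sum>j<n. ?F i j) = (\<Sum>i<n. \<Sum>j<n. ?F j i)" by (rule sum.swap)
  ultimately have "2 * (\<Sum>i\<in>S. \<Sum>j\<in>T. d i j) = (\<Sum>i<n. \<Sum>j<n. ?F i j + ?F j i)" by (simp add: sum.distrib)
  also have "\<dots> = (\<Sum>p\<in>upper_idx n. (if fst p < snd p then 2 else 1) * (?F (fst p) (snd p) + ?F (snd p) (fst p)))"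
    by (rule sum_upper_idx) simp
  also have "\<dots> = (\<Sum>p\<in>upper_idx n. 2 * (rect_coef S T p * d (fst p) (snd p)))"
  proof (intro sum.cong refl)
    fix p assume "p \<in> upper_idx n"
    then have p: "fst p < n" "snd p < n" "fst p \<le> snd p" by (auto simp: upper_idx_def)
    have "d (snd p) (fst p) = d (fst p) (snd p)" by (rule d[OF p(2,1)])
    then show "(if fst p < snd p then 2 else 1) * (?F (fst p) (snd p) + ?F (snd p) (fst p)) = 2 * (rect_coef S T p * d (fst p) (snd p))"
      using p(3) by (cases "fst p < snd p") (auto simp: rect_coef_def algebra_simps)
  qed
  finally show ?thesis by (simp add: sum_distrib_left[symmetric])
qed

lemma near_kmat2:
  assumes n: "n > 0"
  shows "near e (kmat n X) (kmat n X') \<longleftrightarrow> near e (stepk n (symm X)) (stepk n (symm X'))"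
proof -
  have s: "stepk n (symm Z) \<in> kernels" for Z by (rule stepk_kernels) (rule symm_sym)
  have c: "near e k1 k2 \<longleftrightarrow> near e k2 k1" if "k1 \<in> kernels" "k2 \<in> kernels" for k1 k2
    using near_sym that by blast
  have "near e (kmat n X) (kmat n X') \<longleftrightarrow> near e (stepk n (symm X)) (kmat n X')" by (rule near_kmat[OF n kmat_kernels])
  also have "\<dots> \<longleftrightarrow> near e (kmat n X') (stepk n (symm X))" by (rule c[OF s kmat_kernels])
  also have "\<dots> \<longleftrightarrow> near e (stepk n (symm X')) (stepk n (symm X))" by (rule near_kmat[OF n s])
  also have "\<dots> \<longleftrightarrow> near e (stepk n (symm X)) (stepk n (symm X'))" by (rule c[OF s s])
  finally show ?thesis .
qed

text \<open>Rounding strictly towards the mean keeps the Cramer function from growing and lands in the interior of its domain, where a tilt exists; truncation leaves finitely many values, so that one exponent serves for all Chernoff bounds.\<close>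

definition quantize :: "real \<Rightarrow> real \<Rightarrow> nat \<Rightarrow> real \<Rightarrow> real" where
  "quantize m d J a = (if a = m then m else m + sgn (a - m) * (d * real (min J (nat (\<lceil>\<bar>a - m\<bar> / d\<rceil> - 1)))))"

lemma quantize_range: "quantize m d J a \<in> (\<lambda>z. m + d * of_int z) ` {- int J..int J}"
proof (cases "a = m")
  case True then show ?thesis by (auto simp: quantize_def intro!: image_eqI[of _ _ 0])
next
  case False
  let ?k = "min J (nat (\<lceil>\<bar>a - m\<bar> / d\<rceil> - 1))"
  show ?thesis
  proof (cases "a > m")
    case True
    then show ?thesis using False by (intro image_eqI[of _ _ "int ?k"]) (simp_all add: quantize_def)
  next
    case F: False
    then show ?thesis using False by (intro image_eqI[of _ _ "- int ?k"]) (simp_all add: quantize_def)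
  qed
qed

text \<open>\<open>\<lceil>x\<rceil> - 1\<close> is the largest integer strictly below x, which
  gives strictness. When the cap \<open>J\<close> is active, |a - m| exceeds \<open>d * J\<close>,
  so the error is charged to the second moment, as in Chebyshev's inequality.\<close>

lemma quantize_steps:
  fixes a m d :: real and J :: nat
  assumes d: "d > 0" and a: "a \<noteq> m"
  defines "k \<equiv> min J (nat (\<lceil>\<bar>a - m\<bar> / d\<rceil> - 1))"
  shows "d * real k < \<bar>a - m\<bar>" "J > 0 \<Longrightarrow> \<bar>a - m\<bar> - d * real k \<le> d + (a - m)\<^sup>2 / (d * real J)"
proof -
  obtain x where x: "x = \<bar>a - m\<bar> / d" by blast
  have xp: "x > 0" using d a by (simp add: x)
  have c: "\<lceil>x\<rceil> \<ge> 1" using xp by (simp add: one_le_ceiling)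
  have k: "k = min J (nat (\<lceil>x\<rceil> - 1))" by (simp add: k_def x)
  have r: "real (nat (\<lceil>x\<rceil> - 1)) = of_int \<lceil>x\<rceil> - 1" using c by simp
  have "real k \<le> real (nat (\<lceil>x\<rceil> - 1))" by (simp add: k)
  also have "\<dots> < x" unfolding r by linarith
  finally show "d * real k < \<bar>a - m\<bar>" using d by (simp add: x pos_less_divide_eq mult.commute)
  assume J: "J > 0"
  show "\<bar>a - m\<bar> - d * real k \<le> d + (a - m)\<^sup>2 / (d * real J)"
  proof (cases "nat (\<lceil>x\<rceil> - 1) \<le> J")
    case True
    then have "real k = of_int \<lceil>x\<rceil> - 1" using r by (simp add: k)
    then have "x \<le> real k + 1" by linarith
    then have "\<bar>a - m\<bar> \<le> d * (real k + 1)" using d by (simp add: x pos_divide_le_eq mult.commute)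
    moreover have "0 \<le> (a - m)\<^sup>2 / (d * real J)" using d by simp
    ultimately show ?thesis by (simp add: algebra_simps)
  next
    case False
    then have kJ: "k = J" by (simp add: k)
    have Jd: "d * real J < \<bar>a - m\<bar>" using \<open>d * real k < \<bar>a - m\<bar>\<close> kJ by simp
    have "\<bar>a - m\<bar> * (d * real J) \<le> \<bar>a - m\<bar> * \<bar>a - m\<bar>" using Jd by (intro mult_left_mono) auto
    also have "\<bar>a - m\<bar> * \<bar>a - m\<bar> = (a - m)\<^sup>2" by (simp add: power2_eq_square)
    finally have "\<bar>a - m\<bar> * (d * real J) \<le> (a - m)\<^sup>2" .
    then have "\<bar>a - m\<bar> \<le> (a - m)\<^sup>2 / (d * real J)" using d J by (simp add: pos_le_divide_eq)
    moreover have "0 \<le> d * real k" using d by simp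
    ultimately show ?thesis using d by linarith
  qed
qed

lemma quantize_error:
  assumes d: "d > 0" and J: "J > 0"
  shows "\<bar>quantize m d J a - a\<bar> \<le> d + (a - m)\<^sup>2 / (d * real J)"
proof (cases "a = m")
  case True then show ?thesis using d by (simp add: quantize_def)
next
  case False
  let ?k = "min J (nat (\<lceil>\<bar>a - m\<bar> / d\<rceil> - 1))"
  have "a = m + sgn (a - m) * \<bar>a - m\<bar>" by (simp add: mult_sgn_abs)
  then have "quantize m d J a - a = sgn (a - m) * (d * real ?k - \<bar>a - m\<bar>)"
    using False by (simp add: quantize_def right_diff_distrib)
  then have "\<bar>quantize m d J a - a\<bar> = \<bar>d * real ?k - \<bar>a - m\<bar>\<bar>" using False by (simp add: abs_mult abs_sgn_eq)
  then show ?thesis using quantize_steps[OF d False, of J] J by linarith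
qed

text \<open>In the form that \<open>hh_toward_mean\<close> and \<open>tilt_exists\<close> ask for:
  unless it is the mean, the rounded value lies strictly before \<open>a\<close> on the way from the
  mean.\<close>

lemma quantize_between:
  assumes d: "d > 0"
  shows "quantize m d J a = m \<or> a \<noteq> quantize m d J a \<and> (a - quantize m d J a) * (m - quantize m d J a) \<le> 0"
proof (cases "a = m")
  case True then show ?thesis by (simp add: quantize_def)
next
  case False
  let ?k = "min J (nat (\<lceil>\<bar>a - m\<bar> / d\<rceil> - 1))"
  let ?q = "quantize m d J a" and ?D = "d * real ?k"
  have q: "?q = m + sgn (a - m) * ?D" using False by (simp add: quantize_def)
  have D: "0 \<le> ?D" "?D < \<bar>a - m\<bar>" using d quantize_steps(1)[OF d False, of J] by auto
  show ?thesis
  proof (cases "a > m")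
    case True
    then have "?q = m + ?D" using q by simp
    then show ?thesis using True D by (auto intro: mult_nonneg_nonpos)
  next
    case F: False
    then have "?q = m - ?D" "a < m" using q False by auto
    then show ?thesis using D by (auto intro: mult_nonpos_nonneg)
  qed
qed

context gauss_tail
begin

section \<open>Measurability of open events\<close>

lemma sup_ball_measurable:
  "{Y \<in> space (PP n). \<forall>p\<in>upper_idx n. \<bar>Y p - q p\<bar> < r} \<in> sets (PP n)"
proof -
  have "{Y \<in> space (PP n). \<forall>p\<in>upper_idx n. \<bar>Y p - q p\<bar> < r} = (\<Inter>p\<in>upper_idx n. {Y \<in> space (PP n). \<bar>Y p - q p\<bar> < r}) \<inter> space (PP n)"
    by auto
  also have "\<dots> \<in> sets (PP n)"
  proof (cases "upper_idx n = {}")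
    case False
    have "{Y \<in> space (PP n). \<bar>Y p - q p\<bar> < r} \<in> sets (PP n)" if "p \<in> upper_idx n" for p
      using PP_component_measurable[OF that] by measurable
    then show ?thesis using False by (intro sets.Int sets.finite_INT) auto
  qed simp
  finally show ?thesis .
qed

text \<open>There are finitely many coordinates, so an open set is the union of the countably many
  sup-norm balls with rational centre and radius that it contains.\<close>

lemma open_sup_measurable:
  assumes W: "W \<subseteq> space (PP n)"
    and op: "\<And>X. X \<in> W \<Longrightarrow> \<exists>r>0. \<forall>Y\<in>space (PP n). (\<forall>p\<in>upper_idx n. \<bar>Y p - X p\<bar> < r) \<longrightarrow> Y \<in> W"
  shows "W \<in> sets (PP n)"
proof -
  let ?B = "\<lambda>q r. {Y \<in> space (PP n). \<forall>p\<in>upper_idx n. \<bar>Y p - q p\<bar> < r}"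
  let ?I = "{qr \<in> (upper_idx n \<rightarrow>\<^sub>E \<rat>) \<times> \<rat>. ?B (fst qr) (snd qr) \<subseteq> W}"
  have cnt: "countable ?I"
    by (rule countable_subset[of _ "(upper_idx n \<rightarrow>\<^sub>E \<rat>) \<times> \<rat>"])
       (auto intro!: countable_SIGMA countable_PiE countable_rat)
  have "W = (\<Union>qr\<in>?I. ?B (fst qr) (snd qr))"
  proof (intro subset_antisym subsetI)
    fix X assume X: "X \<in> W"
    from op[OF X] obtain r where r: "r > 0" "\<And>Y. Y \<in> space (PP n) \<Longrightarrow> (\<forall>p\<in>upper_idx n. \<bar>Y p - X p\<bar> < r) \<Longrightarrow> Y \<in> W"
      by blast
    obtain \<rho> where rho: "\<rho> \<in> \<rat>" "0 < \<rho>" "\<rho> < r / 2" using Rats_dense_in_real[of 0 "r/2"] r(1) by auto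
    have "\<exists>y. y \<in> \<rat> \<and> \<bar>X p - y\<bar> < \<rho>" for p
      using Rats_dense_in_real[of "X p - \<rho>" "X p"] rho(2) by (auto simp: abs_less_iff)
    then obtain q0 where q0: "\<And>p. q0 p \<in> \<rat>" "\<And>p. \<bar>X p - q0 p\<bar> < \<rho>" by metis
    define q where "q = restrict q0 (upper_idx n)"
    have "?B q \<rho> \<subseteq> W"
    proof
      fix Y assume Y: "Y \<in> ?B q \<rho>"
      have "\<bar>Y p - X p\<bar> < r" if "p \<in> upper_idx n" for p
      proof -
        have "\<bar>Y p - q0 p\<bar> < \<rho>" using Y that by (auto simp: q_def)
        then show ?thesis using q0(2)[of p] rho(3) by linarith
      qed
      then show "Y \<in> W" using r(2) Y by blast
    qed
    then have qI: "(q, \<rho>) \<in> ?I" using rho q0 by (auto simp: q_def)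
    have "X \<in> ?B q \<rho>" using X W q0(2) by (auto simp: q_def)
    then have "X \<in> ?B (fst (q, \<rho>)) (snd (q, \<rho>))" by (simp only: fst_conv snd_conv)
    then show "X \<in> (\<Union>qr\<in>?I. ?B (fst qr) (snd qr))" by (rule UN_I[OF qI])
  qed blast
  also have "\<dots> \<in> sets (PP n)"
    by (rule sets.countable_UN'[OF cnt]) (use sup_ball_measurable in blast)
  finally show ?thesis .
qed

text \<open>Needed because \<open>Qtil\<close> assigns the value 0 to a non-measurable event.\<close>

lemma open_event_measurable:
  assumes U: "til_open U" and n: "n > 0"
  shows "{X \<in> space (PP n). orbit (kmat n X) \<in> U} \<in> sets (PP n)"
proof (rule open_sup_measurable)
  fix X assume X: "X \<in> {X \<in> space (PP n). orbit (kmat n X) \<in> U}"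
  then obtain e where e: "e > 0" "\<And>v. v \<in> Ktil \<Longrightarrow> dtil (orbit (kmat n X)) v < e \<Longrightarrow> v \<in> U"
    using U unfolding til_open_def by blast
  show "\<exists>r>0. \<forall>Y\<in>space (PP n). (\<forall>p\<in>upper_idx n. \<bar>Y p - X p\<bar> < r) \<longrightarrow> Y \<in> {X \<in> space (PP n). orbit (kmat n X) \<in> U}"
  proof (intro exI[of _ "e / 2"] conjI ballI impI)
    fix Y assume Y: "Y \<in> space (PP n)" "\<forall>p\<in>upper_idx n. \<bar>Y p - X p\<bar> < e / 2"
    have s: "stepk n (symm Z) \<in> kernels" for Z by (rule stepk_kernels) (rule symm_sym)
    have "cut_dist (stepk n (symm X)) (stepk n (symm Y)) \<le> (\<integral>p. \<bar>stepk n (symm X) p - stepk n (symm Y) p\<bar> \<partial>usq)"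
      unfolding cut_dist_kernels[OF s s] by (rule cutn_le_L1) simp
    also have "\<dots> = (\<Sum>i<n. \<Sum>j<n. \<bar>symm X i j - symm Y i j\<bar>) / (real n)\<^sup>2"
      by (rule integral_abs_stepk_diff[OF n])
    also have "\<dots> \<le> (\<Sum>i<n. \<Sum>j<n. e / 2) / (real n)\<^sup>2"
      using Y(2) symm_index by (intro divide_right_mono sum_mono) (auto simp: symm_def abs_minus_commute intro!: less_imp_le)
    also have "\<dots> = e / 2" using n by (simp add: power2_eq_square)
    finally have "near e (stepk n (symm X)) (stepk n (symm Y))" using e(1) by (intro nearI_cut s) simp
    then have "dtil (orbit (kmat n X)) (orbit (kmat n Y)) < e"
      using dtil_less_iff[OF kmat_kernels kmat_kernels] near_kmat2[OF n] by simp
    then show "Y \<in> {X \<in> space (PP n). orbit (kmat n X) \<in> U}" using e(2)[OF orbit_in_Ktil[OF kmat_kernels]] Y by simp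
  qed (use e in simp)
qed simp

text \<open>By \<open>tilt_at\<close> the derivative of \<Lambda> at \<theta> is \<open>b\<close>,
  so the error of the linear approximation is o(t). One-sided t suffice since the sign sits in
  \<open>c\<close>.\<close>

lemma tilt_Lambda:
  assumes tilt: "tilt_at b \<theta>" and \<epsilon>: "\<epsilon> > 0"
  shows "\<forall>\<^sub>F t in at_right 0. \<Lambda> (\<theta> + t * c) \<le> \<Lambda> \<theta> + t * c * b + t * \<epsilon>"
proof -
  let ?g = "\<lambda>s. mgf \<mu> (\<theta> + s) * exp (- (s * b))"
  have g0: "(?g has_real_derivative 0) (at (0 * c))" using tilt by (simp add: tilt_at_def)
  have "((\<lambda>t. t * c) has_real_derivative c) (at 0)" by (auto intro!: derivative_eq_intros)
  from DERIV_chain2[OF g0 this] have d1: "((\<lambda>t. ?g (t * c)) has_real_derivative 0) (at 0)" by simp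
  have "((\<lambda>t. ln (?g (t * c))) has_real_derivative (1 / ?g (0 * c)) * 0) (at 0)"
    by (rule DERIV_chain2[OF DERIV_ln_divide d1]) simp
  then have d2: "((\<lambda>t. ln (?g (t * c))) has_real_derivative 0) (at 0)" by simp
  have ln: "ln (?g (t * c)) = \<Lambda> (\<theta> + t * c) - t * c * b" for t
    by (simp add: \<Lambda>_def ln_mult less_imp_neq[OF mgf_pos, symmetric])
  have "((\<lambda>t. (ln (?g (0 + t * c)) - ln (?g (0 * c))) / t) \<longlongrightarrow> 0) (at 0)"
    using d2 unfolding DERIV_def by simp
  then have "((\<lambda>t. (ln (?g (t * c)) - ln (?g (0 * c))) / t) \<longlongrightarrow> 0) (at_right 0)"
    using filterlim_at_split by auto
  then have "\<forall>\<^sub>F t in at_right 0. (ln (?g (t * c)) - ln (?g (0 * c))) / t < \<epsilon>"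
    using \<epsilon> by (rule order_tendstoD(2))
  then show ?thesis using eventually_at_right_less[of 0]
  proof eventually_elim
    case (elim t)
    then have "ln (?g (t * c)) - ln (?g (0 * c)) < t * \<epsilon>" by (simp add: pos_divide_less_eq mult.commute)
    then show ?case unfolding ln by simp
  qed
qed

text \<open>Exponential Markov under the tilted law: on the event the density may be multiplied by
  \<open>exp (t * (s - \<epsilon> * n^2))\<close>, with s the linear form, and the result is again a
  product of exponentials. Half of \<epsilon> pays for the linearisation of \<Lambda> over the at
  most n^2 entries.\<close>

lemma tilted_tail:
  assumes t: "t > 0" and L: "\<And>p. p \<in> upper_idx n \<Longrightarrow> \<Lambda> (\<theta> p + t * c p) \<le> \<Lambda> (\<theta> p) + t * c p * y p + t * (\<epsilon> / 2)"
    and e: "\<epsilon> \<ge> 0"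
  shows "(\<integral>\<^sup>+X. ennreal (exp (\<Sum>p\<in>upper_idx n. \<theta> p * X p - \<Lambda> (\<theta> p))) *
      indicator {X \<in> space (PP n). \<epsilon> * (real n)\<^sup>2 \<le> (\<Sum>p\<in>upper_idx n. c p * (X p - y p))} X \<partial>PP n)
    \<le> ennreal (exp (- (t * (\<epsilon> / 2) * (real n)\<^sup>2)))"
proof -
  let ?U = "upper_idx n"
  define K where "K = - (\<Sum>p\<in>?U. \<Lambda> (\<theta> p)) - t * (\<Sum>p\<in>?U. c p * y p) - t * \<epsilon> * (real n)\<^sup>2"
  have "(\<integral>\<^sup>+X. ennreal (exp (\<Sum>p\<in>?U. \<theta> p * X p - \<Lambda> (\<theta> p))) *
      indicator {X \<in> space (PP n). \<epsilon> * (real n)\<^sup>2 \<le> (\<Sum>p\<in>?U. c p * (X p - y p))} X \<partial>PP n)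
    \<le> (\<integral>\<^sup>+X. ennreal (exp K) * ennreal (exp (\<Sum>p\<in>?U. (\<theta> p + t * c p) * X p)) \<partial>PP n)"
  proof (intro nn_integral_mono)
    fix X
    let ?s = "\<Sum>p\<in>?U. c p * (X p - y p)"
    show "ennreal (exp (\<Sum>p\<in>?U. \<theta> p * X p - \<Lambda> (\<theta> p))) * indicator {X \<in> space (PP n). \<epsilon> * (real n)\<^sup>2 \<le> (\<Sum>p\<in>?U. c p * (X p - y p))} X
      \<le> ennreal (exp K) * ennreal (exp (\<Sum>p\<in>?U. (\<theta> p + t * c p) * X p))"
    proof (cases "\<epsilon> * (real n)\<^sup>2 \<le> ?s")
      case True
      have "t * (\<epsilon> * (real n)\<^sup>2) \<le> t * ?s" using True t by (intro mult_left_mono) auto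
      moreover have "K + (\<Sum>p\<in>?U. (\<theta> p + t * c p) * X p) = (\<Sum>p\<in>?U. \<theta> p * X p - \<Lambda> (\<theta> p)) + (t * ?s - t * \<epsilon> * (real n)\<^sup>2)"
        by (simp add: K_def sum_subtractf sum.distrib algebra_simps sum_distrib_left)
      ultimately have "(\<Sum>p\<in>?U. \<theta> p * X p - \<Lambda> (\<theta> p)) \<le> K + (\<Sum>p\<in>?U. (\<theta> p + t * c p) * X p)" by simp
      then have "ennreal (exp (\<Sum>p\<in>?U. \<theta> p * X p - \<Lambda> (\<theta> p))) \<le> ennreal (exp (K + (\<Sum>p\<in>?U. (\<theta> p + t * c p) * X p)))"
        by (intro ennreal_leI) simp
      also have "\<dots> = ennreal (exp K) * ennreal (exp (\<Sum>p\<in>?U. (\<theta> p + t * c p) * X p))"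
        by (simp add: exp_add ennreal_mult)
      finally show ?thesis by (auto simp: indicator_def)
    qed simp
  qed
  also have "\<dots> = ennreal (exp K) * (\<integral>\<^sup>+X. ennreal (exp (\<Sum>p\<in>?U. (\<theta> p + t * c p) * X p)) \<partial>PP n)"
    by (rule nn_integral_cmult) measurable
  also have "\<dots> = ennreal (exp K) * ennreal (exp (\<Sum>p\<in>?U. \<Lambda> (\<theta> p + t * c p)))" by (simp only: nn_integral_exp_PP)
  also have "\<dots> = ennreal (exp (K + (\<Sum>p\<in>?U. \<Lambda> (\<theta> p + t * c p))))" by (simp add: exp_add ennreal_mult)
  also have "\<dots> \<le> ennreal (exp (- (t * (\<epsilon> / 2) * (real n)\<^sup>2)))"
  proof (intro ennreal_leI)
    have "(\<Sum>p\<in>?U. \<Lambda> (\<theta> p + t * c p)) \<le> (\<Sum>p\<in>?U. \<Lambda> (\<theta> p) + t * c p * y p + t * (\<epsilon> / 2))" by (intro sum_mono L)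
    also have "\<dots> = (\<Sum>p\<in>?U. \<Lambda> (\<theta> p)) + t * (\<Sum>p\<in>?U. c p * y p) + real (card ?U) * (t * (\<epsilon> / 2))"
      by (simp add: sum.distrib sum_distrib_left mult.assoc)
    also have "real (card ?U) * (t * (\<epsilon> / 2)) \<le> (real n)\<^sup>2 * (t * (\<epsilon> / 2))"
      using card_upper_idx[of n] t e by (intro mult_right_mono) (auto simp flip: of_nat_power)
    finally show "exp (K + (\<Sum>p\<in>?U. \<Lambda> (\<theta> p + t * c p))) \<le> exp (- (t * (\<epsilon> / 2) * (real n)\<^sup>2))"
      by (simp add: K_def algebra_simps)
  qed
  finally show ?thesis .
qed

lemma tilted_total:
  "(\<integral>\<^sup>+X. ennreal (exp (\<Sum>p\<in>upper_idx n. \<theta> p * X p - \<Lambda> (\<theta> p))) \<partial>PP n) = 1"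
proof -
  have "(\<integral>\<^sup>+X. ennreal (exp (\<Sum>p\<in>upper_idx n. \<theta> p * X p - \<Lambda> (\<theta> p))) \<partial>PP n) =
     (\<integral>\<^sup>+X. ennreal (exp (- (\<Sum>p\<in>upper_idx n. \<Lambda> (\<theta> p)))) * ennreal (exp (\<Sum>p\<in>upper_idx n. \<theta> p * X p)) \<partial>PP n)"
    by (simp add: sum_subtractf ennreal_mult[symmetric] flip: exp_add)
  also have "\<dots> = ennreal (exp (- (\<Sum>p\<in>upper_idx n. \<Lambda> (\<theta> p)))) * ennreal (exp (\<Sum>p\<in>upper_idx n. \<Lambda> (\<theta> p)))"
    by (subst nn_integral_cmult) (simp_all only: nn_integral_exp_PP, measurable)
  also have "\<dots> = 1" by (simp add: ennreal_mult[symmetric] flip: exp_add)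
  finally show ?thesis .
qed

text \<open>The first condition puts the matrix near the target; the second bounds the tilted
  density from above on the event, so that tilted probability can be converted back.\<close>

definition good_event :: "nat \<Rightarrow> real \<Rightarrow> (nat \<Rightarrow> nat \<Rightarrow> real) \<Rightarrow> (nat \<times> nat \<Rightarrow> real) \<Rightarrow> (nat \<times> nat \<Rightarrow> real) set" where
  "good_event n \<epsilon> Y \<theta> = {X \<in> space (PP n). cut_close \<epsilon> n (symm X) Y \<and>
     (\<Sum>p\<in>upper_idx n. \<theta> p * (X p - Y (fst p) (snd p))) \<le> \<epsilon> * (real n)\<^sup>2}"

text \<open>Both defining conditions bound linear forms in the entries, namely signed rectangles and
  the tilt itself. A failure is thus a deviation of one form from a family of at most
  \<open>3 * 4 ^ n\<close>.\<close>

lemma good_event_cover: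
  assumes Y: "\<And>i j. i < n \<Longrightarrow> j < n \<Longrightarrow> Y i j = Y j i"
    and X: "X \<in> space (PP n)" "X \<notin> good_event n \<epsilon> Y \<theta>"
  shows "\<exists>c\<in>insert \<theta> ((\<lambda>(s, S, T) p. s * rect_coef S T p) ` ({-1, 1} \<times> Pow {..<n} \<times> Pow {..<n})).
    \<epsilon> * (real n)\<^sup>2 \<le> (\<Sum>p\<in>upper_idx n. c p * (X p - Y (fst p) (snd p)))"
proof (cases "cut_close \<epsilon> n (symm X) Y")
  case True
  then show ?thesis using X by (auto simp: good_event_def)
next
  case False
  then obtain S T where ST: "S \<subseteq> {..<n}" "T \<subseteq> {..<n}" "\<epsilon> * (real n)\<^sup>2 < \<bar>\<Sum>i\<in>S. \<Sum>j\<in>T. symm X i j - Y i j\<bar>"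
    unfolding cut_close_def not_all not_imp not_le by blast
  have r: "(\<Sum>i\<in>S. \<Sum>j\<in>T. symm X i j - Y i j) = (\<Sum>p\<in>upper_idx n. rect_coef S T p * (X p - Y (fst p) (snd p)))"
  proof -
    have "(\<Sum>i\<in>S. \<Sum>j\<in>T. symm X i j - Y i j) = (\<Sum>p\<in>upper_idx n. rect_coef S T p * (symm X (fst p) (snd p) - Y (fst p) (snd p)))"
      by (rule sum_rect_upper[OF ST(1,2)]) (use Y symm_sym[of X] in simp)
    then show ?thesis by (simp add: symm_upper)
  qed
  let ?s = "if (\<Sum>i\<in>S. \<Sum>j\<in>T. symm X i j - Y i j) < 0 then -1 else 1 :: real"
  have "\<epsilon> * (real n)\<^sup>2 \<le> ?s * (\<Sum>i\<in>S. \<Sum>j\<in>T. symm X i j - Y i j)" using ST(3) by auto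
  also have "\<dots> = (\<Sum>p\<in>upper_idx n. (?s * rect_coef S T p) * (X p - Y (fst p) (snd p)))"
    unfolding r sum_distrib_left mult.assoc ..
  finally have f: "\<epsilon> * (real n)\<^sup>2 \<le> (\<Sum>p\<in>upper_idx n. (?s * rect_coef S T p) * (X p - Y (fst p) (snd p)))" .
  have "(\<lambda>p. ?s * rect_coef S T p) \<in> (\<lambda>(s, S, T) p. s * rect_coef S T p) ` ({-1, 1} \<times> Pow {..<n} \<times> Pow {..<n})"
    by (rule image_eqI[of _ _ "(?s, S, T)"]) (use ST in auto)
  from bexI[where P = "\<lambda>c. \<epsilon> * (real n)\<^sup>2 \<le> (\<Sum>p\<in>upper_idx n. c p * (X p - Y (fst p) (snd p)))", OF f insertI2[OF this]]
  show ?thesis .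
qed

lemma good_event_measurable:
  assumes Y: "\<And>i j. i < n \<Longrightarrow> j < n \<Longrightarrow> Y i j = Y j i"
  shows "good_event n \<epsilon> Y \<theta> \<in> sets (PP n)"
proof -
  let ?P = "\<lambda>S T X. \<bar>\<Sum>p\<in>upper_idx n. rect_coef S T p * (X p - Y (fst p) (snd p))\<bar> \<le> \<epsilon> * (real n)\<^sup>2"
  have r: "(\<Sum>i\<in>S. \<Sum>j\<in>T. symm X i j - Y i j) = (\<Sum>p\<in>upper_idx n. rect_coef S T p * (X p - Y (fst p) (snd p)))"
    if "S \<subseteq> {..<n}" "T \<subseteq> {..<n}" for S T X
  proof -
    have "(\<Sum>i\<in>S. \<Sum>j\<in>T. symm X i j - Y i j) = (\<Sum>p\<in>upper_idx n. rect_coef S T p * (symm X (fst p) (snd p) - Y (fst p) (snd p)))"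
      by (rule sum_rect_upper[OF that]) (use Y symm_sym[of X] in simp)
    then show ?thesis by (simp add: symm_upper)
  qed
  have "good_event n \<epsilon> Y \<theta> = (\<Inter>ST\<in>Pow {..<n} \<times> Pow {..<n}. {X \<in> space (PP n). ?P (fst ST) (snd ST) X}) \<inter>
     {X \<in> space (PP n). (\<Sum>p\<in>upper_idx n. \<theta> p * (X p - Y (fst p) (snd p))) \<le> \<epsilon> * (real n)\<^sup>2}"
    unfolding good_event_def cut_close_def using r by auto
  also have "\<dots> \<in> sets (PP n)"
  proof (intro sets.Int sets.finite_INT)
    show "{X \<in> space (PP n). ?P (fst ST) (snd ST) X} \<in> sets (PP n)" for ST by measurable
    show "{X \<in> space (PP n). (\<Sum>p\<in>upper_idx n. \<theta> p * (X p - Y (fst p) (snd p))) \<le> \<epsilon> * (real n)\<^sup>2} \<in> sets (PP n)"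
      by measurable
  qed auto
  finally show ?thesis .
qed

end

context gauss_tail
begin

text \<open>Change of measure: the tilted density integrates to 1, the failures carry little of it,
  and on the good event it is at most the exponential factor. The admissible values of
  \<open>c\<close> are the coefficients of signed rectangles and of the tilt.\<close>

lemma good_event_prob:
  assumes Y: "\<And>i j. i < n \<Longrightarrow> j < n \<Longrightarrow> Y i j = Y j i" and t: "t > 0" and e: "\<epsilon> > 0"
    and L: "\<And>p c. p \<in> upper_idx n \<Longrightarrow> c \<in> {-2, -1, 0, 1, 2, \<theta> p} \<Longrightarrow>
       \<Lambda> (\<theta> p + t * c) \<le> \<Lambda> (\<theta> p) + t * c * Y (fst p) (snd p) + t * (\<epsilon> / 2)"
  shows "1 - 3 * 4 ^ n * exp (- (t * (\<epsilon> / 2) * (real n)\<^sup>2)) \<le>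
    exp ((\<Sum>p\<in>upper_idx n. \<theta> p * Y (fst p) (snd p) - \<Lambda> (\<theta> p)) + \<epsilon> * (real n)\<^sup>2) * measure (PP n) (good_event n \<epsilon> Y \<theta>)"
proof -
  interpret P: prob_space "PP n" by (rule prob_space_PP)
  let ?U = "upper_idx n"
  let ?y = "\<lambda>p. Y (fst p) (snd p)"
  let ?D = "\<lambda>X. ennreal (exp (\<Sum>p\<in>?U. \<theta> p * X p - \<Lambda> (\<theta> p)))"
  let ?G = "good_event n \<epsilon> Y \<theta>"
  let ?F = "insert \<theta> ((\<lambda>(s, S, T) p. s * rect_coef S T p) ` ({-1, 1} \<times> Pow {..<n} \<times> Pow {..<n}))"
  let ?B = "\<lambda>c. {X \<in> space (PP n). \<epsilon> * (real n)\<^sup>2 \<le> (\<Sum>p\<in>?U. c p * (X p - ?y p))}"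
  let ?E = "exp ((\<Sum>p\<in>?U. \<theta> p * ?y p - \<Lambda> (\<theta> p)) + \<epsilon> * (real n)\<^sup>2)"
  let ?q = "exp (- (t * (\<epsilon> / 2) * (real n)\<^sup>2))"
  have fin: "finite ?F" by auto
  have Gm: "?G \<in> sets (PP n)" by (rule good_event_measurable[OF Y])
  have Dm [measurable]: "?D \<in> borel_measurable (PP n)" by measurable
  have Bm: "?B c \<in> sets (PP n)" for c by measurable
  have cardF: "card ?F \<le> 3 * 4 ^ n"
  proof -
    have "card ?F \<le> Suc (card ((\<lambda>(s, S, T) p. s * rect_coef S T p) ` ({-1, 1 :: real} \<times> Pow {..<n} \<times> Pow {..<n})))"
      by (rule card_insert_le_m1) auto
    also have "\<dots> \<le> Suc (card ({-1, 1 :: real} \<times> Pow {..<n} \<times> Pow {..<n}))"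
      by (intro Suc_leI le_imp_less_Suc card_image_le) auto
    also have "\<dots> = Suc (2 * 4 ^ n)" by (simp add: card_cartesian_product card_Pow flip: power_mult_distrib)
    also have "\<dots> \<le> 3 * 4 ^ n" using one_le_power[of "4::nat" n] by linarith
    finally show ?thesis .
  qed
  have tail: "(\<integral>\<^sup>+X. ?D X * indicator (?B c) X \<partial>PP n) \<le> ennreal ?q" if c: "c \<in> ?F" for c
  proof (rule tilted_tail[OF t])
    fix p assume p: "p \<in> ?U"
    have "c p \<in> {-2, -1, 0, 1, 2, \<theta> p}"
    proof (cases "c = \<theta>")
      case False
      then obtain s S T where "c = (\<lambda>p. s * rect_coef S T p)" "s \<in> {-1, 1}" using c by auto
      then show ?thesis using rect_coef_range[of S T p] by auto
    qed simp
    then show "\<Lambda> (\<theta> p + t * c p) \<le> \<Lambda> (\<theta> p) + t * c p * ?y p + t * (\<epsilon> / 2)" by (rule L[OF p])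
  qed (use e in simp)
  have "(1 :: ennreal) = (\<integral>\<^sup>+X. ?D X \<partial>PP n)" by (rule tilted_total[symmetric])
  also have "\<dots> \<le> (\<integral>\<^sup>+X. ?D X * indicator ?G X + (\<Sum>c\<in>?F. ?D X * indicator (?B c) X) \<partial>PP n)"
  proof (rule nn_integral_mono)
    fix X assume X: "X \<in> space (PP n)"
    show "?D X \<le> ?D X * indicator ?G X + (\<Sum>c\<in>?F. ?D X * indicator (?B c) X)"
    proof (cases "X \<in> ?G")
      case True then show ?thesis by simp
    next
      case False
      obtain c where c: "c \<in> ?F" "\<epsilon> * (real n)\<^sup>2 \<le> (\<Sum>p\<in>?U. c p * (X p - ?y p))"
        using good_event_cover[OF Y X False] by blast
      then have "?D X = ?D X * indicator (?B c) X" using X by simp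
      also have "\<dots> \<le> (\<Sum>c\<in>?F. ?D X * indicator (?B c) X)"
        using member_le_sum[OF c(1), of "\<lambda>c. ?D X * indicator (?B c) X"] fin by simp
      finally show ?thesis by (simp add: add_increasing)
    qed
  qed
  also have "\<dots> = (\<integral>\<^sup>+X. ?D X * indicator ?G X \<partial>PP n) + (\<Sum>c\<in>?F. \<integral>\<^sup>+X. ?D X * indicator (?B c) X \<partial>PP n)"
  proof -
    have m1: "(\<lambda>X. ?D X * indicator ?G X) \<in> borel_measurable (PP n)" using Gm by measurable
    have m2: "(\<lambda>X. ?D X * indicator (?B c) X) \<in> borel_measurable (PP n)" for c using Bm[of c] by measurable
    show ?thesis
      unfolding nn_integral_add[OF m1 borel_measurable_sum[OF m2]] nn_integral_sum[OF m2] ..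
  qed
  also have "\<dots> \<le> ennreal ?E * emeasure (PP n) ?G + (\<Sum>c\<in>?F. ennreal ?q)"
  proof (intro add_mono sum_mono tail)
    have "(\<integral>\<^sup>+X. ?D X * indicator ?G X \<partial>PP n) \<le> (\<integral>\<^sup>+X. ennreal ?E * indicator ?G X \<partial>PP n)"
    proof (intro nn_integral_mono)
      fix X
      show "?D X * indicator ?G X \<le> ennreal ?E * indicator ?G X"
      proof (cases "X \<in> ?G")
        case True
        then have "(\<Sum>p\<in>?U. \<theta> p * (X p - ?y p)) \<le> \<epsilon> * (real n)\<^sup>2" by (simp add: good_event_def)
        then have "(\<Sum>p\<in>?U. \<theta> p * X p - \<Lambda> (\<theta> p)) \<le> (\<Sum>p\<in>?U. \<theta> p * ?y p - \<Lambda> (\<theta> p)) + \<epsilon> * (real n)\<^sup>2"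
          by (simp add: sum_subtractf right_diff_distrib)
        then show ?thesis by (intro mult_right_mono ennreal_leI) auto
      qed simp
    qed
    also have "\<dots> = ennreal ?E * emeasure (PP n) ?G" by (rule nn_integral_cmult_indicator[OF Gm])
    finally show "(\<integral>\<^sup>+X. ?D X * indicator ?G X \<partial>PP n) \<le> ennreal ?E * emeasure (PP n) ?G" .
  qed
  also have "\<dots> = ennreal (?E * measure (PP n) ?G + real (card ?F) * ?q)"
    by (simp add: P.emeasure_eq_measure ennreal_mult ennreal_of_nat_eq_real_of_nat)
  finally have "1 \<le> ?E * measure (PP n) ?G + real (card ?F) * ?q"
    by (simp only: ennreal_ge_1)
  moreover have "real (card ?F) * ?q \<le> 3 * 4 ^ n * ?q"
  proof (rule mult_right_mono)
    have "real (card ?F) \<le> real (3 * 4 ^ n)" using cardF by (rule of_nat_mono)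
    then show "real (card ?F) \<le> 3 * 4 ^ n" by simp
  qed simp
  ultimately show ?thesis by linarith
qed

lemma good_event_near:
  assumes n: "n > 0" and k: "k \<in> kernels" and X: "X \<in> good_event n \<epsilon> Y \<theta>"
    and Y: "\<And>i j. i < n \<Longrightarrow> j < n \<Longrightarrow> Y i j = Y j i"
    and d: "\<epsilon> + (\<integral>p. \<bar>stepk n Y p - k p\<bar> \<partial>usq) < e"
  shows "dtil (orbit k) (orbit (kmat n X)) < e"
proof -
  have xk: "stepk n (symm X) \<in> kernels" by (rule stepk_kernels) (rule symm_sym)
  have "cut_dist (stepk n (symm X)) k = cutn (\<lambda>p. stepk n (symm X) p - k p)" by (rule cut_dist_kernels[OF xk k])
  also have "\<dots> = cutn (\<lambda>p. (stepk n (symm X) p - stepk n Y p) + (stepk n Y p - k p))" by simp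
  also have "\<dots> \<le> cutn (\<lambda>p. stepk n (symm X) p - stepk n Y p) + cutn (\<lambda>p. stepk n Y p - k p)"
    by (rule cutn_triangle) (use kernels_integrable[OF k] in simp_all)
  also have "cutn (\<lambda>p. stepk n (symm X) p - stepk n Y p) \<le> \<epsilon>"
    using X by (intro cut_close_imp_cutn[OF n]) (simp add: good_event_def)
  also have "cutn (\<lambda>p. stepk n Y p - k p) \<le> (\<integral>p. \<bar>stepk n Y p - k p\<bar> \<partial>usq)"
    by (rule cutn_le_L1) (use kernels_integrable[OF k] in simp)
  finally have "cut_dist (stepk n (symm X)) k < e" using d by simp
  then have "near e (stepk n (symm X)) k" by (rule nearI_cut[OF xk])
  then have "near e (kmat n X) k" using near_kmat[OF n k] by simp
  then have "near e k (kmat n X)" by (rule near_sym[OF kmat_kernels k])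
  then show ?thesis using dtil_less_iff[OF k kmat_kernels] by simp
qed

text \<open>Averaging over cells and moving toward the mean both keep the rate from growing, so the
  cost of the rounded target stays at most \<open>r\<close>; the unrounded average is the point of
  finite Cramer value beyond it that \<open>tilt_exists\<close> asks for. The L^1 error splits into
  rounding, truncation and averaging.\<close>

lemma quantized_kernel:
  assumes n: "n > 0" and k: "k \<in> kernels" and r: "II k = ennreal r" "r \<ge> 0" and d: "d > 0" and J: "J > 0"
  defines "Y \<equiv> \<lambda>i j. quantize mean d J (avg n k i j)"
  shows "(\<integral>p. \<bar>stepk n Y p - k p\<bar> \<partial>usq) \<le> d + (2 * (r + ln A0) + 2 * mean\<^sup>2) / (d * real J) + (\<integral>p. \<bar>k p - Eavg n k p\<bar> \<partial>usq)"
    and "(\<Sum>i<n. \<Sum>j<n. enn2real (hh (Y i j))) \<le> r * (real n)\<^sup>2"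
    and "\<And>i j. i < n \<Longrightarrow> j < n \<Longrightarrow> hh (Y i j) < \<top> \<and> (\<exists>\<theta>. tilt_at (Y i j) \<theta>)"
proof -
  let ?a = "avg n k"
  have ki: "integrable usq k" by (rule kernels_integrable[OF k])
  have IE: "II (Eavg n k) \<le> ennreal r" using II_Eavg[OF n ki] r by simp
  have IE': "(\<Sum>i<n. \<Sum>j<n. hh (?a i j) * ennreal (1 / (real n)\<^sup>2)) \<le> ennreal r"
    using IE unfolding II_def Eavg_def nn_integral_stepk[OF n] .
  have fina: "hh (?a i j) < \<top>" if ij: "i < n" "j < n" for i j
  proof -
    have "hh (?a i j) * ennreal (1 / (real n)\<^sup>2) \<le> (\<Sum>j<n. hh (?a i j) * ennreal (1 / (real n)\<^sup>2))"
      using member_le_sum[of j "{..<n}" "\<lambda>j. hh (?a i j) * ennreal (1 / (real n)\<^sup>2)"] ij by simp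
    also have "\<dots> \<le> (\<Sum>i<n. \<Sum>j<n. hh (?a i j) * ennreal (1 / (real n)\<^sup>2))"
      using member_le_sum[of i "{..<n}" "\<lambda>i. \<Sum>j<n. hh (?a i j) * ennreal (1 / (real n)\<^sup>2)"] ij by simp
    also have "\<dots> \<le> ennreal r" by (rule IE')
    finally have "hh (?a i j) * ennreal (1 / (real n)\<^sup>2) < \<top>" by (rule order.strict_trans1) simp
    then show ?thesis using n by (auto simp: ennreal_mult_less_top)
  qed
  have btw: "Y i j = mean \<or> ?a i j \<noteq> Y i j \<and> (?a i j - Y i j) * (mean - Y i j) \<le> 0" for i j
    unfolding Y_def by (rule quantize_between[OF d])
  have le: "hh (Y i j) \<le> hh (?a i j)" for i j
    by (rule hh_toward_mean) (use btw[of i j] in auto)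
  show "hh (Y i j) < \<top> \<and> (\<exists>\<theta>. tilt_at (Y i j) \<theta>)" if "i < n" "j < n" for i j
  proof
    show "hh (Y i j) < \<top>" using le fina[OF that] by (rule order.strict_trans1)
    show "\<exists>\<theta>. tilt_at (Y i j) \<theta>" by (rule tilt_exists[of _ "?a i j"]) (use btw[of i j] fina[OF that] in auto)
  qed
  note finY = this
  show "(\<Sum>i<n. \<Sum>j<n. enn2real (hh (Y i j))) \<le> r * (real n)\<^sup>2"
  proof -
    have "ennreal (\<Sum>i<n. \<Sum>j<n. enn2real (hh (Y i j)) / (real n)\<^sup>2) = (\<Sum>i<n. \<Sum>j<n. ennreal (enn2real (hh (Y i j)) / (real n)\<^sup>2))"
      by (simp add: sum_nonneg)
    also have "\<dots> = (\<Sum>i<n. \<Sum>j<n. hh (Y i j) * ennreal (1 / (real n)\<^sup>2))"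
    proof (intro sum.cong refl)
      fix i j assume "i \<in> {..<n}" "j \<in> {..<n}"
      then have "hh (Y i j) = ennreal (enn2real (hh (Y i j)))" using finY[of i j] by simp
      then have "hh (Y i j) * ennreal (1 / (real n)\<^sup>2) = ennreal (enn2real (hh (Y i j)) * (1 / (real n)\<^sup>2))"
        by (metis ennreal_mult enn2real_nonneg zero_le_divide_1_iff zero_le_power2)
      then show "ennreal (enn2real (hh (Y i j)) / (real n)\<^sup>2) = hh (Y i j) * ennreal (1 / (real n)\<^sup>2)" by simp
    qed
    also have "\<dots> \<le> (\<Sum>i<n. \<Sum>j<n. hh (?a i j) * ennreal (1 / (real n)\<^sup>2))"
      by (intro sum_mono mult_right_mono le) simp
    also have "\<dots> \<le> ennreal r" by (rule IE')
    finally have "(\<Sum>i<n. \<Sum>j<n. enn2real (hh (Y i j)) / (real n)\<^sup>2) \<le> r" using r by (simp add: ennreal_le_iff)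
    then show ?thesis using n by (simp add: sum_divide_distrib[symmetric] pos_divide_le_eq)
  qed
  have sqE: "integrable usq (\<lambda>p. (Eavg n k p)\<^sup>2)" "(\<integral>p. (Eavg n k p)\<^sup>2 \<partial>usq) \<le> r + ln A0"
    by (rule II_square[OF Eavg_measurable IE r(2)])+
  \<comment> \<open>The second moment of the averages about the mean, bounded through the quadratic
    growth of the Cramer function, controls the truncation error.\<close>
  have V: "(\<Sum>i<n. \<Sum>j<n. (?a i j - mean)\<^sup>2) / (real n)\<^sup>2 \<le> 2 * (r + ln A0) + 2 * mean\<^sup>2"
  proof -
    have "(\<Sum>i<n. \<Sum>j<n. (?a i j - mean)\<^sup>2) / (real n)\<^sup>2 = (\<integral>p. (Eavg n k p - mean)\<^sup>2 \<partial>usq)"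
      unfolding Eavg_def by (rule integral_stepk_comp[OF n, where \<phi> = "\<lambda>x. (x - mean)\<^sup>2", symmetric]) simp
    also have "\<dots> \<le> (\<integral>p. 2 * (Eavg n k p)\<^sup>2 + 2 * mean\<^sup>2 \<partial>usq)"
    proof (rule integral_mono)
      have e: "(\<lambda>p. (Eavg n k p - mean)\<^sup>2) = (\<lambda>p. (Eavg n k p)\<^sup>2 - 2 * mean * Eavg n k p + mean\<^sup>2)"
        by (auto simp: power2_diff)
      show "integrable usq (\<lambda>p. (Eavg n k p - mean)\<^sup>2)" unfolding e using sqE by simp
      fix p
      have "0 \<le> (Eavg n k p + mean)\<^sup>2" by simp
      then show "(Eavg n k p - mean)\<^sup>2 \<le> 2 * (Eavg n k p)\<^sup>2 + 2 * mean\<^sup>2" by (simp add: power2_diff power2_sum)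
    qed (use sqE in simp)
    also have "\<dots> = 2 * (\<integral>p. (Eavg n k p)\<^sup>2 \<partial>usq) + 2 * mean\<^sup>2" using sqE by (simp add: usq.prob_space[simplified])
    also have "\<dots> \<le> 2 * (r + ln A0) + 2 * mean\<^sup>2" using sqE(2) by (intro add_right_mono mult_left_mono) auto
    finally show ?thesis .
  qed
  have "(\<integral>p. \<bar>stepk n Y p - Eavg n k p\<bar> \<partial>usq) = (\<Sum>i<n. \<Sum>j<n. \<bar>Y i j - ?a i j\<bar>) / (real n)\<^sup>2"
    unfolding Eavg_def by (rule integral_abs_stepk_diff[OF n])
  also have "\<dots> \<le> (\<Sum>i<n. \<Sum>j<n. d + (?a i j - mean)\<^sup>2 / (d * real J)) / (real n)\<^sup>2"
    unfolding Y_def by (intro divide_right_mono sum_mono quantize_error[OF d J]) simp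
  also have "\<dots> = d + ((\<Sum>i<n. \<Sum>j<n. (?a i j - mean)\<^sup>2) / (real n)\<^sup>2) / (d * real J)"
    using n by (simp add: sum.distrib sum_divide_distrib[symmetric] add_divide_distrib power2_eq_square[of "real n"])
  also have "\<dots> \<le> d + (2 * (r + ln A0) + 2 * mean\<^sup>2) / (d * real J)"
    using d by (intro add_left_mono divide_right_mono V) simp
  finally have 1: "(\<integral>p. \<bar>stepk n Y p - Eavg n k p\<bar> \<partial>usq) \<le> d + (2 * (r + ln A0) + 2 * mean\<^sup>2) / (d * real J)" .
  have "(\<integral>p. \<bar>stepk n Y p - k p\<bar> \<partial>usq) \<le> (\<integral>p. \<bar>stepk n Y p - Eavg n k p\<bar> + \<bar>k p - Eavg n k p\<bar> \<partial>usq)"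
    by (rule integral_mono) (use ki in auto)
  also have "\<dots> = (\<integral>p. \<bar>stepk n Y p - Eavg n k p\<bar> \<partial>usq) + (\<integral>p. \<bar>k p - Eavg n k p\<bar> \<partial>usq)"
    using ki by simp
  finally show "(\<integral>p. \<bar>stepk n Y p - k p\<bar> \<partial>usq) \<le> d + (2 * (r + ln A0) + 2 * mean\<^sup>2) / (d * real J) + (\<integral>p. \<bar>k p - Eavg n k p\<bar> \<partial>usq)"
    using 1 by linarith
qed

text \<open>Counting the diagonal fully instead of by half costs at most n H, which is linear in
  n.\<close>

lemma sum_upper_half:
  fixes h :: "nat \<Rightarrow> nat \<Rightarrow> real"
  assumes sym: "\<And>i j. i < n \<Longrightarrow> j < n \<Longrightarrow> h i j = h j i" and H: "\<And>i. i < n \<Longrightarrow> h i i \<le> H"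
  shows "2 * (\<Sum>p\<in>upper_idx n. h (fst p) (snd p)) \<le> (\<Sum>i<n. \<Sum>j<n. h i j) + real n * H"
proof -
  have "2 * (\<Sum>p\<in>upper_idx n. h (fst p) (snd p)) =
    (\<Sum>p\<in>upper_idx n. (if fst p < snd p then 2 else 1) * h (fst p) (snd p)) + (\<Sum>p\<in>upper_idx n. if fst p < snd p then 0 else h (fst p) (snd p))"
    unfolding sum.distrib[symmetric] sum_distrib_left by (intro sum.cong refl) auto
  moreover have "(\<Sum>p\<in>upper_idx n. if fst p < snd p then 0 else h (fst p) (snd p)) = (\<Sum>p\<in>(\<lambda>i. (i, i)) ` {..<n}. h (fst p) (snd p))"
    by (rule sum.mono_neutral_cong_right[OF finite_upper_idx]) (auto simp: upper_idx_def)
  moreover have "(\<Sum>p\<in>(\<lambda>i. (i, i)) ` {..<n}. h (fst p) (snd p)) = (\<Sum>i<n. h i i)"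
    by (subst sum.reindex) (auto simp: inj_on_def)
  moreover have "(\<Sum>i<n. h i i) \<le> real n * H" using sum_mono[of "{..<n}" "\<lambda>i. h i i" "\<lambda>_. H"] H by simp
  moreover have "(\<Sum>i<n. \<Sum>j<n. h i j) = (\<Sum>p\<in>upper_idx n. (if fst p < snd p then 2 else 1) * h (fst p) (snd p))"
    by (rule sum_upper_idx) (rule sym)
  ultimately show ?thesis by linarith
qed

theorem lower_prob:
  assumes U: "til_open U" and k: "k \<in> kernels" "orbit k \<in> U" and s: "rateItil \<mu> (orbit k) < ereal s"
  shows "\<forall>\<^sub>F n in sequentially. exp (- (real n)\<^sup>2 * s) \<le> Qtil \<mu> n U"
proof -
  have rI: "ereal (1 / 2) * enn2ereal (II k) < ereal s" using s rateItil_orbit[OF k(1)] by simp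
  have "II k \<noteq> \<top>"
  proof
    assume "II k = \<top>"
    then show False using rI by (simp add: top_ennreal.rep_eq)
  qed
  then obtain r where r: "II k = ennreal r" "r \<ge> 0" by (cases "II k") auto
  have rs: "r / 2 < s" using rI r by (simp add: enn2ereal_ennreal)
  obtain e where e: "e > 0" "\<And>v. v \<in> Ktil \<Longrightarrow> dtil (orbit k) v < e \<Longrightarrow> v \<in> U"
    using U k(2) unfolding til_open_def by blast
  \<comment> \<open>The first term keeps the matrix within \<open>e\<close> of \<open>k\<close>:
    \<epsilon>, twice \<open>d = e / 8\<close> and an averaging error below \<open>e / 4\<close> add
    up to less than \<open>e\<close>. The second leaves half of the gap \<open>s - r / 2\<close> to
    absorb terms linear in n.\<close>
  define \<epsilon> where "\<epsilon> = min (e / 4) ((s - r / 2) / 2)"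
  have eps: "\<epsilon> > 0" "\<epsilon> \<le> e / 4" "\<epsilon> \<le> (s - r / 2) / 2"
    unfolding \<epsilon>_def using e rs by (simp, simp only: min.cobounded1, simp only: min.cobounded2)
  define d where "d = e / 8"
  have d: "d > 0" using e by (simp add: d_def)
  define V where "V = 2 * (r + ln A0) + 2 * mean\<^sup>2"
  obtain J0 :: nat where J0: "V / (d * d) < real J0" using reals_Archimedean2 by blast
  define J where "J = Suc J0"
  have J: "J > 0" by (simp add: J_def)
  have VJ: "V / (d * real J) \<le> d"
  proof -
    have "V / (d * d) \<le> real J" using J0 by (simp add: J_def)
    then have "V \<le> real J * (d * d)" using d by (simp add: pos_divide_le_eq)
    then show ?thesis using d J by (simp add: pos_divide_le_eq mult_ac)
  qed
  let ?Rng = "(\<lambda>z. mean + d * of_int z) ` {- int J..int J}"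
  \<comment> \<open>All rounded values lie in a finite set that does not depend on n; thus one
    \<open>t\<close> and one bound \<open>H\<close> serve every n and every entry.\<close>
  define B where "B = {b \<in> ?Rng. \<exists>\<theta>. tilt_at b \<theta>}"
  have finB: "finite B" by (simp add: B_def)
  have "\<forall>b\<in>B. \<exists>\<theta>. tilt_at b \<theta>" by (simp add: B_def)
  from bchoice[OF this] obtain \<psi> where vt: "\<And>b. b \<in> B \<Longrightarrow> tilt_at b (\<psi> b)" by blast
  have "\<forall>\<^sub>F t in at_right 0. \<forall>b\<in>B. \<forall>c\<in>{-2, -1, 0, 1, 2, \<psi> b}. \<Lambda> (\<psi> b + t * c) \<le> \<Lambda> (\<psi> b) + t * c * b + t * (\<epsilon> / 2)"
    by (intro eventually_ball_finite ballI finB tilt_Lambda vt) (use eps in auto)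
  then have "\<forall>\<^sub>F t in at_right 0. t > 0 \<and> (\<forall>b\<in>B. \<forall>c\<in>{-2, -1, 0, 1, 2, \<psi> b}. \<Lambda> (\<psi> b + t * c) \<le> \<Lambda> (\<psi> b) + t * c * b + t * (\<epsilon> / 2))"
    by (intro eventually_conj eventually_at_right_less)
  then obtain t where t: "t > 0" "\<And>b c. b \<in> B \<Longrightarrow> c \<in> {-2, -1, 0, 1, 2, \<psi> b} \<Longrightarrow> \<Lambda> (\<psi> b + t * c) \<le> \<Lambda> (\<psi> b) + t * c * b + t * (\<epsilon> / 2)"
    using eventually_happens[of _ "at_right (0::real)"] trivial_limit_at_right_real by blast
  define H where "H = (\<Sum>b\<in>B. enn2real (hh b))"
  have H: "enn2real (hh b) \<le> H" if "b \<in> B" for b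
    unfolding H_def using member_le_sum[OF that, of "\<lambda>b. enn2real (hh b)"] finB by simp
  define Y where "Y n i j = quantize mean d J (avg n k i j)" for n i j
  have ap: "\<forall>\<^sub>F n in sequentially. (\<integral>p. \<bar>k p - Eavg n k p\<bar> \<partial>usq) < e / 4"
    using avg_approx_integrable[OF kernels_integrable[OF k(1)]] e(1) unfolding avg_approx_def
    by (intro order_tendstoD(2)) auto
  have ev1: "\<forall>\<^sub>F n in sequentially. exp (real n * ln 4 - (real n)\<^sup>2 * (t * (\<epsilon> / 2) / 2)) \<le> 1 / 2"
    by (rule exp_quadratic_eventually) (use t eps in simp)
  have ev2: "\<forall>\<^sub>F n in sequentially. exp (real n * ln 6 - (real n)\<^sup>2 * (t * (\<epsilon> / 2) / 2)) \<le> 1 / 2"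
    by (rule exp_quadratic_eventually) (use t eps in simp)
  have ev3: "\<forall>\<^sub>F n in sequentially. exp (real n * (H / 2) - (real n)\<^sup>2 * (s - r / 2 - \<epsilon>)) \<le> 1 / 2"
    by (rule exp_quadratic_eventually) (use eps(3) rs in \<open>simp add: field_simps\<close>)
  have ev0: "\<forall>\<^sub>F n in sequentially. (n :: nat) > 0" by (rule eventually_gt_at_top)
  show ?thesis using ap ev1 ev2 ev3 ev0
  proof eventually_elim
    case (elim n)
    note n = elim(5)
    interpret P: prob_space "PP n" by (rule prob_space_PP)
    note qk = quantized_kernel[OF n k(1) r d J, folded Y_def]
    have Ysym: "Y n i j = Y n j i" for i j unfolding Y_def avg_sym[OF k(1), of n i j] ..
    have YB: "Y n i j \<in> B" if "i < n" "j < n" for i j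
      using qk(3)[OF that] quantize_range[of mean d J "avg n k i j"] by (simp add: B_def Y_def)
    define \<theta> where "\<theta> p = \<psi> (Y n (fst p) (snd p))" for p
    have pU: "Y n (fst p) (snd p) \<in> B" if "p \<in> upper_idx n" for p
      using that YB by (auto simp: upper_idx_def)
    let ?G = "good_event n \<epsilon> (Y n) \<theta>"
    let ?v = "\<Sum>p\<in>upper_idx n. \<theta> p * Y n (fst p) (snd p) - \<Lambda> (\<theta> p)"
    let ?q = "exp (- (t * (\<epsilon> / 2) * (real n)\<^sup>2))"
    have G: "1 - 3 * 4 ^ n * ?q \<le> exp (?v + \<epsilon> * (real n)\<^sup>2) * measure (PP n) ?G"
    proof (rule good_event_prob[OF Ysym t(1) eps(1)])
      fix p c assume p: "p \<in> upper_idx n" "c \<in> {-2, -1, 0, 1, 2, \<theta> p}"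
      show "\<Lambda> (\<theta> p + t * c) \<le> \<Lambda> (\<theta> p) + t * c * Y n (fst p) (snd p) + t * (\<epsilon> / 2)"
        unfolding \<theta>_def by (rule t(2)[OF pU[OF p(1)]]) (use p(2) in \<open>simp add: \<theta>_def\<close>)
    qed
    \<comment> \<open>The exponent of \<open>?q\<close> is split in two halves, one beating
      \<open>4 ^ n\<close> and the other the constant 6, bounded by \<open>6 ^ n\<close>.\<close>
    have small: "3 * 4 ^ n * ?q \<le> 1 / 2"
    proof -
      have e4: "(4 :: real) ^ n = exp (real n * ln 4)" by (simp add: exp_of_nat_mult)
      have e6: "(6 :: real) \<le> exp (real n * ln 6)"
        using power_increasing[of 1 n "6 :: real"] n by (simp add: exp_of_nat_mult)
      let ?h = "(real n)\<^sup>2 * (t * (\<epsilon> / 2) / 2)"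
      have "?q = exp (- ?h) * exp (- ?h)" by (simp flip: exp_add add: algebra_simps)
      then have "6 * 4 ^ n * ?q = (6 * exp (- ?h)) * (exp (real n * ln 4) * exp (- ?h))" by (simp add: e4)
      also have "\<dots> \<le> (exp (real n * ln 6) * exp (- ?h)) * (exp (real n * ln 4) * exp (- ?h))"
        by (intro mult_right_mono e6) auto
      also have "\<dots> = exp (real n * ln 6 - ?h) * exp (real n * ln 4 - ?h)" by (simp flip: exp_add)
      also have "\<dots> \<le> (1 / 2) * (1 / 2)" by (intro mult_mono elim(2,3)) auto
      finally show ?thesis by simp
    qed
    have v: "?v \<le> (real n)\<^sup>2 * (r / 2) + real n * (H / 2)"
    proof -
      have "?v \<le> (\<Sum>p\<in>upper_idx n. enn2real (hh (Y n (fst p) (snd p))))"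
      proof (rule sum_mono)
        fix p assume "p \<in> upper_idx n"
        then have "fst p < n" "snd p < n" by (auto simp: upper_idx_def)
        then have fin: "hh (Y n (fst p) (snd p)) < \<top>" using qk(3) by blast
        have "ennreal (\<theta> p * Y n (fst p) (snd p) - \<Lambda> (\<theta> p)) \<le> ennreal (enn2real (hh (Y n (fst p) (snd p))))"
          using hh_lower fin by simp
        then show "\<theta> p * Y n (fst p) (snd p) - \<Lambda> (\<theta> p) \<le> enn2real (hh (Y n (fst p) (snd p)))"
          by (simp add: ennreal_le_iff)
      qed
      moreover have "2 * (\<Sum>p\<in>upper_idx n. enn2real (hh (Y n (fst p) (snd p)))) \<le> (\<Sum>i<n. \<Sum>j<n. enn2real (hh (Y n i j))) + real n * H"
        by (rule sum_upper_half[where h = "\<lambda>i j. enn2real (hh (Y n i j))"]) (use Ysym H YB in auto)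
      ultimately show ?thesis using qk(2) by (simp add: mult.commute)
    qed
    have "1 / 2 \<le> exp (?v + \<epsilon> * (real n)\<^sup>2) * measure (PP n) ?G" using G small by linarith
    also have "\<dots> \<le> exp ((real n)\<^sup>2 * (r / 2) + real n * (H / 2) + \<epsilon> * (real n)\<^sup>2) * measure (PP n) ?G"
      using v by (intro mult_right_mono) auto
    finally have pG: "1 / 2 \<le> exp ((real n)\<^sup>2 * (r / 2) + real n * (H / 2) + \<epsilon> * (real n)\<^sup>2) * measure (PP n) ?G" .
    have "exp (- (real n)\<^sup>2 * s) * exp ((real n)\<^sup>2 * (r / 2) + real n * (H / 2) + \<epsilon> * (real n)\<^sup>2)
        = exp (real n * (H / 2) - (real n)\<^sup>2 * (s - r / 2 - \<epsilon>))"
      by (simp flip: exp_add add: algebra_simps)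
    also have "\<dots> \<le> exp ((real n)\<^sup>2 * (r / 2) + real n * (H / 2) + \<epsilon> * (real n)\<^sup>2) * measure (PP n) ?G"
      using elim(4) pG by linarith
    finally have "exp (- (real n)\<^sup>2 * s) \<le> measure (PP n) ?G" by (simp add: mult.commute)
    also have "\<dots> \<le> Qtil \<mu> n U"
      unfolding Qtil_def
    proof (rule P.finite_measure_mono[OF _ open_event_measurable[OF U n]])
      show "?G \<subseteq> {X \<in> space (PP n). orbit (kmat n X) \<in> U}"
      proof
        fix X assume X: "X \<in> ?G"
        have "dtil (orbit k) (orbit (kmat n X)) < e"
        proof (rule good_event_near[OF n k(1) X Ysym])
          show "\<epsilon> + (\<integral>p. \<bar>stepk n (Y n) p - k p\<bar> \<partial>usq) < e"
            using qk(1) elim(1) eps(2) VJ e(1) unfolding V_def d_def by linarith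
        qed
        then have "orbit (kmat n X) \<in> U" by (rule e(2)[OF orbit_in_Ktil[OF kmat_kernels]])
        then show "X \<in> {X \<in> space (PP n). orbit (kmat n X) \<in> U}" using X by (simp add: good_event_def)
      qed
    qed
    finally show "exp (- (real n)\<^sup>2 * s) \<le> Qtil \<mu> n U" .
  qed
qed

end

section \<open>Passage to the logarithmic scale\<close>

lemma elog_upper:
  assumes "n > 0" "q \<le> exp (- (real n)\<^sup>2 * t)"
  shows "elog q / ereal ((real n)\<^sup>2) \<le> - ereal t"
proof (cases "q \<le> 0")
  case True
  then show ?thesis using assms by (simp add: elog_def)
next
  case False
  then have "ln q \<le> ln (exp (- (real n)\<^sup>2 * t))" using assms(2) by (intro ln_mono) auto
  then have "ln q \<le> - (real n)\<^sup>2 * t" by simp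
  then have "ln q / (real n)\<^sup>2 \<le> - t" using assms(1) by (simp add: pos_divide_le_eq mult.commute)
  then show ?thesis using False assms(1) by (simp add: elog_def)
qed

lemma elog_lower:
  assumes "n > 0" "exp (- (real n)\<^sup>2 * s) \<le> q"
  shows "- ereal s \<le> elog q / ereal ((real n)\<^sup>2)"
proof -
  have q: "q > 0" using assms(2) exp_gt_zero[of "- (real n)\<^sup>2 * s"] by linarith
  then have "- (real n)\<^sup>2 * s \<le> ln q" using assms(2) by (simp add: ln_ge_iff)
  then have "- s \<le> ln q / (real n)\<^sup>2" using assms(1) by (simp add: pos_le_divide_eq mult.commute)
  then show ?thesis using q assms(1) by (simp add: elog_def)
qed

theorem theorem1p2:
  fixes \<mu> :: "real measure"
  assumes "prob_space \<mu>"
    and "sets \<mu> = sets borel"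
    and "\<forall>\<theta>>0. integrable \<mu> (\<lambda>x. exp (\<theta> * x\<^sup>2))"
  shows "(\<forall>C. til_closed C \<longrightarrow>
            limsup (\<lambda>n. elog (Qtil \<mu> n C) / ereal ((real n)\<^sup>2))
              \<le> - (INF Ob \<in> C. rateItil \<mu> Ob))
       \<and> (\<forall>U. til_open U \<longrightarrow>
            liminf (\<lambda>n. elog (Qtil \<mu> n U) / ereal ((real n)\<^sup>2))
              \<ge> - (INF Ob \<in> U. rateItil \<mu> Ob))"
proof -
  interpret prob_space \<mu> by (rule assms(1))
  interpret gauss_tail \<mu>
    by standard (use assms(2) assms(3)[rule_format, of 1] in auto)
  show ?thesis
  proof (intro conjI allI impI)
    fix C assume C: "til_closed C"
    let ?L = "limsup (\<lambda>n. elog (Qtil \<mu> n C) / ereal ((real n)\<^sup>2))"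
    have upper: "ereal t \<le> - ?L" if "ereal t < (INF Ob \<in> C. rateItil \<mu> Ob)" for t
    proof -
      have "\<forall>\<^sub>F n in sequentially. elog (Qtil \<mu> n C) / ereal ((real n)\<^sup>2) \<le> - ereal t"
        using upper_prob[OF C that] eventually_gt_at_top[of 0] by eventually_elim (rule elog_upper)
      then have "?L \<le> - ereal t" by (rule Limsup_bounded)
      then show ?thesis using ereal_minus_le_minus[of "- ereal t" ?L] by simp
    qed
    \<comment> \<open>Approaching the infimum by reals from below also covers the value \<infinity>,
      in particular an empty \<open>C\<close>.\<close>
    have "(INF Ob \<in> C. rateItil \<mu> Ob) \<le> - ?L"
    proof (rule dense_le)
      fix z assume z: "z < (INF Ob \<in> C. rateItil \<mu> Ob)"
      show "z \<le> - ?L"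
      proof (cases z)
        case (real t)
        then show ?thesis using upper z by simp
      qed (use z in simp_all)
    qed
    then have "- (- ?L) \<le> - (INF Ob \<in> C. rateItil \<mu> Ob)" by (simp only: ereal_minus_le_minus)
    then show "?L \<le> - (INF Ob \<in> C. rateItil \<mu> Ob)" by (simp only: ereal_uminus_uminus)
  next
    fix U assume U: "til_open U"
    let ?L = "liminf (\<lambda>n. elog (Qtil \<mu> n U) / ereal ((real n)\<^sup>2))"
    \<comment> \<open>Approximation from above makes the claim vacuous at an orbit of infinite
      rate.\<close>
    have "- ?L \<le> rateItil \<mu> Ob" if Ob: "Ob \<in> U" for Ob
    proof (rule dense_ge)
      fix z assume z: "rateItil \<mu> Ob < z"
      obtain k where k: "k \<in> kernels" "Ob = orbit k" using U Ob unfolding til_open_def Ktil_def by blast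
      have lower: "- ?L \<le> ereal s" if s: "rateItil \<mu> (orbit k) < ereal s" for s
      proof -
        have "\<forall>\<^sub>F n in sequentially. - ereal s \<le> elog (Qtil \<mu> n U) / ereal ((real n)\<^sup>2)"
          using lower_prob[OF U k(1) Ob[unfolded k(2)] s] eventually_gt_at_top[of 0] by eventually_elim (rule elog_lower)
        then have "- ereal s \<le> ?L" by (rule Liminf_bounded)
        then show ?thesis using ereal_minus_le_minus[of ?L "- ereal s"] by simp
      qed
      show "- ?L \<le> z"
      proof (cases z)
        case (real s)
        then show ?thesis using lower z k(2) by simp
      qed (use z in simp_all)
    qed
    then have "- ?L \<le> (INF Ob \<in> U. rateItil \<mu> Ob)" by (rule INF_greatest)
    then have "- (INF Ob \<in> U. rateItil \<mu> Ob) \<le> - (- ?L)" by (simp only: ereal_minus_le_minus)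
    then show "- (INF Ob \<in> U. rateItil \<mu> Ob) \<le> ?L" by (simp only: ereal_uminus_uminus)
  qed
qed



end
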